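(* Let $d\ge 1$, let $b:\mathbb{R}^d\to\mathbb{R}^d$ and $\sigma\in\mathbb{R}^{d\times d}$ satisfy Assumption (Coeff), and let $h:\mathbb{R}^d\to\mathbb{R}$ be Lipschitz. There exists $\eta^{\ast}>0$ (sufficiently small) such that for every step-size sequence $\{\eta_k\}_{k\ge1}\subset(0,1)$ satisfying Assumptions (Step-0) and (Step-1) with $\eta_1\le\eta^{\ast}$, and every initial point $x\in\mathbb{R}^d$, the Euler--Maruyama chain $\{\theta_k\}_{k\ge0}$ with $\theta_0=x$ satisfies $$\frac{n}{\sqrt{T_n}}\big[\Pi_n(h)-\pi(h)\big]\Rightarrow \mathcal{N}\big(0,\pi(|\sigma^{\intercal}\nabla\varphi|^2)\big)\quad\text{as } n\to\infty,$$ where $\Rightarrow$ denotes weak convergence and $\varphi$ solves the Poisson equation $h-\pi(h)=\mathcal{A}\varphi$.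
   Context: $|\cdot|$ is the Euclidean norm on vectors and the Frobenius norm on matrices; $A\preceq B$ means $B-A$ is positive semi-definite; $\langle A,B\rangle_{\mathrm{HS}}=\mathrm{tr}(A^{\intercal}B)$; $\pi(f)=\int f\,\mathrm{d}\pi$. Assumption (Coeff): $b$ is continuous; there is $L>0$ with $|b(x)-b(y)|\le L|x-y|$ for all $x,y$; there are $K_1>0$, $K_2\ge0$ with $\langle b(x)-b(y),x-y\rangle\le -K_1|x-y|^2+K_2$ for all $x,y$; $\sigma$ is invertible and there is $K_3>1$ with $K_3^{-1}I_d\preceq\sigma\sigma^{\intercal}\preceq K_3I_d$. SDE: $\mathrm{d}X_t=b(X_t)\,\mathrm{d}t+\sigma\,\mathrm{d}B_t$, $X_0=x$, with $B$ a standard $d$-dimensional Brownian motion. Under (Coeff) it has a unique strong solution and a unique invariant probability measure, denoted $\pi$. Its generator is $\mathcal{A}f(x)=\langle b(x),\nabla f(x)\rangle+\frac12\langle\sigma\sigma^{\intercal},\nabla^2f(x)\rangle_{\mathrm{HS}}$. Euler--Maruyama chain: $\theta_0=x$, $\theta_{k+1}=\theta_k+\eta_{k+1}b(\theta_k)+\sqrt{\eta_{k+1}}\,\sigma\xi_{k+1}$, with $\xi_1,\xi_2,\dots$ i.i.d. $\mathcal{N}(0,I_d)$. Empirical measure: $\Pi_n=\frac1n\sum_{k=0}^{n-1}\delta_{\theta_k}$, so $\Pi_n(h)=\frac1n\sum_{k=0}^{n-1}h(\theta_k)$. Also $T_n=\sum_{k=1}^n\eta_k^{-1}$. Assumption (Step-0):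 $\{\eta_k\}$ is non-increasing, $\sum_{k\ge1}\eta_k=\infty$, and there is $c>0$ with $\eta_{k-1}-\eta_k\le c\,\eta_k^2$ for all $k\ge2$. Assumption (Step-1): for some $0<\epsilon<1$, $\sum_{k\ge1}\eta_k^{2-\epsilon}<\infty$; and there is a sequence $L_n\to\infty$ with $\frac{L_n}{\eta_n\sqrt{T_n}}\to0$ as $n\to\infty$. Poisson equation: $\varphi$ denotes the ($C^2$) solution of $\mathcal{A}\varphi=h-\pi(h)$ for which it is known that, for some $C>0$, $|\nabla^k\varphi(x)|\le C(1+|x|^{k+2})$ for $k=0,1,2$ and $\sup_{0<|y-x|\le1}\frac{|\nabla^2\varphi(x)-\nabla^2\varphi(y)|}{|x-y|}\le C(1+|x|^5)$ for all $x$. *)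

theory Defs
  imports "HOL-Probability.Probability"
begin

section \<open>Matrices, gradients and Hessians\<close>

text \<open>The norm of \<^typ>\<open>real^'n^'n\<close> in the library is the Frobenius norm.\<close>

definition hs_inner :: "real^'n^'m \<Rightarrow> real^'n^'m \<Rightarrow> real" where
  "hs_inner A B = trace (transpose A ** B)"

definition pos_semidef :: "real^'n^'n \<Rightarrow> bool" where
  "pos_semidef A \<longleftrightarrow> transpose A = A \<and> (\<forall>x. 0 \<le> x \<bullet> (A *v x))"

definition loewner_le :: "real^'n^'n \<Rightarrow> real^'n^'n \<Rightarrow> bool" where
  "loewner_le A B \<longleftrightarrow> pos_semidef (B - A)"

definition grad :: "(real^'n \<Rightarrow> real) \<Rightarrow> real^'n \<Rightarrow> real^'n" where
  "grad f x = (THE D. GDERIV f x :> D)"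

definition hess :: "(real^'n \<Rightarrow> real) \<Rightarrow> real^'n \<Rightarrow> real^'n^'n" where
  "hess f x = jacobian (grad f) (at x)"

definition C2 :: "(real^'n \<Rightarrow> real) \<Rightarrow> bool" where
  "C2 f \<longleftrightarrow> (\<forall>x. f differentiable (at x)) \<and> (\<forall>x. grad f differentiable (at x)) \<and>
     continuous_on UNIV (hess f)"

lemma grad_eqI:
  fixes f :: "real^'n \<Rightarrow> real"
  assumes "GDERIV f x :> D"
  shows "grad f x = D"
  unfolding grad_def
proof (rule the_equality)
  show "GDERIV f x :> D" by fact
  fix E assume "GDERIV f x :> E"
  with assms have "(\<lambda>h. inner h D) = (\<lambda>h. inner h E)"
    unfolding gderiv_def by (rule has_derivative_unique)
  then have "inner h E = inner h D" for h by (auto dest: fun_cong[where x = h])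
  then show "E = D" by (metis inner_commute vector_eq_ldot)
qed


section \<open>The stochastic differential equation\<close>

definition coeff_assumption :: "(real^'n \<Rightarrow> real^'n) \<Rightarrow> real^'n^'n \<Rightarrow> bool" where
  "coeff_assumption b \<sigma> \<longleftrightarrow>
     continuous_on UNIV b \<and>
     (\<exists>L>0. \<forall>x y. norm (b x - b y) \<le> L * norm (x - y)) \<and>
     (\<exists>K1>0. \<exists>K2\<ge>0. \<forall>x y. (b x - b y) \<bullet> (x - y) \<le> - K1 * (norm (x - y))\<^sup>2 + K2) \<and>
     invertible \<sigma> \<and>
     (\<exists>K3>1. loewner_le (inverse K3 *\<^sub>R mat 1) (\<sigma> ** transpose \<sigma>) \<and>
             loewner_le (\<sigma> ** transpose \<sigma>) (K3 *\<^sub>R mat 1))"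

text \<open>The density of the Gaussian law with mean \<open>0\<close> and covariance matrix \<open>v\<close> times the identity,
  for \<open>v > 0\<close>.\<close>

definition isotropic_normal_density :: "real \<Rightarrow> real^'n \<Rightarrow> real" where
  "isotropic_normal_density v x = (\<Prod>i\<in>UNIV. normal_density 0 (sqrt v) (x $ i))"

definition standard_brownian_motion :: "'w measure \<Rightarrow> (real \<Rightarrow> 'w \<Rightarrow> real^'n) \<Rightarrow> bool" where
  "standard_brownian_motion W B \<longleftrightarrow>
     prob_space W \<and>
     (\<forall>t\<ge>0. B t \<in> borel_measurable W) \<and>
     (AE \<omega> in W. B 0 \<omega> = 0) \<and>
     (AE \<omega> in W. continuous_on {0..} (\<lambda>t. B t \<omega>)) \<and>
     (\<forall>s t. 0 \<le> s \<and> s < t \<longrightarrow>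
        distributed W lborel (\<lambda>\<omega>. B t \<omega> - B s \<omega>) (isotropic_normal_density (t - s))) \<and>
     (\<forall>(\<tau>::nat \<Rightarrow> real) m. 0 \<le> \<tau> 0 \<and> (\<forall>i<m. \<tau> i \<le> \<tau> (Suc i)) \<longrightarrow>
        prob_space.indep_vars W (\<lambda>_. borel) (\<lambda>i \<omega>. B (\<tau> (Suc i)) \<omega> - B (\<tau> i) \<omega>) {..<m})"

text \<open>The filtration generated by \<open>B\<close>, augmented by the null sets.\<close>

definition augmented_filtration ::
    "'w measure \<Rightarrow> (real \<Rightarrow> 'w \<Rightarrow> real^'n) \<Rightarrow> real \<Rightarrow> 'w measure" where
  "augmented_filtration W B t =
     sigma (space W) ({B s -` A \<inter> space W | s A. 0 \<le> s \<and> s \<le> t \<and> A \<in> sets borel} \<union> null_sets W)"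

text \<open>The noise is additive, so the stochastic integral of the constant matrix \<open>\<sigma>\<close> is
  \<open>\<sigma> B\<^sub>t\<close> and the equation is a pathwise integral equation.\<close>

definition strong_solution ::
    "'w measure \<Rightarrow> (real \<Rightarrow> 'w \<Rightarrow> real^'n) \<Rightarrow> (real^'n \<Rightarrow> real^'n) \<Rightarrow> real^'n^'n \<Rightarrow> real^'n \<Rightarrow>
     (real \<Rightarrow> 'w \<Rightarrow> real^'n) \<Rightarrow> bool" where
  "strong_solution W B b \<sigma> x X \<longleftrightarrow>
     (\<forall>t\<ge>0. X t \<in> borel_measurable (augmented_filtration W B t)) \<and>
     (AE \<omega> in W. continuous_on {0..} (\<lambda>t. X t \<omega>) \<and>
        (\<forall>t\<ge>0. X t \<omega> = x + integral {0..t} (\<lambda>s. b (X s \<omega>)) + \<sigma> *v B t \<omega>))"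

text \<open>Here \<open>X x\<close> is the solution started at \<open>x\<close>, so that the law of \<open>X x t\<close> is the transition
  kernel of the diffusion at time \<open>t\<close>.\<close>

definition invariant_probability_measure ::
    "'w measure \<Rightarrow> (real^'n \<Rightarrow> real \<Rightarrow> 'w \<Rightarrow> real^'n) \<Rightarrow> (real^'n) measure \<Rightarrow> bool" where
  "invariant_probability_measure W X \<mu> \<longleftrightarrow>
     prob_space \<mu> \<and> sets \<mu> = sets borel \<and>
     (\<forall>t\<ge>0. \<forall>A\<in>sets borel.
        (\<integral>\<^sup>+ x. emeasure W {\<omega> \<in> space W. X x t \<omega> \<in> A} \<partial>\<mu>) = emeasure \<mu> A)"

definition generator ::
    "(real^'n \<Rightarrow> real^'n) \<Rightarrow> real^'n^'n \<Rightarrow> (real^'n \<Rightarrow> real) \<Rightarrow> real^'n \<Rightarrow> real" where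
  "generator b \<sigma> f x =
     b x \<bullet> grad f x + 1 / 2 * hs_inner (\<sigma> ** transpose \<sigma>) (hess f x)"

text \<open>The Poisson equation determines \<open>\<phi>\<close> up to an additive constant only within a class of
  functions of controlled growth; the bounds below are the known ones of the solution under
  consideration.\<close>

definition poisson_solution ::
    "(real^'n \<Rightarrow> real^'n) \<Rightarrow> real^'n^'n \<Rightarrow> (real^'n) measure \<Rightarrow> (real^'n \<Rightarrow> real) \<Rightarrow>
     (real^'n \<Rightarrow> real) \<Rightarrow> bool" where
  "poisson_solution b \<sigma> \<mu> h \<phi> \<longleftrightarrow>
     C2 \<phi> \<and>
     (\<forall>x. generator b \<sigma> \<phi> x = h x - integral\<^sup>L \<mu> h) \<and>
     (\<exists>C>0. \<forall>x.
        \<bar>\<phi> x\<bar> \<le> C * (1 + norm x ^ 2) \<and>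
        norm (grad \<phi> x) \<le> C * (1 + norm x ^ 3) \<and>
        norm (hess \<phi> x) \<le> C * (1 + norm x ^ 4) \<and>
        (\<forall>y. 0 < norm (y - x) \<and> norm (y - x) \<le> 1 \<longrightarrow>
           norm (hess \<phi> x - hess \<phi> y) / norm (x - y) \<le> C * (1 + norm x ^ 5)))"


section \<open>The Euler--Maruyama chain\<close>

text \<open>Step sizes and noise variables are indexed from \<open>1\<close>; their values at \<open>0\<close> are never used.\<close>

definition T_sum :: "(nat \<Rightarrow> real) \<Rightarrow> nat \<Rightarrow> real" where
  "T_sum \<eta> n = (\<Sum>k=1..n. inverse (\<eta> k))"

definition step0_assumption :: "(nat \<Rightarrow> real) \<Rightarrow> bool" where
  "step0_assumption \<eta> \<longleftrightarrow>
     (\<forall>k\<ge>1. \<eta> (Suc k) \<le> \<eta> k) \<and>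
     filterlim (\<lambda>n. \<Sum>k=1..n. \<eta> k) at_top sequentially \<and>
     (\<exists>c>0. \<forall>k\<ge>2. \<eta> (k - 1) - \<eta> k \<le> c * (\<eta> k)\<^sup>2)"

definition step1_assumption :: "(nat \<Rightarrow> real) \<Rightarrow> bool" where
  "step1_assumption \<eta> \<longleftrightarrow>
     (\<exists>\<epsilon>. 0 < \<epsilon> \<and> \<epsilon> < 1 \<and> summable (\<lambda>k. \<eta> (Suc k) powr (2 - \<epsilon>))) \<and>
     (\<exists>L::nat \<Rightarrow> real. filterlim L at_top sequentially \<and>
        (\<lambda>n. L n / (\<eta> n * sqrt (T_sum \<eta> n))) \<longlonglongrightarrow> 0)"

definition iid_standard_normal :: "'a measure \<Rightarrow> (nat \<Rightarrow> 'a \<Rightarrow> real^'n) \<Rightarrow> bool" where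
  "iid_standard_normal M \<xi> \<longleftrightarrow>
     prob_space M \<and>
     prob_space.indep_vars M (\<lambda>_. borel) \<xi> {1..} \<and>
     (\<forall>k\<ge>1. distributed M lborel (\<xi> k) (isotropic_normal_density 1))"

primrec euler_maruyama ::
    "(real^'n \<Rightarrow> real^'n) \<Rightarrow> real^'n^'n \<Rightarrow> (nat \<Rightarrow> real) \<Rightarrow> (nat \<Rightarrow> 'a \<Rightarrow> real^'n) \<Rightarrow> real^'n \<Rightarrow>
     nat \<Rightarrow> 'a \<Rightarrow> real^'n" where
  "euler_maruyama b \<sigma> \<eta> \<xi> x 0 \<omega> = x"
| "euler_maruyama b \<sigma> \<eta> \<xi> x (Suc k) \<omega> =
     euler_maruyama b \<sigma> \<eta> \<xi> x k \<omega>
     + \<eta> (Suc k) *\<^sub>R b (euler_maruyama b \<sigma> \<eta> \<xi> x k \<omega>)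
     + sqrt (\<eta> (Suc k)) *\<^sub>R (\<sigma> *v \<xi> (Suc k) \<omega>)"

text \<open>The push-forward of the uniform distribution on the indices \<open>0, \<dots>, n - 1\<close>, i.e. the average
  of the Dirac masses at \<open>\<theta> 0, \<dots>, \<theta> (n - 1)\<close>.\<close>

definition empirical_measure :: "(nat \<Rightarrow> real^'n) \<Rightarrow> nat \<Rightarrow> (real^'n) measure" where
  "empirical_measure \<theta> n = distr (uniform_count_measure {..<n}) borel \<theta>"

lemma integral_empirical_measure:
  fixes h :: "real^'n \<Rightarrow> real"
  assumes [measurable]: "h \<in> borel_measurable borel"
  shows "integral\<^sup>L (empirical_measure \<theta> n) h = 1 / real n * (\<Sum>k<n. h (\<theta> k))"
proof -
  have "integral\<^sup>L (empirical_measure \<theta> n) h = (\<integral>k. h (\<theta> k) \<partial>uniform_count_measure {..<n})"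
    unfolding empirical_measure_def
    by (rule integral_distr) (simp_all add: uniform_count_measure_def)
  also have "\<dots> = 1 / real n * (\<Sum>k<n. h (\<theta> k))"
    by (simp add: integral_uniform_count_measure)
  finally show ?thesis .
qed

text \<open>The law with mean \<open>0\<close> and variance \<open>v \<ge> 0\<close>; for \<open>v = 0\<close> this is the Dirac mass at \<open>0\<close>.\<close>

definition centred_normal :: "real \<Rightarrow> real measure" where
  "centred_normal v = distr std_normal_distribution borel (\<lambda>z. sqrt v * z)"

end

theory Submission
  imports Defs
begin

text \<open>
  Taylor's formula and the Poisson equation turn \<open>\<Sum>\<^sub>k (h (\<theta>\<^sub>k) - \<pi>(h))\<close> into a martingale whose
  increments, given the past, are centred Gaussian with variance \<open>|\<sigma>\<^sup>T \<nabla>\<phi> (\<theta>\<^sub>k)|\<^sup>2 / \<eta>\<^sub>k\<^sub>+\<^sub>1\<close>, plus terms that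
  vanish in \<open>L\<^sup>1\<close> after division by \<open>\<surd>T\<^sub>n\<close>. For Gaussian increments, convergence of the quadratic
  variation to a constant suffices for convergence of the characteristic functions.

  The quadratic variation is a weighted ergodic average along the chain. A step-size independent
  Harnack inequality for the chain, obtained by steering one copy into the other and paying for the
  shift of the Gaussian noise, combines with the drift condition to a contraction in a weighted
  total variation distance (Harris' theorem). The Euler scheme converges pathwise to the diffusion
  as the mesh tends to \<open>0\<close>, so the contraction forces the chain towards the invariant measure of the
  diffusion; no uniqueness of that measure has to be known in advance.
\<close>


section \<open>The standard Gaussian measure\<close>

text \<open>The steps vary and tend to 0, so no single step mixes or contracts by a fixed amount;
  what is uniform is the joint effect of the steps in a window of elapsed time between 1 and 2.
  Transition operators are therefore indexed by lists of step sizes, and the estimates depend on a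
  list through its sum and a bound on its entries only. Dividing the Taylor expansion of a step by
  its size isolates \<open>h - \<pi>(h)\<close> and gives the martingale increments conditional
  variances proportional to \<open>1 / \<eta> (Suc k)\<close>; hence the normalisation
  \<open>T_sum\<close>. The errors match the step-size conditions: summation by parts of the
  increments of \<open>\<phi>\<close> leaves \<open>1 / \<eta> n\<close>, the centred quadratic
  noise is orthogonal and leaves the square root of \<open>n\<close>, and the Taylor remainders
  leave the sum of \<open>sqrt (\<eta> k)\<close>, controlled by square summability. That
  \<open>\<eta> n * sqrt (T_sum \<eta> n)\<close> tends to infinity also makes negligible the
  covariances of positions less than a fixed elapsed time apart. No moment of the invariant measure
  is assumed; those in use are inherited from the chain.\<close>

definition gauss :: "(real^'n) measure" where
  "gauss = density lborel (\<lambda>z. ennreal (isotropic_normal_density 1 z))"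

lemma space_gauss [simp]: "space gauss = UNIV"
  and sets_gauss [simp, measurable_cong]: "sets gauss = sets borel"
  by (simp_all add: gauss_def)

lemma isotropic_normal_density_measurable [measurable]:
  "(isotropic_normal_density v :: real^'n \<Rightarrow> real) \<in> borel_measurable borel"
  unfolding isotropic_normal_density_def by measurable

lemma isotropic_normal_density_nonneg [simp]: "0 \<le> isotropic_normal_density v z"
  by (simp add: isotropic_normal_density_def prod_nonneg)

text \<open>The density is a product over the indices in \<open>'n\<close>, whereas Lebesgue measure
  on \<open>real^'n\<close> is the image of a product over \<open>Basis\<close>; this bijection
  makes the Fubini rules for \<open>lborel\<close> applicable.\<close>

lemma prod_Basis_vec: "(\<Prod>b\<in>(Basis :: (real^'n) set). f b) = (\<Prod>i\<in>UNIV. f (axis i 1))"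
proof -
  have "(Basis :: (real^'n) set) = range (\<lambda>i. axis i 1)"
    by (auto simp: Basis_vec_def)
  moreover have inj: "inj (\<lambda>i. axis i 1 :: real^'n)"
    by (auto simp: inj_on_def axis_eq_axis)
  ultimately show ?thesis
    using prod.reindex[OF inj, of f] by (simp add: o_def)
qed

lemma isotropic_normal_density_Basis:
  "isotropic_normal_density v z = (\<Prod>b\<in>Basis. normal_density 0 (sqrt v) (z \<bullet> b))"
  by (simp add: isotropic_normal_density_def prod_Basis_vec inner_axis)

lemma isotropic_normal_density_eq:
  "isotropic_normal_density 1 (z :: real^'n) =
    (1 / sqrt (2 * pi)) ^ CARD('n) * exp (- (norm z)\<^sup>2 / 2)"
proof -
  have "isotropic_normal_density 1 z = (\<Prod>i\<in>UNIV. (1 / sqrt (2 * pi)) * exp (- (z $ i)\<^sup>2 / 2))"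
    by (simp add: isotropic_normal_density_def std_normal_density_def)
  also have "\<dots> = (1 / sqrt (2 * pi)) ^ CARD('n) * exp (\<Sum>i\<in>UNIV. - (z $ i)\<^sup>2 / 2)"
    by (subst prod.distrib) (simp add: exp_sum)
  also have "(\<Sum>i\<in>UNIV. - (z $ i)\<^sup>2 / 2) = - (norm z)\<^sup>2 / 2"
    by (simp add: norm_vec_def L2_set_def sum_nonneg sum_divide_distrib sum_negf)
  finally show ?thesis .
qed

lemma prob_space_gauss: "prob_space (gauss :: (real^'n) measure)"
proof
  have "emeasure (gauss :: (real^'n) measure) (space gauss) =
      (\<integral>\<^sup>+ z. (\<Prod>b\<in>Basis. ennreal (std_normal_density ((z :: real^'n) \<bullet> b))) \<partial>lborel)"
    by (simp add: gauss_def emeasure_density isotropic_normal_density_Basis prod_ennreal)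
  also have "\<dots> = (\<Prod>b\<in>(Basis :: (real^'n) set). (\<integral>\<^sup>+ x. ennreal (std_normal_density x) \<partial>lborel))"
    by (subst nn_integral_lborel_prod) auto
  also have "(\<integral>\<^sup>+ x. ennreal (std_normal_density x) \<partial>lborel) = 1"
    using prob_space.emeasure_space_1[OF prob_space_normal_density[of 1 0]]
    by (simp add: emeasure_density)
  finally show "emeasure (gauss :: (real^'n) measure) (space gauss) = 1"
    by simp
qed

interpretation gauss: prob_space "gauss :: (real^'n) measure"
  by (rule prob_space_gauss)

section \<open>Characteristic function and polynomial moments\<close>

lemma char_gauss: "(\<integral>z. iexp (a \<bullet> z) \<partial>gauss) = exp (- (norm (a :: real^'n))\<^sup>2 / 2)"
proof -
  interpret product_sigma_finite "\<lambda>_ :: real^'n. lborel :: real measure"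
    by standard
  let ?f = "\<lambda>b x. std_normal_density x *\<^sub>R iexp ((a \<bullet> b) * x)"
  have int: "integrable lborel (?f b)" for b :: "real^'n"
  proof (rule Bochner_Integration.integrable_bound)
    show "integrable lborel (\<lambda>x. std_normal_density x)"
      using integrable_std_normal_moment[of 0] by simp
    show "AE x in lborel. norm (?f b x) \<le> norm (std_normal_density x)"
      by (auto simp: norm_mult)
  qed simp
  have "(\<integral>z. iexp (a \<bullet> z) \<partial>gauss) =
      (\<integral>z. isotropic_normal_density 1 z *\<^sub>R iexp (a \<bullet> z) \<partial>lborel)"
    unfolding gauss_def by (subst integral_density) auto
  \<comment> \<open>Lebesgue measure is the image of the product measure on coordinates, where
    density and exponential both factor; what remains is a product of one-dimensional characteristic
    functions.\<close>
  also have "\<dots> = (\<integral>f. (\<Prod>b\<in>Basis. ?f b (f b)) \<partial>(\<Pi>\<^sub>M b\<in>(Basis :: (real^'n) set). lborel))"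
  proof (subst lborel_eq, subst integral_distr)
    show "(\<integral>f. isotropic_normal_density 1 (\<Sum>b\<in>Basis. f b *\<^sub>R b) *\<^sub>R
          iexp (a \<bullet> (\<Sum>b\<in>Basis. f b *\<^sub>R b)) \<partial>(\<Pi>\<^sub>M b\<in>(Basis :: (real^'n) set). lborel))
        = (\<integral>f. (\<Prod>b\<in>Basis. ?f b (f b)) \<partial>(\<Pi>\<^sub>M b\<in>(Basis :: (real^'n) set). lborel))"
      (is "?L = ?R")
    proof (rule Bochner_Integration.integral_cong[OF refl])
      fix f :: "real^'n \<Rightarrow> real"
      have 1: "(\<Sum>b\<in>Basis. f b *\<^sub>R b) \<bullet> c = f c" if "c \<in> Basis" for c :: "real^'n"
        using that by simp
      have 2: "a \<bullet> (\<Sum>b\<in>Basis. f b *\<^sub>R b) = (\<Sum>b\<in>Basis. (a \<bullet> b) * f b)"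
        by (simp add: inner_sum_right mult.commute)
      have 3: "isotropic_normal_density 1 (\<Sum>b\<in>Basis. f b *\<^sub>R b) =
          (\<Prod>b\<in>(Basis :: (real^'n) set). std_normal_density (f b))"
        unfolding isotropic_normal_density_Basis by (intro prod.cong refl) (simp add: 1)
      show "isotropic_normal_density 1 (\<Sum>b\<in>Basis. f b *\<^sub>R b) *\<^sub>R
          iexp (a \<bullet> (\<Sum>b\<in>Basis. f b *\<^sub>R b)) = (\<Prod>b\<in>Basis. ?f b (f b))"
        unfolding 2 3
        by (simp add: scaleR_conv_of_real prod.distrib of_real_prod of_real_sum exp_sum sum_distrib_left)
    qed
  qed measurable
  also have "\<dots> = (\<Prod>b\<in>(Basis :: (real^'n) set). integral\<^sup>L lborel (?f b))"
    by (rule product_integral_prod) (use int in auto)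
  also have "\<dots> = (\<Prod>b\<in>(Basis :: (real^'n) set). complex_of_real (exp (- (a \<bullet> b)\<^sup>2 / 2)))"
  proof (rule prod.cong[OF refl])
    fix b :: "real^'n"
    have "integral\<^sup>L lborel (?f b) = char std_normal_distribution (a \<bullet> b)"
      unfolding char_def by (subst integral_density) (auto simp: normal_density_nonneg)
    then show "integral\<^sup>L lborel (?f b) = complex_of_real (exp (- (a \<bullet> b)\<^sup>2 / 2))"
      by (simp add: char_std_normal_distribution)
  qed
  also have "\<dots> = of_real (exp (- (norm a)\<^sup>2 / 2))"
    by (simp add: exp_sum[symmetric] sum_negf sum_divide_distrib[symmetric]
        euclidean_inner[of a a, folded power2_eq_square] power2_norm_eq_inner flip: of_real_prod)
  finally show ?thesis by (simp add: of_real_exp)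
qed

text \<open>Characteristic functions identify the law of a linear form, so that moments of linear
  forms reduce to one-dimensional integrals.\<close>

lemma distr_gauss_inner:
  "distr gauss borel (\<lambda>z. a \<bullet> z) = centred_normal ((norm (a :: real^'n))\<^sup>2)"
proof (rule Levy_uniqueness)
  show "real_distribution (distr gauss borel (\<lambda>z. a \<bullet> z))"
    by (rule real_distribution.intro) (auto intro!: gauss.prob_space_distr simp: real_distribution_axioms_def)
  interpret std: prob_space std_normal_distribution
    by (rule prob_space_normal_density) simp
  show "real_distribution (centred_normal ((norm a)\<^sup>2))"
    unfolding centred_normal_def
    by (rule real_distribution.intro) (auto intro!: std.prob_space_distr simp: real_distribution_axioms_def)
  show "char (distr gauss borel (\<lambda>z. a \<bullet> z)) = char (centred_normal ((norm a)\<^sup>2))"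
  proof
    fix t
    have "char (distr gauss borel (\<lambda>z. a \<bullet> z)) t = exp (- (norm (t *\<^sub>R a))\<^sup>2 / 2)"
      unfolding char_def using char_gauss[of "t *\<^sub>R a"] by (subst integral_distr) auto
    moreover have "char (centred_normal ((norm a)\<^sup>2)) t = char std_normal_distribution (t * norm a)"
      unfolding char_def centred_normal_def by (subst integral_distr) (auto simp: mult.assoc)
    ultimately show "char (distr gauss borel (\<lambda>z. a \<bullet> z)) t = char (centred_normal ((norm a)\<^sup>2)) t"
      by (simp add: char_std_normal_distribution power_mult_distrib)
  qed
qed

lemma integral_gauss_inner:
  fixes a :: "real^'n" and f :: "real \<Rightarrow> real"
  assumes [measurable]: "f \<in> borel_measurable borel"
  shows "(\<integral>z. f (a \<bullet> z) \<partial>gauss) = (\<integral>x. f (norm a * x) \<partial>std_normal_distribution)"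
    and "integrable gauss (\<lambda>z. f (a \<bullet> z)) \<longleftrightarrow> integrable std_normal_distribution (\<lambda>x. f (norm a * x))"
proof -
  have "(\<integral>z. f (a \<bullet> z) \<partial>gauss) = integral\<^sup>L (distr gauss borel (\<lambda>z. a \<bullet> z)) f"
    by (subst integral_distr) auto
  then show "(\<integral>z. f (a \<bullet> z) \<partial>gauss) = (\<integral>x. f (norm a * x) \<partial>std_normal_distribution)"
    unfolding distr_gauss_inner centred_normal_def by (subst (asm) integral_distr) auto
  have "integrable gauss (\<lambda>z. f (a \<bullet> z)) \<longleftrightarrow> integrable (distr gauss borel (\<lambda>z. a \<bullet> z)) f"
    by (subst integrable_distr_eq) auto
  then show "integrable gauss (\<lambda>z. f (a \<bullet> z)) \<longleftrightarrow> integrable std_normal_distribution (\<lambda>x. f (norm a * x))"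
    unfolding distr_gauss_inner centred_normal_def by (subst (asm) integrable_distr_eq) auto
qed

lemma gauss_inner_moments:
  fixes a :: "real^'n"
  shows "integrable gauss (\<lambda>z. (a \<bullet> z) ^ k)"
    and "(\<integral>z. a \<bullet> z \<partial>gauss) = 0"
    and "(\<integral>z. (a \<bullet> z)\<^sup>2 \<partial>gauss) = (norm a)\<^sup>2"
proof -
  show "integrable gauss (\<lambda>z. (a \<bullet> z) ^ k)"
    by (subst integral_gauss_inner(2)[of "\<lambda>x. x ^ k"])
      (auto simp: power_mult_distrib intro!: integrable_std_normal_distribution_moment)
  show "(\<integral>z. a \<bullet> z \<partial>gauss) = 0"
    using integral_std_normal_distribution_moment_odd[of 1]
    by (subst integral_gauss_inner(1)[of "\<lambda>x. x"]) auto
  show "(\<integral>z. (a \<bullet> z)\<^sup>2 \<partial>gauss) = (norm a)\<^sup>2"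
    using std_normal_distribution_even_moments(1)[of 1]
    by (subst integral_gauss_inner(1)[of "\<lambda>x. x\<^sup>2"]) (auto simp: power_mult_distrib fact_numeral)
qed

text \<open>The norm is at most the number of coordinates times the largest one, whose power is one
  term of the sum.\<close>

lemma norm_power_le_sum: "norm (z :: real^'n) ^ k \<le> real CARD('n) ^ k * (\<Sum>i\<in>UNIV. \<bar>z $ i\<bar> ^ k)"
proof -
  define m where "m = Max (range (\<lambda>i. \<bar>z $ i\<bar>))"
  have m: "\<bar>z $ i\<bar> \<le> m" for i
    unfolding m_def by (intro Max_ge) auto
  have "m \<in> range (\<lambda>i. \<bar>z $ i\<bar>)"
    unfolding m_def by (rule Max_in) auto
  then obtain j where j: "m = \<bar>z $ j\<bar>"
    by auto
  have "norm z \<le> (\<Sum>i\<in>UNIV. \<bar>z $ i\<bar>)"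
    by (rule norm_le_l1_cart)
  also have "\<dots> \<le> (\<Sum>i\<in>(UNIV :: 'n set). m)"
    by (rule sum_mono) (rule m)
  finally have "norm z ^ k \<le> (real CARD('n) * m) ^ k"
    by (intro power_mono) auto
  also have "\<dots> = real CARD('n) ^ k * \<bar>z $ j\<bar> ^ k"
    by (simp add: power_mult_distrib j)
  also have "\<bar>z $ j\<bar> ^ k \<le> (\<Sum>i\<in>UNIV. \<bar>z $ i\<bar> ^ k)"
    by (rule member_le_sum) auto
  finally show ?thesis by simp
qed

lemma integrable_gauss_norm_power [intro, simp]: "integrable gauss (\<lambda>z :: real^'n. norm z ^ k)"
proof (rule Bochner_Integration.integrable_bound)
  have "integrable gauss (\<lambda>z :: real^'n. \<bar>z $ i\<bar> ^ k)" for i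
    using gauss_inner_moments(1)[of "axis i 1" k] integrable_abs
    by (fastforce simp: inner_axis' power_abs)
  then show "integrable gauss (\<lambda>z :: real^'n. real CARD('n) ^ k * (\<Sum>i\<in>UNIV. \<bar>z $ i\<bar> ^ k))"
    by auto
qed (auto intro!: AE_I2 order_trans[OF norm_power_le_sum abs_ge_self])

text \<open>Polarisation: the product of two coordinates is a quarter of a difference of squares of
  two linear forms.\<close>

lemma gauss_coord:
  "(\<integral>z. (z :: real^'n) $ i * z $ j \<partial>gauss) = (if i = j then 1 else 0)"
  "integrable gauss (\<lambda>z :: real^'n. z $ i * z $ j)"
proof -
  have sq: "integrable gauss (\<lambda>z. (a \<bullet> z)\<^sup>2)" for a :: "real^'n"
    by (rule gauss_inner_moments)
  let ?p = "axis i 1 + axis j 1 :: real^'n" and ?m = "axis i 1 - axis j 1 :: real^'n"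
  have eq: "z $ i * z $ j = ((?p \<bullet> z)\<^sup>2 - (?m \<bullet> z)\<^sup>2) / 4" for z :: "real^'n"
    by (simp add: inner_axis' inner_add_left inner_diff_left) algebra
  show "integrable gauss (\<lambda>z :: real^'n. z $ i * z $ j)"
    unfolding eq using sq by auto
  have "(\<integral>z. (z :: real^'n) $ i * z $ j \<partial>gauss) = ((norm ?p)\<^sup>2 - (norm ?m)\<^sup>2) / 4"
    unfolding eq using sq by (simp add: gauss_inner_moments(3))
  also have "\<dots> = (if i = j then 1 else 0)"
    by (auto simp: power2_norm_eq_inner inner_simps inner_axis_axis)
  finally show "(\<integral>z. (z :: real^'n) $ i * z $ j \<partial>gauss) = (if i = j then 1 else 0)" .
qed

section \<open>Translates of the Gaussian measure\<close>

lemma isotropic_normal_density_shift: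
  "isotropic_normal_density 1 (z + u) =
    isotropic_normal_density 1 z * exp (- (u \<bullet> z) - (norm u)\<^sup>2 / 2)"
  by (simp add: isotropic_normal_density_eq power2_norm_eq_inner inner_simps inner_commute
      exp_add[symmetric] field_simps)

text \<open>Cameron--Martin formula in finite dimension: translation invariance of Lebesgue measure,
  with the quotient of the two densities moved in front of the translated integrand.\<close>

lemma nn_integral_gauss_shift:
  fixes u :: "real^'n"
  assumes [measurable]: "f \<in> borel_measurable borel"
  shows "(\<integral>\<^sup>+ z. f z \<partial>gauss) =
    (\<integral>\<^sup>+ z. ennreal (exp (- (u \<bullet> z) - (norm u)\<^sup>2 / 2)) * f (z + u) \<partial>gauss)"
proof -
  have "(\<integral>\<^sup>+ z. f z \<partial>gauss) = (\<integral>\<^sup>+ z. ennreal (isotropic_normal_density 1 z) * f z \<partial>lborel)"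
    unfolding gauss_def by (subst nn_integral_density) auto
  also have "\<dots> = (\<integral>\<^sup>+ z. ennreal (isotropic_normal_density 1 z) * f z \<partial>(distr lborel borel ((+) u)))"
    by (simp only: lborel_distr_plus)
  also have "\<dots> = (\<integral>\<^sup>+ z. ennreal (isotropic_normal_density 1 (z + u)) * f (z + u) \<partial>lborel)"
    by (subst nn_integral_distr) (auto simp: add.commute)
  also have "\<dots> = (\<integral>\<^sup>+ z. ennreal (isotropic_normal_density 1 z) *
        (ennreal (exp (- (u \<bullet> z) - (norm u)\<^sup>2 / 2)) * f (z + u)) \<partial>lborel)"
    by (simp add: isotropic_normal_density_shift ennreal_mult mult.assoc)
  also have "\<dots> = (\<integral>\<^sup>+ z. ennreal (exp (- (u \<bullet> z) - (norm u)\<^sup>2 / 2)) * f (z + u) \<partial>gauss)"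
    unfolding gauss_def by (subst nn_integral_density) auto
  finally show ?thesis .
qed

text \<open>The relative density of a translate has second moment \<open>exp |u|\<^sup>2\<close>, so the Cauchy--Schwarz
  inequality compares the two integrals.\<close>

lemma integral_gauss_shift_square_le:
  fixes u :: "real^'n"
  assumes [measurable]: "f \<in> borel_measurable borel" and f: "\<And>z. 0 \<le> f z" "\<And>z. f z \<le> c"
  shows "(\<integral>z. f z \<partial>gauss)\<^sup>2 \<le> exp ((norm u)\<^sup>2) * (\<integral>z. (f (z + u))\<^sup>2 \<partial>gauss)"
proof -
  let ?r = "\<lambda>z. exp (- (u \<bullet> z) - (norm u)\<^sup>2 / 2)"
  have c: "0 \<le> c" using f[of 0] by linarith
  have int: "integrable gauss f"
    by (rule gauss.integrable_const_bound[of _ c]) (auto simp: f)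
  have int2: "integrable gauss (\<lambda>z. (f (z + u))\<^sup>2)"
    by (rule gauss.integrable_const_bound[of _ "c\<^sup>2"]) (auto simp: f power_mono)
  have one: "(\<integral>\<^sup>+ z. ennreal (exp (- (v \<bullet> z) - (norm v)\<^sup>2 / 2)) \<partial>gauss) = 1" for v :: "real^'n"
    using nn_integral_gauss_shift[of "\<lambda>_. 1" v] by (simp add: gauss.emeasure_space_1[simplified])
  \<comment> \<open>The square of the relative density for \<open>u\<close> is
    \<open>exp ((norm u)\<^sup>2)\<close> times the relative density for
    \<open>2 *\<^sub>R u\<close>, which has mass 1 by \<open>one\<close>.\<close>
  have r2: "(\<integral>\<^sup>+ z. (ennreal (?r z))\<^sup>2 \<partial>gauss) = ennreal (exp ((norm u)\<^sup>2))"
  proof -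
    have "(ennreal (?r z))\<^sup>2 =
        ennreal (exp ((norm u)\<^sup>2)) * ennreal (exp (- ((2 *\<^sub>R u) \<bullet> z) - (norm (2 *\<^sub>R u))\<^sup>2 / 2))" for z
      by (simp add: ennreal_power ennreal_mult[symmetric] exp_add[symmetric] power2_eq_square algebra_simps)
    then have "(\<integral>\<^sup>+ z. (ennreal (?r z))\<^sup>2 \<partial>gauss) = (\<integral>\<^sup>+ z. ennreal (exp ((norm u)\<^sup>2)) *
        ennreal (exp (- ((2 *\<^sub>R u) \<bullet> z) - (norm (2 *\<^sub>R u))\<^sup>2 / 2)) \<partial>gauss)"
      by (intro nn_integral_cong)
    also have "\<dots> = ennreal (exp ((norm u)\<^sup>2))"
      by (subst nn_integral_cmult) (auto simp only: one mult_1_right, measurable)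
    finally show ?thesis .
  qed
  have "ennreal ((\<integral>z. f z \<partial>gauss)\<^sup>2) = (\<integral>\<^sup>+ z. ennreal (f z) \<partial>gauss)\<^sup>2"
    using int f by (subst nn_integral_eq_integral) (auto simp: ennreal_power integral_nonneg_AE)
  also have "(\<integral>\<^sup>+ z. ennreal (f z) \<partial>gauss) = (\<integral>\<^sup>+ z. ennreal (?r z) * ennreal (f (z + u)) \<partial>gauss)"
    by (rule nn_integral_gauss_shift) auto
  also have "\<dots>\<^sup>2 \<le> (\<integral>\<^sup>+ z. (ennreal (?r z))\<^sup>2 \<partial>gauss) * (\<integral>\<^sup>+ z. (ennreal (f (z + u)))\<^sup>2 \<partial>gauss)"
    by (rule Cauchy_Schwarz_nn_integral) auto
  also have "\<dots> = ennreal (exp ((norm u)\<^sup>2)) * ennreal (\<integral>z. (f (z + u))\<^sup>2 \<partial>gauss)"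
    unfolding r2 using int2 f by (subst nn_integral_eq_integral[symmetric]) (auto simp: ennreal_power)
  finally have "ennreal ((\<integral>z. f z \<partial>gauss)\<^sup>2) \<le>
      ennreal (exp ((norm u)\<^sup>2) * (\<integral>z. (f (z + u))\<^sup>2 \<partial>gauss))"
    by (simp add: ennreal_mult integral_nonneg_AE)
  then show ?thesis
    by (subst (asm) ennreal_le_iff) (auto simp: integral_nonneg_AE)
qed


section \<open>The one-step kernel and its moments\<close>

lemma measure_gauss_UNIV [simp]: "measure (gauss :: (real^'n) measure) UNIV = 1"
  using gauss.prob_space by simp

lemma integrable_gauss_one_plus_norm [intro, simp]:
  "integrable gauss (\<lambda>z :: real^'n. (1 + c * norm z) ^ k)"
  by (subst binomial_ring) (auto simp: power_mult_distrib)

text \<open>Later \<open>a\<close> is the squared norm of the mean of a step and \<open>u\<close>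
  the change of the squared norm caused by the noise, of size \<open>sqrt e\<close>. The point is
  that the remainder carries a full factor \<open>e\<close>, but \<open>1 + a\<close> only to the
  power \<open>q\<close>, one less than the leading power.\<close>

lemma power_add_first_order:
  fixes a u y e :: real
  assumes a: "0 \<le> a" and y: "0 \<le> y" and e: "0 \<le> e" "e \<le> 1"
    and u: "\<bar>u\<bar> \<le> sqrt e * sqrt (1 + a) * y"
  shows "\<bar>(a + u) ^ Suc q - a ^ Suc q - real (Suc q) * a ^ q * u\<bar> \<le>
    (real (Suc q))\<^sup>2 * e * (1 + a) ^ q * (1 + y) ^ Suc q"
proof (induction q)
  case 0
  then show ?case using a y e by simp
next
  case (Suc q)
  let ?r = "\<lambda>q. (a + u) ^ Suc q - a ^ Suc q - real (Suc q) * a ^ q * u"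
  let ?p = "real (Suc q)"
  have u2: "u\<^sup>2 \<le> e * (1 + a) * y\<^sup>2"
  proof -
    have "u\<^sup>2 \<le> (sqrt e * sqrt (1 + a) * y)\<^sup>2"
      using u by (metis abs_ge_zero power2_abs power_mono)
    then show ?thesis using a e by (simp add: power_mult_distrib)
  qed
  have "sqrt e * sqrt (1 + a) * y \<le> 1 * (1 + a) * y"
    using a e y by (intro mult_mono) (auto intro!: real_le_lsqrt simp: power2_eq_square algebra_simps)
  then have au: "\<bar>a + u\<bar> \<le> (1 + a) * (1 + y)"
    using u a y by (simp add: algebra_simps abs_le_iff)
  \<comment> \<open>Multiplying by \<open>a + u\<close> raises the exponent and adds one
    second-order term \<open>u\<^sup>2\<close>, through which the factor \<open>e\<close>
    enters.\<close>
  have eq: "?r (Suc q) = (a + u) * ?r q + ?p * a ^ q * u\<^sup>2"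
    by (simp add: algebra_simps power2_eq_square)
  have "\<bar>?r (Suc q)\<bar> \<le> \<bar>a + u\<bar> * \<bar>?r q\<bar> + ?p * a ^ q * u\<^sup>2"
    unfolding eq using a by (intro order_trans[OF abs_triangle_ineq]) (simp add: abs_mult)
  also have "\<dots> \<le> ((1 + a) * (1 + y)) * (?p\<^sup>2 * e * (1 + a) ^ q * (1 + y) ^ Suc q) +
      ?p * (1 + a) ^ q * (e * (1 + a) * (1 + y) ^ Suc (Suc q))"
  proof (intro add_mono mult_mono order_refl Suc.IH au)
    have "y\<^sup>2 \<le> (1 + y) ^ Suc (Suc q)"
    proof -
      have "y\<^sup>2 \<le> (1 + y)\<^sup>2" using y by (intro power_mono) auto
      also have "\<dots> \<le> (1 + y) ^ Suc (Suc q)" using y by (intro power_increasing) auto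
      finally show ?thesis .
    qed
    then have "e * (1 + a) * y\<^sup>2 \<le> e * (1 + a) * (1 + y) ^ Suc (Suc q)"
      using a e by (intro mult_left_mono) auto
    then show "u\<^sup>2 \<le> e * (1 + a) * (1 + y) ^ Suc (Suc q)" using u2 by linarith
  qed (use a y e in \<open>auto intro!: power_mono\<close>)
  also have "\<dots> = (?p\<^sup>2 + ?p) * (e * (1 + a) ^ Suc q * (1 + y) ^ Suc (Suc q))"
    by (simp add: algebra_simps)
  also have "\<dots> \<le> (real (Suc (Suc q)))\<^sup>2 * (e * (1 + a) ^ Suc q * (1 + y) ^ Suc (Suc q))"
    using a y e by (intro mult_right_mono) (auto simp: power2_eq_square algebra_simps)
  finally show ?case by (simp only: mult.assoc)
qed

lemma lower_power_absorbed:
  fixes c D \<epsilon> :: real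
  assumes "0 < c" "0 \<le> D" "0 < \<epsilon>"
  shows "\<exists>C\<ge>0. \<forall>r\<ge>0. D * (r + c) ^ q \<le> \<epsilon> * r ^ Suc q + C"
proof -
  \<comment> \<open>Above \<open>R\<close> one has \<open>r + c \<le> 2 * r\<close> and
    \<open>D * 2 ^ q \<le> \<epsilon> * r\<close>; below it the left-hand side is at most its value
    at \<open>R\<close>.\<close>
  define R where "R = max c (D * 2 ^ q / \<epsilon>)"
  have "D * (r + c) ^ q \<le> \<epsilon> * r ^ Suc q + D * (R + c) ^ q" if r: "0 \<le> r" for r
  proof (cases "r \<le> R")
    case True
    then have "D * (r + c) ^ q \<le> D * (R + c) ^ q"
      using assms r by (intro mult_left_mono power_mono) auto
    moreover have "0 \<le> \<epsilon> * r ^ Suc q" using assms r by simp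
    ultimately show ?thesis by linarith
  next
    case False
    then have rc: "c \<le> r" and rD: "D * 2 ^ q \<le> \<epsilon> * r"
      using assms by (auto simp: R_def divide_less_eq not_le mult.commute)
    have "D * (r + c) ^ q \<le> D * (2 * r) ^ q"
      using assms r rc by (intro mult_left_mono power_mono) auto
    also have "\<dots> = (D * 2 ^ q) * r ^ q" by (simp add: power_mult_distrib)
    also have "\<dots> \<le> (\<epsilon> * r) * r ^ q" using rD r by (intro mult_right_mono) auto
    finally have "D * (r + c) ^ q \<le> \<epsilon> * r ^ Suc q" by simp
    moreover have "0 \<le> D * (R + c) ^ q"
      using assms by (auto simp: R_def intro!: mult_nonneg_nonneg zero_le_power)
    ultimately show ?thesis by linarith
  qed
  moreover have "0 \<le> D * (R + c) ^ q"
    using assms by (auto simp: R_def intro!: mult_nonneg_nonneg zero_le_power)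
  ultimately show ?thesis by blast
qed

lemma convex_combination_power_le:
  fixes r s t :: real
  assumes "0 \<le> r" "0 \<le> s" "0 \<le> t" "t \<le> 1"
  shows "((1 - t) * r + t * s) ^ Suc q \<le> (1 - t) * r ^ Suc q + t * s ^ Suc q"
proof -
  have "convex_on {0..} (\<lambda>x :: real. x ^ Suc q)"
    using convex_on_subset[OF convex_power_even[of "Suc q"], of "{0..}"] convex_power_odd[of "Suc q"]
    by (cases "even (Suc q)") auto
  from convex_onD[OF this, of t r s] assms show ?thesis
    by simp
qed

section \<open>Transition operators of the Euler chain\<close>

locale em_kernel =
  fixes b :: "real^'n \<Rightarrow> real^'n" and \<sigma> :: "real^'n^'n" and L K1 K2 :: real
  assumes L: "0 < L" and lip: "norm (b x - b y) \<le> L * norm (x - y)"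
    and K1: "0 < K1" and K2: "0 \<le> K2"
    and dissip: "(b x - b y) \<bullet> (x - y) \<le> - K1 * (norm (x - y))\<^sup>2 + K2"
    and inv\<sigma>: "invertible \<sigma>"
begin

definition em_step :: "real \<Rightarrow> real^'n \<Rightarrow> real^'n \<Rightarrow> real^'n" where
  "em_step e x z = x + e *\<^sub>R b x + sqrt e *\<^sub>R (\<sigma> *v z)"

definition K :: "real \<Rightarrow> (real^'n \<Rightarrow> real) \<Rightarrow> real^'n \<Rightarrow> real" where
  "K e f x = (\<integral>z. f (em_step e x z) \<partial>gauss)"

text \<open>The head of the list is the first step taken, so \<open>Kl es f x\<close> is the mean of
  \<open>f\<close> after steps of sizes \<open>es\<close> started at \<open>x\<close>. Concatenation
  of lists is composition of operators.\<close>

definition Kl :: "real list \<Rightarrow> (real^'n \<Rightarrow> real) \<Rightarrow> real^'n \<Rightarrow> real" where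
  "Kl es f = foldr K es f"

lemma Kl_Nil [simp]: "Kl [] f = f" and Kl_Cons [simp]: "Kl (e # es) f = K e (Kl es f)"
  and Kl_append: "Kl (es @ fs) f = Kl es (Kl fs f)"
  by (simp_all add: Kl_def)

text \<open>The integral of a non-integrable function is 0 by convention, so monotonicity and
  additivity of \<open>K\<close> require integrability; this class provides it and is stable under
  \<open>K\<close> for every nonnegative step.\<close>

definition poly_growth :: "nat \<Rightarrow> (real^'n \<Rightarrow> real) \<Rightarrow> bool" where
  "poly_growth p f \<longleftrightarrow> f \<in> borel_measurable borel \<and> (\<exists>c\<ge>0. \<forall>x. \<bar>f x\<bar> \<le> c * (1 + norm x) ^ p)"

lemma continuous_b: "continuous_on UNIV b"
  by (rule lipschitz_on_continuous_on[of L], rule lipschitz_onI) (use lip L in \<open>auto simp: dist_norm\<close>)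

lemma measurable_b [measurable]: "b \<in> borel_measurable borel"
  by (rule borel_measurable_continuous_onI[OF continuous_b])

lemma measurable_mult_vec [measurable]: "(\<lambda>z. (A :: real^'m^'k) *v z) \<in> borel_measurable borel"
  by (intro borel_measurable_continuous_onI linear_continuous_on matrix_vector_mul_bounded_linear)

lemma measurable_em_step [measurable (raw)]:
  assumes [measurable]: "f \<in> borel_measurable N" "g \<in> borel_measurable N"
  shows "(\<lambda>w. em_step e (f w) (g w)) \<in> borel_measurable N"
  unfolding em_step_def by measurable

lemma measurable_K [measurable]:
  assumes [measurable]: "f \<in> borel_measurable borel"
  shows "K e f \<in> borel_measurable borel"
  unfolding K_def[abs_def] by measurable

lemma measurable_Kl [measurable]:
  "f \<in> borel_measurable borel \<Longrightarrow> Kl es f \<in> borel_measurable borel"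
  by (induction es) auto

lemma norm_\<sigma>_le: "norm (\<sigma> *v z) \<le> onorm ((*v) \<sigma>) * norm z"
  by (rule onorm) (rule matrix_vector_mul_bounded_linear)

lemma onorm_\<sigma>_nonneg: "0 \<le> onorm ((*v) \<sigma>)"
  by (rule onorm_pos_le) (rule matrix_vector_mul_bounded_linear)

lemma norm_b_le: "norm (b x) \<le> L * norm x + norm (b 0)"
  using lip[of x 0] norm_triangle_ineq[of "b x - b 0" "b 0"] by simp

text \<open>The bound is a factor in \<open>x\<close> times a factor in \<open>z\<close>, so that a
  power of it splits and is integrated over \<open>z\<close> alone.\<close>

lemma em_step_growth:
  assumes "0 \<le> e"
  shows "1 + norm (em_step e x z) \<le>
    (1 + e * (L + norm (b 0)) + sqrt e * onorm ((*v) \<sigma>)) * (1 + norm x) * (1 + norm z)"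
proof -
  let ?S = "onorm ((*v) \<sigma>)"
  have "norm (em_step e x z) \<le> norm x + e * (L * norm x + norm (b 0)) + sqrt e * (?S * norm z)"
    unfolding em_step_def using assms norm_b_le[of x] norm_\<sigma>_le[of z]
    by (intro norm_triangle_le add_mono) (auto intro!: mult_left_mono)
  moreover define P where "P = (1 + norm x) * (1 + norm z)"
  have P: "1 + norm x \<le> P" "norm x \<le> P" "1 \<le> P" "norm z \<le> P"
    by (auto simp: P_def ring_distribs add_increasing)
  have "e * (L * norm x + norm (b 0)) \<le> e * (L * P + norm (b 0) * P)"
    using assms L P by (intro mult_left_mono add_mono) (auto simp: mult_le_cancel_left1)
  moreover have "sqrt e * (?S * norm z) \<le> sqrt e * (?S * P)"
    using assms onorm_\<sigma>_nonneg P by (intro mult_left_mono) auto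
  ultimately have "1 + norm (em_step e x z) \<le> (1 + e * (L + norm (b 0)) + sqrt e * ?S) * P"
    using P(1) by (simp add: algebra_simps)
  then show ?thesis by (simp add: P_def mult.assoc)
qed

lemma poly_growth_measurable [measurable_dest]: "poly_growth p f \<Longrightarrow> f \<in> borel_measurable borel"
  by (simp add: poly_growth_def)

lemma poly_growth_const [intro, simp]: "poly_growth p (\<lambda>_. c)"
  unfolding poly_growth_def
proof (intro conjI exI[of _ "\<bar>c\<bar>"] allI)
  show "\<bar>c\<bar> \<le> \<bar>c\<bar> * (1 + norm x) ^ p" for x :: "real^'n"
    by (simp add: mult_le_cancel_left1)
qed auto

lemma poly_growth_add [intro]: "poly_growth p f \<Longrightarrow> poly_growth p g \<Longrightarrow> poly_growth p (\<lambda>x. f x + g x)"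
  unfolding poly_growth_def
proof (elim conjE exE, intro conjI)
  fix c d assume c: "0 \<le> c" "\<forall>x. \<bar>f x\<bar> \<le> c * (1 + norm x) ^ p" and d: "0 \<le> d" "\<forall>x. \<bar>g x\<bar> \<le> d * (1 + norm x) ^ p"
  have "\<bar>f x + g x\<bar> \<le> (c + d) * (1 + norm x) ^ p" for x
    using c(2)[rule_format, of x] d(2)[rule_format, of x] by (auto simp: ring_distribs)
  then show "\<exists>c\<ge>0. \<forall>x. \<bar>f x + g x\<bar> \<le> c * (1 + norm x) ^ p"
    using c d by (intro exI[of _ "c + d"]) auto
qed auto

lemma poly_growth_cmult [intro]: "poly_growth p f \<Longrightarrow> poly_growth p (\<lambda>x. k * f x)"
  unfolding poly_growth_def
proof (elim conjE exE, intro conjI)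
  fix c assume c: "0 \<le> c" "\<forall>x. \<bar>f x\<bar> \<le> c * (1 + norm x) ^ p"
  have "\<bar>k * f x\<bar> \<le> (\<bar>k\<bar> * c) * (1 + norm x) ^ p" for x
    using mult_left_mono[OF c(2)[rule_format, of x], of "\<bar>k\<bar>"] by (simp add: abs_mult mult.assoc)
  then show "\<exists>c\<ge>0. \<forall>x. \<bar>k * f x\<bar> \<le> c * (1 + norm x) ^ p"
    using c by (intro exI[of _ "\<bar>k\<bar> * c"]) auto
qed auto

lemma poly_growth_norm_power [intro]: "q \<le> p \<Longrightarrow> poly_growth p (\<lambda>x. norm x ^ q)"
  unfolding poly_growth_def
proof (intro conjI exI[of _ 1] allI)
  fix x :: "real^'n"
  assume "q \<le> p"
  have "norm x ^ q \<le> (1 + norm x) ^ q" by (intro power_mono) auto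
  also have "\<dots> \<le> (1 + norm x) ^ p" using \<open>q \<le> p\<close> by (intro power_increasing) auto
  finally show "\<bar>norm x ^ q\<bar> \<le> 1 * (1 + norm x) ^ p" by simp
qed auto

lemma poly_growth_bounded:
  assumes [measurable]: "f \<in> borel_measurable borel" and "\<And>x. \<bar>f x\<bar> \<le> c"
  shows "poly_growth p f"
  unfolding poly_growth_def
proof (intro conjI exI[of _ c] allI)
  show "0 \<le> c" using assms(2)[of 0] by linarith
  then show "\<bar>f x\<bar> \<le> c * (1 + norm x) ^ p" for x :: "real^'n"
    using assms(2)[of x] mult_left_mono[of 1 "(1 + norm x) ^ p" c] by simp
qed auto

lemma integrable_em_step:
  assumes "poly_growth p f" "0 \<le> e"
  shows "integrable gauss (\<lambda>z. f (em_step e x z))"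
    and "\<exists>c\<ge>0. \<forall>x. \<bar>K e f x\<bar> \<le> c * (1 + norm x) ^ p"
proof -
  note [measurable] = poly_growth_measurable[OF assms(1)]
  obtain c where c: "0 \<le> c" "\<And>x. \<bar>f x\<bar> \<le> c * (1 + norm x) ^ p"
    using assms by (auto simp: poly_growth_def)
  define D where "D = 1 + e * (L + norm (b 0)) + sqrt e * onorm ((*v) \<sigma>)"
  have D: "0 \<le> D" unfolding D_def using assms(2) L onorm_\<sigma>_nonneg by (intro add_nonneg_nonneg) auto
  have bd: "\<bar>f (em_step e x z)\<bar> \<le> c * D ^ p * (1 + norm x) ^ p * (1 + norm z) ^ p" for x z
  proof -
    have "\<bar>f (em_step e x z)\<bar> \<le> c * (1 + norm (em_step e x z)) ^ p" by (rule c)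
    also have "\<dots> \<le> c * (D * (1 + norm x) * (1 + norm z)) ^ p"
      using em_step_growth[OF assms(2), of x z] c(1) unfolding D_def
      by (intro mult_left_mono power_mono) auto
    finally show ?thesis by (simp add: power_mult_distrib mult.assoc)
  qed
  have int1: "integrable gauss (\<lambda>z :: real^'n. (1 + norm z) ^ p)"
    using integrable_gauss_one_plus_norm[of 1 p] by simp
  show int: "integrable gauss (\<lambda>z. f (em_step e x z))" for x
    by (rule Bochner_Integration.integrable_bound[OF integrable_mult_right[OF int1, of "c * D ^ p * (1 + norm x) ^ p"]])
      (use bd[of x] in \<open>auto intro: order_trans[OF _ abs_ge_self]\<close>)
  have "\<bar>K e f x\<bar> \<le> c * D ^ p * (\<integral>z. (1 + norm (z :: real^'n)) ^ p \<partial>gauss) * (1 + norm x) ^ p" for x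
  proof -
    have "\<bar>K e f x\<bar> \<le> (\<integral>z. \<bar>f (em_step e x z)\<bar> \<partial>gauss)"
      unfolding K_def by (rule integral_abs_bound)
    also have "\<dots> \<le> (\<integral>z. c * D ^ p * (1 + norm x) ^ p * (1 + norm (z :: real^'n)) ^ p \<partial>gauss)"
      by (rule integral_mono) (use int bd int1 in auto)
    finally show ?thesis by (simp add: mult_ac)
  qed
  moreover have "0 \<le> c * D ^ p * (\<integral>z. (1 + norm (z :: real^'n)) ^ p \<partial>gauss)"
    using c D by (intro mult_nonneg_nonneg integral_nonneg_AE) auto
  ultimately show "\<exists>c\<ge>0. \<forall>x. \<bar>K e f x\<bar> \<le> c * (1 + norm x) ^ p" by blast
qed

lemma poly_growth_K [intro]: "poly_growth p f \<Longrightarrow> 0 \<le> e \<Longrightarrow> poly_growth p (K e f)"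
  using integrable_em_step(2)[of p f e] by (auto simp: poly_growth_def)

lemma poly_growth_Kl: "poly_growth p f \<Longrightarrow> (\<And>e. e \<in> set es \<Longrightarrow> 0 \<le> e) \<Longrightarrow> poly_growth p (Kl es f)"
  by (induction es) auto

lemma K_mono:
  assumes "poly_growth p f" "poly_growth p g" "0 \<le> e" "\<And>x. f x \<le> g x"
  shows "K e f x \<le> K e g x"
  unfolding K_def using assms by (intro integral_mono integrable_em_step) auto

lemma K_add: "poly_growth p f \<Longrightarrow> poly_growth p g \<Longrightarrow> 0 \<le> e \<Longrightarrow> K e (\<lambda>x. f x + g x) x = K e f x + K e g x"
  unfolding K_def by (intro Bochner_Integration.integral_add integrable_em_step)

lemma K_cmult: "K e (\<lambda>x. k * f x) x = k * K e f x"
  unfolding K_def by simp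

lemma K_const [simp]: "K e (\<lambda>_. k) x = k"
  by (simp add: K_def)

lemma Kl_mono:
  assumes "poly_growth p f" "poly_growth p g" "\<And>e. e \<in> set es \<Longrightarrow> 0 \<le> e" "\<And>x. f x \<le> g x"
  shows "Kl es f x \<le> Kl es g x"
  using assms(3) by (induction es arbitrary: x) (auto intro!: K_mono poly_growth_Kl assms(1,2) simp: assms(4))

lemma Kl_add:
  assumes "poly_growth p f" "poly_growth p g" "\<And>e. e \<in> set es \<Longrightarrow> 0 \<le> e"
  shows "Kl es (\<lambda>x. f x + g x) x = Kl es f x + Kl es g x"
  using assms(3)
proof (induction es arbitrary: x)
  case (Cons e es)
  then have "Kl es (\<lambda>x. f x + g x) = (\<lambda>x. Kl es f x + Kl es g x)" by auto
  then show ?case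
    using Cons.prems assms by (auto intro!: K_add poly_growth_Kl)
qed simp

lemma Kl_cmult: "Kl es (\<lambda>x. k * f x) x = k * Kl es f x"
proof (induction es arbitrary: x)
  case (Cons e es)
  then have "Kl es (\<lambda>x. k * f x) = (\<lambda>x. k * Kl es f x)" by auto
  then show ?case by (simp add: K_cmult)
qed simp

lemma Kl_const [simp]: "Kl es (\<lambda>_. k) x = k"
proof (induction es arbitrary: x)
  case (Cons e es)
  then have "Kl es (\<lambda>_. k) = (\<lambda>_. k)" by auto
  then show ?case by simp
qed simp

text \<open>For \<open>e \<le> e0\<close> dissipativity absorbs the term \<open>e\<^sup>2 |b x|\<^sup>2\<close>, and the contraction factors
  \<open>1 - K1 e / 2\<close> are nonnegative.\<close>

definition e0 :: real where "e0 = min 1 (min (K1 / (4 * L\<^sup>2)) (1 / K1))"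

text \<open>Collects the constants of \<open>drift_mean\<close>: the first two summands come from
  \<open>2 * (x \<bullet> b x)\<close>, the last one from \<open>e * (norm (b x))\<^sup>2\<close>
  with \<open>e \<le> 1\<close>.\<close>

definition C0 :: real where "C0 = 2 * K2 + (norm (b 0))\<^sup>2 / K1 + 2 * (norm (b 0))\<^sup>2"

section \<open>Lyapunov drift of the even powers of the norm\<close>

lemma e0: "0 < e0" "e0 \<le> 1" and C0: "0 \<le> C0"
  using L K1 K2 by (auto simp: e0_def C0_def)

text \<open>In the expansion of the square the term \<open>2 * (x \<bullet> b x)\<close> contributes
  the rate \<open>K1\<close> after Young's inequality; the second-order term gives back at most half
  of it, because \<open>e \<le> K1 / (4 * L\<^sup>2)\<close>.\<close>

lemma drift_mean:
  assumes "0 < e" "e \<le> e0"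
  shows "(norm (x + e *\<^sub>R b x))\<^sup>2 \<le> (1 - K1 / 2 * e) * (norm x)\<^sup>2 + C0 * e"
proof -
  have e: "e \<le> 1" "e * (4 * L\<^sup>2) \<le> K1"
    using assms L K1 by (auto simp: e0_def field_simps)
  have "x \<bullet> b x \<le> - K1 * (norm x)\<^sup>2 + K2 + norm x * norm (b 0)"
    using dissip[of x 0] Cauchy_Schwarz_ineq2[of x "b 0"]
    by (simp add: inner_diff_left inner_diff_right inner_commute)
  also have "norm x * norm (b 0) \<le> K1 / 2 * (norm x)\<^sup>2 + (norm (b 0))\<^sup>2 / (2 * K1)"
  proof -
    have "0 \<le> (K1 * norm x - norm (b 0))\<^sup>2 / (2 * K1)" using K1 by auto
    then show ?thesis using K1 by (simp add: power2_eq_square field_simps)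
  qed
  finally have xb: "2 * (x \<bullet> b x) \<le> - K1 * (norm x)\<^sup>2 + 2 * K2 + (norm (b 0))\<^sup>2 / K1"
    by (simp add: field_simps)
  have bb: "(norm (b x))\<^sup>2 \<le> 2 * L\<^sup>2 * (norm x)\<^sup>2 + 2 * (norm (b 0))\<^sup>2"
  proof -
    have "(norm (b x))\<^sup>2 \<le> (L * norm x + norm (b 0))\<^sup>2"
      using norm_b_le by (intro power_mono) auto
    moreover have "0 \<le> (L * norm x - norm (b 0))\<^sup>2" by simp
    ultimately show ?thesis by (simp add: power2_eq_square algebra_simps)
  qed
  have "(norm (x + e *\<^sub>R b x))\<^sup>2 = (norm x)\<^sup>2 + e * (2 * (x \<bullet> b x)) + e * (e * (norm (b x))\<^sup>2)"
    by (simp add: power2_norm_eq_inner inner_simps inner_commute algebra_simps)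
  also have "\<dots> \<le> (norm x)\<^sup>2 + e * (- K1 * (norm x)\<^sup>2 + 2 * K2 + (norm (b 0))\<^sup>2 / K1) +
      e * (e * (2 * L\<^sup>2 * (norm x)\<^sup>2 + 2 * (norm (b 0))\<^sup>2))"
    using assms(1) xb bb by (intro add_mono mult_left_mono) auto
  also have "e * (2 * L\<^sup>2 * (norm x)\<^sup>2 + 2 * (norm (b 0))\<^sup>2) \<le> K1 / 2 * (norm x)\<^sup>2 + 2 * (norm (b 0))\<^sup>2"
  proof -
    have "e * (2 * L\<^sup>2) * (norm x)\<^sup>2 \<le> K1 / 2 * (norm x)\<^sup>2" using e by (intro mult_right_mono) auto
    moreover have "e * (2 * (norm (b 0))\<^sup>2) \<le> 1 * (2 * (norm (b 0))\<^sup>2)" using e by (intro mult_right_mono) auto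
    ultimately show ?thesis by (simp add: ring_distribs mult.assoc)
  qed
  finally show ?thesis
    using assms by (simp add: C0_def algebra_simps)
qed

text \<open>Expanding \<open>|m + W|\<^sup>2\<^sup>p\<close> around \<open>|m|\<^sup>2\<^sup>p\<close>, where \<open>m\<close> is the conditional mean of a step, the
  first-order term has mean of order \<open>e\<close> and so does the remainder; both have a lower power.\<close>

lemma drift_power:
  "\<exists>C\<ge>0. \<forall>e x. 0 < e \<longrightarrow> e \<le> e0 \<longrightarrow>
    K e (\<lambda>y. norm y ^ (2 * Suc q)) x \<le> (1 - K1 / 4 * e) * norm x ^ (2 * Suc q) + C * e"
proof -
  define S where "S = onorm ((*v) \<sigma>)"
  have S: "0 \<le> S" "norm (\<sigma> *v z) \<le> S * norm z" for z
    by (auto simp: S_def onorm_\<sigma>_nonneg norm_\<sigma>_le)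
  define p where "p = real (Suc q)"
  have p: "0 < p" by (simp add: p_def)
  define \<kappa>1 where "\<kappa>1 = S\<^sup>2 * (\<integral>z. norm (z :: real^'n) ^ 2 \<partial>gauss)"
  define \<kappa>2 where "\<kappa>2 = (\<integral>z. (1 + S * norm (z :: real^'n)) ^ (2 * Suc q) \<partial>gauss)"
  have \<kappa>: "0 \<le> \<kappa>1" "0 \<le> \<kappa>2" unfolding \<kappa>1_def \<kappa>2_def
    using S(1) by (auto intro!: mult_nonneg_nonneg integral_nonneg_AE)
  \<comment> \<open>\<open>p * \<kappa>1\<close> bounds the mean of the first-order term and
    \<open>p\<^sup>2 * \<kappa>2\<close> that of the remainder from
    \<open>power_add_first_order\<close>, both up to the factor
    \<open>e * (1 + a) ^ q\<close>.\<close>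
  define D where "D = p * \<kappa>1 + p\<^sup>2 * \<kappa>2"
  have D: "0 \<le> D" using p \<kappa> by (auto simp: D_def)
  \<comment> \<open>Half of the rate \<open>K1 / 2\<close> from \<open>drift_mean\<close> is spent
    on absorbing this lower power, which leaves the rate \<open>K1 / 4\<close>.\<close>
  obtain C1 where C1: "0 \<le> C1" "\<And>r. 0 \<le> r \<Longrightarrow> D * (r + (1 + C0)) ^ q \<le> K1 / 4 * r ^ Suc q + C1"
    using lower_power_absorbed[of "1 + C0" D "K1 / 4" q] C0 D K1 by auto
  have pg: "poly_growth (2 * Suc q) (\<lambda>y. norm y ^ (2 * Suc q))"
    by (rule poly_growth_norm_power) simp
  have "K e (\<lambda>y. norm y ^ (2 * Suc q)) x \<le>
      (1 - K1 / 4 * e) * norm x ^ (2 * Suc q) + (K1 / 2 * (2 * C0 / K1) ^ Suc q + C1) * e"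
    if e: "0 < e" "e \<le> e0" for e x
  proof -
    have e1: "e \<le> 1" and eK: "K1 / 2 * e \<le> 1"
      using e e0 K1 by (auto simp: e0_def field_simps)
    define m where "m = x + e *\<^sub>R b x"
    define a where "a = (norm m)\<^sup>2"
    define u where "u z = 2 * sqrt e * (m \<bullet> (\<sigma> *v z)) + e * (norm (\<sigma> *v z))\<^sup>2" for z
    have a0: "0 \<le> a" by (simp add: a_def)
    have au: "(norm (em_step e x z))\<^sup>2 = a + u z" for z
      using e unfolding em_step_def a_def u_def m_def[symmetric]
      by (simp add: power2_norm_eq_inner inner_simps inner_commute power2_eq_square[symmetric]
          algebra_simps real_sqrt_mult_self)
    have u_int: "integrable gauss (\<lambda>z. m \<bullet> (\<sigma> *v z))" "integrable gauss (\<lambda>z. (norm (\<sigma> *v z))\<^sup>2)"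
    proof -
      have "m \<bullet> (\<sigma> *v z) = (transpose \<sigma> *v m) \<bullet> z" for z
        by (simp add: dot_lmul_matrix)
      then show "integrable gauss (\<lambda>z. m \<bullet> (\<sigma> *v z))"
        using gauss_inner_moments(1)[of "transpose \<sigma> *v m" 1] by simp
      show "integrable gauss (\<lambda>z. (norm (\<sigma> *v z))\<^sup>2)"
      proof (rule Bochner_Integration.integrable_bound)
        show "integrable gauss (\<lambda>z :: real^'n. S\<^sup>2 * norm z ^ 2)" by auto
        have "(norm (\<sigma> *v z))\<^sup>2 \<le> S\<^sup>2 * norm z ^ 2" for z
          using power_mono[OF S(2), of z 2] by (simp add: power_mult_distrib)
        then show "AE z in gauss. norm ((norm (\<sigma> *v z))\<^sup>2) \<le> norm (S\<^sup>2 * norm z ^ 2)" by auto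
      qed auto
    qed
    have Eu: "(\<integral>z. u z \<partial>gauss) \<le> e * \<kappa>1"
    proof -
      have "(\<integral>z. m \<bullet> (\<sigma> *v z) \<partial>gauss) = 0"
        using gauss_inner_moments(2)[of "transpose \<sigma> *v m"] by (simp add: dot_lmul_matrix)
      then have "(\<integral>z. u z \<partial>gauss) = e * (\<integral>z. (norm (\<sigma> *v z))\<^sup>2 \<partial>gauss)"
        unfolding u_def using u_int by simp
      also have "(\<integral>z. (norm (\<sigma> *v z))\<^sup>2 \<partial>gauss) \<le> (\<integral>z. S\<^sup>2 * norm (z :: real^'n) ^ 2 \<partial>gauss)"
        using u_int(2)
      proof (rule integral_mono)
        show "(norm (\<sigma> *v z))\<^sup>2 \<le> S\<^sup>2 * norm z ^ 2" for z
          using power_mono[OF S(2), of z 2] by (simp add: power_mult_distrib)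
      qed auto
      finally show ?thesis using e by (simp add: \<kappa>1_def)
    qed
    have pw: "norm (em_step e x z) ^ (2 * Suc q) \<le>
        a ^ Suc q + p * a ^ q * u z + p\<^sup>2 * e * (1 + a) ^ q * (1 + S * norm z) ^ (2 * Suc q)" for z
    proof -
      define s where "s = norm (\<sigma> *v z)"
      have s: "0 \<le> s" by (simp add: s_def)
      have "\<bar>u z\<bar> \<le> 2 * sqrt e * (norm m * s) + e * s\<^sup>2"
        unfolding u_def s_def using Cauchy_Schwarz_ineq2[of m "\<sigma> *v z"] e
        by (intro order_trans[OF abs_triangle_ineq]) (auto simp: abs_mult)
      \<comment> \<open>Both summands are brought to the form required by
        \<open>power_add_first_order\<close> with \<open>y = 2 * s + s\<^sup>2\<close>, chosen so
        that \<open>1 + y\<close> is the square of \<open>1 + s\<close>.\<close>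
      also have "\<dots> \<le> sqrt e * (sqrt (1 + a) * (2 * s)) + sqrt e * (sqrt (1 + a) * s\<^sup>2)"
      proof (rule add_mono)
        have "norm m \<le> sqrt (1 + a)" by (simp add: a_def real_le_rsqrt)
        then show "2 * sqrt e * (norm m * s) \<le> sqrt e * (sqrt (1 + a) * (2 * s))"
          using e s by (simp add: mult_right_mono)
        have "e \<le> sqrt e" using e e1 by (simp add: real_le_rsqrt power2_eq_square mult_le_one)
        moreover have "1 \<le> sqrt (1 + a)" using a0 by simp
        ultimately show "e * s\<^sup>2 \<le> sqrt e * (sqrt (1 + a) * s\<^sup>2)"
          using mult_right_mono[OF mult_mono[of e "sqrt e" 1 "sqrt (1 + a)"], of "s\<^sup>2"] e by (simp add: mult.assoc)
      qed
      also have "\<dots> = sqrt e * sqrt (1 + a) * (2 * s + s\<^sup>2)" by (simp add: algebra_simps)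
      finally have "\<bar>(a + u z) ^ Suc q - a ^ Suc q - real (Suc q) * a ^ q * u z\<bar> \<le>
          (real (Suc q))\<^sup>2 * e * (1 + a) ^ q * (1 + (2 * s + s\<^sup>2)) ^ Suc q"
        using a0 s e e1 by (intro power_add_first_order) auto
      moreover have "(1 + (2 * s + s\<^sup>2)) ^ Suc q \<le> (1 + S * norm z) ^ (2 * Suc q)"
      proof -
        have "(1 + (2 * s + s\<^sup>2)) ^ Suc q = ((1 + s)\<^sup>2) ^ Suc q"
          by (simp add: power2_eq_square algebra_simps)
        also have "\<dots> = (1 + s) ^ (2 * Suc q)" by (simp only: power_mult)
        also have "\<dots> \<le> (1 + S * norm z) ^ (2 * Suc q)"
          using s S(2)[of z] by (intro power_mono) (auto simp: s_def)
        finally show ?thesis .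
      qed
      ultimately have "\<bar>(a + u z) ^ Suc q - a ^ Suc q - p * a ^ q * u z\<bar> \<le>
          p\<^sup>2 * e * (1 + a) ^ q * (1 + S * norm z) ^ (2 * Suc q)"
        unfolding p_def[symmetric] using e a0
        by (elim order_trans) (auto intro!: mult_left_mono)
      then show ?thesis
        unfolding power_mult au by linarith
    qed
    have "K e (\<lambda>y. norm y ^ (2 * Suc q)) x \<le>
      (\<integral>z. a ^ Suc q + p * a ^ q * u z + p\<^sup>2 * e * (1 + a) ^ q * (1 + S * norm z) ^ (2 * Suc q) \<partial>gauss)"
      unfolding K_def
    proof (rule integral_mono[OF _ _ pw])
      show "integrable gauss (\<lambda>z. norm (em_step e x z) ^ (2 * Suc q))"
        using integrable_em_step(1)[OF pg, of e x] e by simp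
      show "integrable gauss (\<lambda>z. a ^ Suc q + p * a ^ q * u z +
          p\<^sup>2 * e * (1 + a) ^ q * (1 + S * norm z) ^ (2 * Suc q))"
        unfolding u_def using u_int
        by (intro Bochner_Integration.integrable_add integrable_mult_right integrable_gauss_one_plus_norm) auto
    qed
    also have "\<dots> = a ^ Suc q + p * a ^ q * (\<integral>z. u z \<partial>gauss) + p\<^sup>2 * e * (1 + a) ^ q * \<kappa>2"
    proof -
      have "integrable gauss u" unfolding u_def using u_int by auto
      then show ?thesis
        unfolding \<kappa>2_def
        by (subst Bochner_Integration.integral_add | subst integral_mult_right_zero |
            intro Bochner_Integration.integrable_add integrable_mult_right integrable_gauss_one_plus_norm | simp)+
    qed
    also have "\<dots> \<le> a ^ Suc q + p * (1 + a) ^ q * (e * \<kappa>1) + p\<^sup>2 * e * (1 + a) ^ q * \<kappa>2"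
    proof -
      have "p * a ^ q * (\<integral>z. u z \<partial>gauss) \<le> p * a ^ q * (e * \<kappa>1)"
        using Eu p a0 by (intro mult_left_mono) auto
      also have "\<dots> \<le> p * (1 + a) ^ q * (e * \<kappa>1)"
        using p a0 e \<kappa> by (intro mult_mono power_mono) auto
      finally show ?thesis by simp
    qed
    also have "\<dots> = a ^ Suc q + e * (D * (1 + a) ^ q)"
      by (simp add: D_def algebra_simps)
    also have "\<dots> \<le> ((1 - K1 / 2 * e) * norm x ^ (2 * Suc q) + K1 / 2 * e * (2 * C0 / K1) ^ Suc q) +
        e * (K1 / 4 * norm x ^ (2 * Suc q) + C1)"
    proof (intro add_mono mult_left_mono)
      let ?r = "(norm x)\<^sup>2"
      have ar: "a \<le> (1 - K1 / 2 * e) * ?r + C0 * e"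
        unfolding a_def m_def by (rule drift_mean[OF e])
      \<comment> \<open>The bound on \<open>a\<close> is a convex combination of \<open>?r\<close>
        and the equilibrium value \<open>2 * C0 / K1\<close> with weight \<open>K1 / 2 * e\<close>,
        so convexity of the power keeps the contraction factor.\<close>
      have "a ^ Suc q \<le> ((1 - K1 / 2 * e) * ?r + K1 / 2 * e * (2 * C0 / K1)) ^ Suc q"
        using ar a0 K1 by (intro power_mono) (auto simp: field_simps)
      also have "\<dots> \<le> (1 - K1 / 2 * e) * ?r ^ Suc q + K1 / 2 * e * (2 * C0 / K1) ^ Suc q"
        using eK e K1 C0 by (intro convex_combination_power_le) auto
      finally show "a ^ Suc q \<le> (1 - K1 / 2 * e) * norm x ^ (2 * Suc q) + K1 / 2 * e * (2 * C0 / K1) ^ Suc q"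
        unfolding power_mult .
      have "(1 - K1 / 2 * e) * ?r \<le> 1 * ?r" using e K1 by (intro mult_right_mono) auto
      moreover have "C0 * e \<le> C0 * 1" using C0 e1 by (intro mult_left_mono) auto
      ultimately have "D * (1 + a) ^ q \<le> D * (?r + (1 + C0)) ^ q"
        using ar D a0 by (intro mult_left_mono power_mono) auto
      also have "\<dots> \<le> K1 / 4 * ?r ^ Suc q + C1" by (rule C1) simp
      finally show "D * (1 + a) ^ q \<le> K1 / 4 * norm x ^ (2 * Suc q) + C1" unfolding power_mult .
    qed (use e in auto)
    also have "\<dots> = (1 - K1 / 4 * e) * norm x ^ (2 * Suc q) + (K1 / 2 * (2 * C0 / K1) ^ Suc q + C1) * e"
      by (simp add: algebra_simps)
    finally show ?thesis .
  qed
  moreover have "0 \<le> K1 / 2 * (2 * C0 / K1) ^ Suc q + C1" using K1 C0 C1 by auto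
  ultimately show ?thesis by blast
qed

end


section \<open>Contraction of the chain\<close>

text \<open>Entries are at most 1, so a prefix that is stopped once its sum reaches \<open>T\<close>
  overshoots by at most 1.\<close>

lemma split_list_sum:
  fixes es :: "real list"
  assumes "\<And>e. e \<in> set es \<Longrightarrow> e \<le> 1" "0 \<le> T" "T \<le> sum_list es"
  shows "\<exists>fs gs. es = fs @ gs \<and> T \<le> sum_list fs \<and> sum_list fs \<le> T + 1"
  using assms
proof (induction es arbitrary: T)
  case (Cons e es)
  show ?case
  proof (cases "T \<le> e")
    case True
    then have "e # es = [e] @ es \<and> T \<le> sum_list [e] \<and> sum_list [e] \<le> T + 1"
      using Cons.prems(1)[of e] Cons.prems(2) by auto
    then show ?thesis by blast
  next
    case False
    then obtain fs gs where "es = fs @ gs" "T - e \<le> sum_list fs" "sum_list fs \<le> T - e + 1"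
      using Cons.IH[of "T - e"] Cons.prems by auto
    then have "e # es = (e # fs) @ gs \<and> T \<le> sum_list (e # fs) \<and> sum_list (e # fs) \<le> T + 1"
      by auto
    then show ?thesis by blast
  qed
qed auto

lemma split_list_sum_suffix:
  fixes es :: "real list"
  assumes "\<And>e. e \<in> set es \<Longrightarrow> e \<le> 1" "0 \<le> T" "T \<le> sum_list es"
  shows "\<exists>fs gs. es = fs @ gs \<and> T \<le> sum_list gs \<and> sum_list gs \<le> T + 1"
proof -
  obtain fs gs where "rev es = fs @ gs" "T \<le> sum_list fs" "sum_list fs \<le> T + 1"
    using split_list_sum[of "rev es" T] assms by (auto simp: sum_list_rev)
  then have "es = rev gs @ rev fs \<and> T \<le> sum_list (rev fs) \<and> sum_list (rev fs) \<le> T + 1"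
    by (auto simp: sum_list_rev rev_swap)
  then show ?thesis by blast
qed

lemma sum_list_nonneg_real: "(\<And>e. e \<in> set es \<Longrightarrow> 0 \<le> e) \<Longrightarrow> 0 \<le> sum_list (es :: real list)"
  by (induction es) auto

context em_kernel
begin

section \<open>Harnack inequality and minorisation over a window\<close>

lemma Kl_bounds:
  assumes [measurable]: "g \<in> borel_measurable borel" and "\<And>x. l \<le> g x" "\<And>x. g x \<le> u"
    and "\<And>e. e \<in> set es \<Longrightarrow> 0 \<le> e"
  shows "l \<le> Kl es g x" "Kl es g x \<le> u"
proof -
  have "\<bar>g x\<bar> \<le> \<bar>l\<bar> + \<bar>u\<bar>" for x using assms(2,3)[of x] by auto
  then have "poly_growth 0 g" by (intro poly_growth_bounded) auto
  then show "l \<le> Kl es g x" "Kl es g x \<le> u"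
    using Kl_mono[of 0 "\<lambda>_. l" g es x] Kl_mono[of 0 g "\<lambda>_. u" es x] assms by auto
qed

text \<open>Square of the noise shift per unit velocity: the shift is the inverse of
  \<open>\<sigma>\<close> applied to \<open>v + b y - b x\<close>, and in a window of total length
  at most 2 the points \<open>x\<close> and \<open>y\<close> are at most \<open>2 * norm v\<close>
  apart.\<close>

definition harnack_const :: real where
  "harnack_const = (onorm ((*v) (matrix_inv \<sigma>)) * (1 + 2 * L))\<^sup>2"

text \<open>The second chain is steered at constant velocity \<open>v\<close> into the first one by shifting its noise,
  so that the two have merged at the end of the time window.\<close>

lemma Kl_harnack:
  assumes "\<And>e. e \<in> set es \<Longrightarrow> 0 < e" "sum_list es \<le> 2"
    and [measurable]: "g \<in> borel_measurable borel" and g: "\<And>x. 0 \<le> g x" "\<And>x. g x \<le> 1"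
  shows "(Kl es g (x + sum_list es *\<^sub>R v))\<^sup>2 \<le>
    exp (harnack_const * sum_list es * (norm v)\<^sup>2) * Kl es (\<lambda>y. (g y)\<^sup>2) x"
  using assms(1,2)
proof (induction es arbitrary: x)
  case Nil
  then show ?case by simp
next
  case (Cons e es)
  define s where "s = sum_list es"
  define y where "y = x + (e + s) *\<^sub>R v"
  \<comment> \<open>Scaled by \<open>sqrt e\<close>, this shift of the noise replaces the drift at
    \<open>y\<close> by the drift at \<open>x\<close> and moves the second chain by \<open>e\<close>
    times \<open>- v\<close>; the gap shrinks from \<open>(e + s) *\<^sub>R v\<close> to
    \<open>s *\<^sub>R v\<close>.\<close>
  define u where "u = - (matrix_inv \<sigma> *v (v + b y - b x))"
  let ?S = "onorm ((*v) (matrix_inv \<sigma>))"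
  have e: "0 < e" and s: "0 \<le> s" "e + s \<le> 2"
    using Cons.prems by (auto simp: s_def less_imp_le intro!: sum_list_nonneg_real)
  have S: "0 \<le> ?S" by (rule onorm_pos_le) (rule matrix_vector_mul_bounded_linear)
  have "\<sigma> *v u = - ((\<sigma> ** matrix_inv \<sigma>) *v (v + b y - b x))"
    by (simp add: u_def matrix_vector_mul_assoc[symmetric] linear_neg[OF matrix_vector_mul_linear])
  then have \<sigma>u: "\<sigma> *v u = - (v + b y - b x)"
    using someI_ex[OF inv\<sigma>[unfolded invertible_def]] by (simp add: matrix_inv_def)
  have shift: "em_step e y (z + sqrt e *\<^sub>R u) = em_step e x z + s *\<^sub>R v" for z
  proof -
    have "em_step e y (z + sqrt e *\<^sub>R u) = y + e *\<^sub>R b y + sqrt e *\<^sub>R (\<sigma> *v z) + e *\<^sub>R (\<sigma> *v u)"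
      using e by (simp add: em_step_def matrix_vector_right_distrib scaleR_add_right
          linear_scale[OF matrix_vector_mul_linear] scaleR_scaleR)
    also have "\<dots> = em_step e x z + s *\<^sub>R v"
      unfolding \<sigma>u em_step_def y_def by (simp add: algebra_simps)
    finally show ?thesis .
  qed
  have "norm u \<le> ?S * norm (v + b y - b x)"
    unfolding u_def norm_minus_cancel by (rule onorm) (rule matrix_vector_mul_bounded_linear)
  also have "norm (v + b y - b x) \<le> (1 + 2 * L) * norm v"
  proof -
    have "norm (b y - b x) \<le> L * ((e + s) * norm v)"
      using lip[of y x] e s by (simp add: y_def)
    also have "\<dots> \<le> L * (2 * norm v)"
      using L s by (intro mult_left_mono mult_right_mono) auto
    finally show ?thesis
      using norm_triangle_ineq[of v "b y - b x"] by (simp add: algebra_simps)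
  qed
  finally have "(norm u)\<^sup>2 \<le> (?S * (1 + 2 * L) * norm v)\<^sup>2"
    using S by (intro power_mono) (auto simp: mult.assoc mult_left_mono)
  then have u: "(norm (sqrt e *\<^sub>R u))\<^sup>2 \<le> harnack_const * e * (norm v)\<^sup>2"
    using e by (simp add: power_mult_distrib harnack_const_def mult_ac)
  have ge: "0 \<le> a" if "a \<in> set es" for a using Cons.prems that by (auto intro: less_imp_le)
  have bd: "0 \<le> Kl es g w" "Kl es g w \<le> 1" for w
    using Kl_bounds[of g 0 1 es w] ge g by auto
  have g2: "0 \<le> (g w)\<^sup>2" "(g w)\<^sup>2 \<le> 1" for w using g[of w] by (auto simp: power_le_one)
  have bd2: "0 \<le> Kl es (\<lambda>y. (g y)\<^sup>2) w" "Kl es (\<lambda>y. (g y)\<^sup>2) w \<le> 1" for w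
    using Kl_bounds[of "\<lambda>y. (g y)\<^sup>2" 0 1 es w] ge g2 by auto
  have "(Kl (e # es) g y)\<^sup>2 \<le> exp ((norm (sqrt e *\<^sub>R u))\<^sup>2) *
      (\<integral>z. (Kl es g (em_step e y (z + sqrt e *\<^sub>R u)))\<^sup>2 \<partial>gauss)"
    unfolding Kl_Cons K_def
    by (rule integral_gauss_shift_square_le[where c = 1]) (auto simp: bd)
  also have "\<dots> = exp ((norm (sqrt e *\<^sub>R u))\<^sup>2) * (\<integral>z. (Kl es g (em_step e x z + s *\<^sub>R v))\<^sup>2 \<partial>gauss)"
    by (simp only: shift)
  \<comment> \<open>The induction hypothesis is applied inside the integral, at the new position.
    The squares on both sides make the estimate iterate: the costs of the steps multiply and their
    exponents add up to the total time.\<close>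
  also have "\<dots> \<le> exp (harnack_const * e * (norm v)\<^sup>2) *
      (\<integral>z. exp (harnack_const * s * (norm v)\<^sup>2) * Kl es (\<lambda>y. (g y)\<^sup>2) (em_step e x z) \<partial>gauss)"
  proof (intro mult_mono integral_mono)
    show "exp ((norm (sqrt e *\<^sub>R u))\<^sup>2) \<le> exp (harnack_const * e * (norm v)\<^sup>2)" using u by simp
    show "integrable gauss (\<lambda>z. (Kl es g (em_step e x z + s *\<^sub>R v))\<^sup>2)"
      by (rule gauss.integrable_const_bound[of _ 1]) (auto simp: bd power_le_one)
    show "integrable gauss (\<lambda>z. exp (harnack_const * s * (norm v)\<^sup>2) * Kl es (\<lambda>y. (g y)\<^sup>2) (em_step e x z))"
      by (intro integrable_mult_right gauss.integrable_const_bound[of _ 1]) (auto simp: bd2)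
    show "(Kl es g (em_step e x z + s *\<^sub>R v))\<^sup>2 \<le>
        exp (harnack_const * s * (norm v)\<^sup>2) * Kl es (\<lambda>y. (g y)\<^sup>2) (em_step e x z)" for z
      using Cons.IH[of "em_step e x z"] Cons.prems(1) s e unfolding s_def by auto
  qed (auto intro!: integral_nonneg_AE)
  also have "\<dots> = exp (harnack_const * (e + s) * (norm v)\<^sup>2) * Kl (e # es) (\<lambda>y. (g y)\<^sup>2) x"
    by (simp add: K_def exp_add ring_distribs mult.assoc)
  finally show ?case by (simp add: y_def s_def)
qed

text \<open>If the two values differed by more than \<open>1 - \<epsilon>\<close>, one would be
  below \<open>\<epsilon>\<close> and the other above \<open>1 - \<epsilon>\<close>, but the Harnack
  inequality bounds the square of the second by a multiple of the first. The multiple is uniform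
  over the lists because the window has length at least 1.\<close>

lemma Kl_doeblin:
  "\<exists>\<epsilon>>0. \<epsilon> < 1 \<and> (\<forall>es g x y. (\<forall>e\<in>set es. 0 < e) \<longrightarrow> 1 \<le> sum_list es \<longrightarrow> sum_list es \<le> 2 \<longrightarrow>
     g \<in> borel_measurable borel \<longrightarrow> (\<forall>x. 0 \<le> g x \<and> g x \<le> 1) \<longrightarrow> norm (x - y) \<le> R \<longrightarrow>
     \<bar>Kl es g x - Kl es g y\<bar> \<le> 1 - \<epsilon>)"
proof -
  define M where "M = exp (harnack_const * R\<^sup>2)"
  have M: "1 \<le> M" by (simp add: M_def harnack_const_def)
  \<comment> \<open>With \<open>M * \<epsilon> = 1 / 4\<close> the contradiction becomes
    \<open>(3 / 4)\<^sup>2 \<le> 1 / 4\<close>.\<close>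
  define \<epsilon> where "\<epsilon> = 1 / (4 * M)"
  have \<epsilon>: "0 < \<epsilon>" "\<epsilon> \<le> 1 / 4" "M * \<epsilon> = 1 / 4" using M by (auto simp: \<epsilon>_def field_simps)
  have key: "Kl es g y - Kl es g x \<le> 1 - \<epsilon>"
    if es: "\<forall>e\<in>set es. 0 < e" "1 \<le> sum_list es" "sum_list es \<le> 2"
      and [measurable]: "g \<in> borel_measurable borel" and g: "\<forall>x. 0 \<le> g x \<and> g x \<le> 1"
      and xy: "norm (x - y) \<le> R" for es g x y
  proof (rule ccontr)
    assume neg: "\<not> ?thesis"
    define s where "s = sum_list es"
    \<comment> \<open>Velocity that leads from \<open>x\<close> to \<open>y\<close> in time
      \<open>s\<close>; its cost \<open>s * (norm v)\<^sup>2\<close> is the squared distance divided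
      by \<open>s\<close>.\<close>
    define v where "v = (1 / s) *\<^sub>R (y - x)"
    have s: "1 \<le> s" using es by (simp add: s_def)
    have ge: "0 \<le> e" if "e \<in> set es" for e using es that by (auto intro: less_imp_le)
    have bd: "0 \<le> Kl es g w" "Kl es g w \<le> 1" for w
      using Kl_bounds[of g 0 1 es w] ge g by auto
    have g2: "0 \<le> (g w)\<^sup>2" "(g w)\<^sup>2 \<le> 1" "(g w)\<^sup>2 \<le> g w" for w
      using g[rule_format, of w] by (auto simp: power_le_one) (simp add: power2_eq_square mult_left_le)
    have pg: "poly_growth 0 (\<lambda>w. (g w)\<^sup>2)" "poly_growth 0 g"
      using g g2 by (auto intro!: poly_growth_bounded[of _ 1])
    have sv: "x + s *\<^sub>R v = y" using s by (simp add: v_def)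

    have "s * (norm v)\<^sup>2 = (norm (y - x))\<^sup>2 / s"
      using s by (simp add: v_def power_mult_distrib power2_eq_square)
    also have "\<dots> \<le> (norm (y - x))\<^sup>2 / 1" using s by (intro divide_left_mono) auto
    also have "\<dots> \<le> R\<^sup>2" using xy by (simp add: norm_minus_commute power_mono)
    finally have "exp (harnack_const * s * (norm v)\<^sup>2) \<le> M"
      unfolding M_def exp_le_cancel_iff mult.assoc
      by (intro mult_left_mono) (auto simp: harnack_const_def)
    moreover have "(Kl es g y)\<^sup>2 \<le> exp (harnack_const * s * (norm v)\<^sup>2) * Kl es (\<lambda>w. (g w)\<^sup>2) x"
      using Kl_harnack[of es g x v] es g sv by (simp add: s_def)
    moreover have "Kl es (\<lambda>w. (g w)\<^sup>2) x \<le> Kl es g x"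
      using pg ge g2 by (intro Kl_mono[of 0]) auto
    moreover have "0 \<le> Kl es (\<lambda>w. (g w)\<^sup>2) x"
      using Kl_bounds[of "\<lambda>w. (g w)\<^sup>2" 0 1 es x] ge g2 by auto
    ultimately have "(Kl es g y)\<^sup>2 \<le> M * Kl es g x"
      using M by (smt (verit) mult_mono)
    also have "\<dots> \<le> M * \<epsilon>" using neg bd(2)[of y] M by (intro mult_left_mono) auto
    finally have "(Kl es g y)\<^sup>2 \<le> 1 / 4" using \<epsilon> by simp
    moreover have "(3 / 4)\<^sup>2 \<le> (Kl es g y)\<^sup>2"
      using neg bd(1)[of x] \<epsilon> by (intro power_mono) auto
    ultimately show False by (simp add: power2_eq_square)
  qed
  show ?thesis
  proof (intro exI[of _ \<epsilon>] conjI allI impI)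
    fix es :: "real list" and g :: "real^'n \<Rightarrow> real" and x y :: "real^'n"
    assume *: "\<forall>e\<in>set es. 0 < e" "1 \<le> sum_list es" "sum_list es \<le> 2"
      "g \<in> borel_measurable borel" "\<forall>x. 0 \<le> g x \<and> g x \<le> 1" "norm (x - y) \<le> R"
    show "\<bar>Kl es g x - Kl es g y\<bar> \<le> 1 - \<epsilon>"
      using key[OF *] key[OF *(1-5), of y x] *(6) by (simp add: norm_minus_commute abs_le_iff)
  qed (use \<epsilon> in auto)
qed

section \<open>Drift along a list and Harris contraction\<close>

lemma Kl_drift:
  "\<exists>C\<ge>0. \<forall>es x. (\<forall>e\<in>set es. 0 < e \<and> e \<le> e0) \<longrightarrow>
    Kl es (\<lambda>y. (norm y)\<^sup>2) x \<le> exp (- (K1 / 4) * sum_list es) * (norm x)\<^sup>2 + C"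
proof -
  obtain C where C: "0 \<le> C"
    "\<And>e x. 0 < e \<Longrightarrow> e \<le> e0 \<Longrightarrow> K e (\<lambda>y. (norm y)\<^sup>2) x \<le> (1 - K1 / 4 * e) * (norm x)\<^sup>2 + C * e"
    using drift_power[of 0] by (auto simp: power2_eq_square numeral_2_eq_2)
  define \<kappa> where "\<kappa> = K1 / 4"
  have \<kappa>: "0 < \<kappa>" using K1 by (simp add: \<kappa>_def)
  have pg: "poly_growth 2 (\<lambda>y. (norm y)\<^sup>2)" by auto
  \<comment> \<open>\<open>C / \<kappa>\<close> is the fixed point of
    \<open>m \<mapsto> (1 - \<kappa> * e) * m + C * e\<close> for every \<open>e\<close>, hence a
    bound uniform in the list. The induction removes the last step, the one that acts directly on
    the squared norm.\<close>
  have "Kl es (\<lambda>y. (norm y)\<^sup>2) x \<le> exp (- \<kappa> * sum_list es) * (norm x)\<^sup>2 + C / \<kappa>"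
    if "\<forall>e\<in>set es. 0 < e \<and> e \<le> e0" for es x
    using that
  proof (induction es arbitrary: x rule: rev_induct)
    case Nil
    then show ?case using C \<kappa> by simp
  next
    case (snoc e es)
    have e: "0 < e" "e \<le> e0" using snoc.prems by auto
    have \<kappa>e: "\<kappa> * e \<le> 1" using e K1 by (auto simp: \<kappa>_def e0_def field_simps)
    have ge: "0 \<le> a" if "a \<in> set es" for a using snoc.prems that by (auto intro: less_imp_le)
    have "Kl (es @ [e]) (\<lambda>y. (norm y)\<^sup>2) x = Kl es (K e (\<lambda>y. (norm y)\<^sup>2)) x"
      by (simp add: Kl_append)
    also have "\<dots> \<le> Kl es (\<lambda>y. (1 - \<kappa> * e) * (norm y)\<^sup>2 + C * e) x"
      using pg ge e C(2) by (intro Kl_mono[of 2]) (auto simp: \<kappa>_def)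
    also have "\<dots> = (1 - \<kappa> * e) * Kl es (\<lambda>y. (norm y)\<^sup>2) x + C * e"
      using pg ge by (subst Kl_add[of 2]) (auto simp: Kl_cmult)
    also have "\<dots> \<le> (1 - \<kappa> * e) * (exp (- \<kappa> * sum_list es) * (norm x)\<^sup>2 + C / \<kappa>) + C * e"
      using \<kappa>e snoc C(1) e by (intro add_mono mult_left_mono) auto
    also have "\<dots> = (1 - \<kappa> * e) * (exp (- \<kappa> * sum_list es) * (norm x)\<^sup>2) + C / \<kappa>"
      using \<kappa> by (simp add: field_simps)
    also have "\<dots> \<le> exp (- \<kappa> * e) * (exp (- \<kappa> * sum_list es) * (norm x)\<^sup>2) + C / \<kappa>"
      using exp_ge_add_one_self[of "- \<kappa> * e"] by (intro add_mono mult_right_mono) auto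
    also have "\<dots> = exp (- \<kappa> * sum_list (es @ [e])) * (norm x)\<^sup>2 + C / \<kappa>"
      by (simp add: exp_add[symmetric] mult.assoc[symmetric] algebra_simps)
    finally show ?case .
  qed
  moreover have "0 \<le> C / \<kappa>" using C \<kappa> by simp
  ultimately show ?thesis unfolding \<kappa>_def by blast
qed

text \<open>Oscillations are measured against \<open>2 + \<beta> * (V x + V y)\<close> with
  \<open>V\<close> the squared norm. Where \<open>V x + V y\<close> is large, the drift shrinks the
  weight; where it is small, the minorisation shrinks the constant 2, and \<open>\<beta>\<close> is
  so small that the weight does not consume this gain.\<close>

lemma Kl_contraction_window:
  "\<exists>\<beta>>0. \<exists>a>0. a < 1 \<and> (\<forall>es g x y. (\<forall>e\<in>set es. 0 < e \<and> e \<le> e0) \<longrightarrow> 1 \<le> sum_list es \<longrightarrow> sum_list es \<le> 2 \<longrightarrow>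
     g \<in> borel_measurable borel \<longrightarrow>
     (\<forall>x y. \<bar>g x - g y\<bar> \<le> 2 + \<beta> * ((norm x)\<^sup>2 + (norm y)\<^sup>2)) \<longrightarrow>
     \<bar>Kl es g x - Kl es g y\<bar> \<le> a * (2 + \<beta> * ((norm x)\<^sup>2 + (norm y)\<^sup>2)))"
proof -
  obtain C where C: "0 \<le> C"
    "\<And>es x. (\<forall>e\<in>set es. 0 < e \<and> e \<le> e0) \<Longrightarrow>
      Kl es (\<lambda>y. (norm y)\<^sup>2) x \<le> exp (- (K1 / 4) * sum_list es) * (norm x)\<^sup>2 + C"
    using Kl_drift by blast
  define \<gamma> where "\<gamma> = exp (- (K1 / 4))"
  have \<gamma>: "0 < \<gamma>" "\<gamma> < 1" using K1 by (auto simp: \<gamma>_def)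
  \<comment> \<open>Beyond this level the drift constant \<open>2 * C\<close> costs at most half of
    the gap \<open>1 - \<gamma>\<close>, which leaves the factor \<open>\<gamma>'\<close>.\<close>
  define R where "R = 4 * C / (1 - \<gamma>) + 1"
  have "(1 - \<gamma>) * R = 4 * C + (1 - \<gamma>)" using \<gamma> by (simp add: R_def distrib_left)
  then have R: "1 \<le> R" "4 * C \<le> (1 - \<gamma>) * R" using C(1) \<gamma> by (auto simp: R_def)
  obtain \<epsilon> where \<epsilon>: "0 < \<epsilon>" "\<epsilon> < 1" and doeblin:
    "\<And>es g x y. (\<forall>e\<in>set es. 0 < e) \<Longrightarrow> 1 \<le> sum_list es \<Longrightarrow> sum_list es \<le> 2 \<Longrightarrow>
     g \<in> borel_measurable borel \<Longrightarrow> (\<forall>x. 0 \<le> g x \<and> g x \<le> 1) \<Longrightarrow> norm (x - y) \<le> sqrt (2 * R) \<Longrightarrow>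
     \<bar>Kl es g x - Kl es g y\<bar> \<le> 1 - \<epsilon>"
    using Kl_doeblin[of "sqrt (2 * R)"] by blast
  \<comment> \<open>Inside the level \<open>R\<close> the weighted part contributes at most
    \<open>\<epsilon>\<close>, half of the gain \<open>2 * \<epsilon>\<close> from the
    minorisation.\<close>
  define \<beta> where "\<beta> = \<epsilon> / (R + 2 * C)"
  have \<beta>: "0 < \<beta>" "\<beta> * (R + 2 * C) = \<epsilon>" using \<epsilon> R C by (auto simp: \<beta>_def)
  define \<gamma>' where "\<gamma>' = (1 + \<gamma>) / 2"
  \<comment> \<open>Value at \<open>w = R\<close> of the ratio
    \<open>(2 + \<beta> * \<gamma>' * w) / (2 + \<beta> * w)\<close>, which decreases in
    \<open>w\<close>.\<close>
  define a1 where "a1 = (2 + \<beta> * \<gamma>' * R) / (2 + \<beta> * R)"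
  define a where "a = max a1 (1 - \<epsilon> / 2)"
  have \<gamma>': "0 < \<gamma>'" "\<gamma>' < 1" using \<gamma> by (auto simp: \<gamma>'_def)
  have a1: "a1 < 1"
  proof -
    have "\<beta> * R * \<gamma>' < \<beta> * R * 1" using \<beta> R \<gamma>' by (intro mult_strict_left_mono) auto
    moreover have "0 < 2 + \<beta> * R" using \<beta> R by (simp add: add_pos_pos)
    ultimately show ?thesis by (simp add: a1_def mult_ac)
  qed
  have a: "0 < a" "a < 1" using a1 \<epsilon> by (auto simp: a_def)
  have main: "\<bar>Kl es g x - Kl es g y\<bar> \<le> a * (2 + \<beta> * ((norm x)\<^sup>2 + (norm y)\<^sup>2))"
    if es: "\<forall>e\<in>set es. 0 < e \<and> e \<le> e0" "1 \<le> sum_list es" "sum_list es \<le> 2"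
      and [measurable]: "g \<in> borel_measurable borel"
      and g: "\<And>x y. \<bar>g x - g y\<bar> \<le> 2 + \<beta> * ((norm x)\<^sup>2 + (norm y)\<^sup>2)" for es g x y
  proof -
    define V where "V = (\<lambda>x :: real^'n. (norm x)\<^sup>2)"
    have V0: "0 \<le> V x" for x by (simp add: V_def)
    have ge: "0 \<le> e" if "e \<in> set es" for e using es that by (auto intro: less_imp_le)
    have V: "Kl es V x \<le> \<gamma> * V x + C" for x
    proof -
      have "Kl es V x \<le> exp (- (K1 / 4) * sum_list es) * V x + C"
        unfolding V_def by (rule C(2)[OF es(1)])
      also have "exp (- (K1 / 4) * sum_list es) \<le> \<gamma>"
        unfolding \<gamma>_def using K1 es(2) by simp
      finally show ?thesis using V0[of x] by (simp add: mult_right_mono)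
    qed
    \<comment> \<open>Turns the oscillation bound into a pointwise one: for this \<open>c\<close>
      the function \<open>g - c\<close> is bounded by \<open>1 + \<beta> * V\<close>, and
      subtracting a constant changes no difference.\<close>
    define c where "c = (SUP x. g x - (1 + \<beta> * V x))"
    have up: "g x - (1 + \<beta> * V x) \<le> g y + (1 + \<beta> * V y)" for x y
      using g[of x y] by (simp add: V_def algebra_simps)
    have c1: "g x - (1 + \<beta> * V x) \<le> c" for x
      unfolding c_def by (rule cSUP_upper) (auto intro!: bdd_aboveI2[OF up])
    have c2: "c \<le> g x + (1 + \<beta> * V x)" for x
      unfolding c_def by (rule cSUP_least[OF _ up]) auto
    define f where "f = (\<lambda>x. g x - c)"
    have [measurable]: "f \<in> borel_measurable borel" unfolding f_def by measurable
    have [measurable]: "V \<in> borel_measurable borel" unfolding V_def by measurable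
    have f: "\<bar>f x\<bar> \<le> 1 + \<beta> * V x" for x using c1[of x] c2[of x] by (auto simp: f_def)
    have pgV: "poly_growth 2 V" unfolding V_def by auto
    have pgf: "poly_growth 2 f"
      unfolding poly_growth_def
    proof (intro conjI exI[of _ "1 + \<beta>"] allI)
      fix x :: "real^'n"
      have "1 \<le> (1 + norm x)\<^sup>2" "V x \<le> (1 + norm x)\<^sup>2" by (auto simp: V_def power_mono)
      then have "1 + \<beta> * V x \<le> (1 + norm x)\<^sup>2 + \<beta> * (1 + norm x)\<^sup>2"
        using \<beta> by (intro add_mono mult_left_mono) auto
      then show "\<bar>f x\<bar> \<le> (1 + \<beta>) * (1 + norm x)\<^sup>2" using f[of x] by (simp add: ring_distribs)
    qed (use \<beta> in auto)
    have gf: "Kl es g x - Kl es g y = Kl es f x - Kl es f y"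
    proof -
      have "g = (\<lambda>x. f x + c)" by (simp add: f_def)
      then have "Kl es g x = Kl es f x + c" for x
        using Kl_add[OF pgf poly_growth_const, of es c x] ge by simp
      then show ?thesis by simp
    qed
    define w where "w = V x + V y"
    have w0: "0 \<le> w" by (simp add: w_def V0)
    have "\<bar>Kl es f x - Kl es f y\<bar> \<le> a * (2 + \<beta> * w)"
    proof (cases "R \<le> w")
      case True
      have abs_f: "\<bar>Kl es f x\<bar> \<le> 1 + \<beta> * (\<gamma> * V x + C)" for x
      proof -
        have pg: "poly_growth 2 (\<lambda>x. 1 + \<beta> * V x)" "poly_growth 2 (\<lambda>x. - 1 * f x)"
          by (intro poly_growth_add poly_growth_cmult poly_growth_const pgV pgf)+
        have "Kl es (\<lambda>x. 1 + \<beta> * V x) x = 1 + \<beta> * Kl es V x"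
          using pgV ge by (subst Kl_add[of 2]) (auto simp: Kl_cmult)
        also have "\<dots> \<le> 1 + \<beta> * (\<gamma> * V x + C)" using V \<beta> by simp
        finally have "Kl es (\<lambda>x. 1 + \<beta> * V x) x \<le> 1 + \<beta> * (\<gamma> * V x + C)" .
        moreover have "f x \<le> 1 + \<beta> * V x" "- 1 * f x \<le> 1 + \<beta> * V x" for x using f[of x] by auto
        then have "Kl es f x \<le> Kl es (\<lambda>x. 1 + \<beta> * V x) x"
          "Kl es (\<lambda>x. - 1 * f x) x \<le> Kl es (\<lambda>x. 1 + \<beta> * V x) x"
          using pg pgf ge by (auto intro!: Kl_mono[of 2])
        ultimately show ?thesis unfolding Kl_cmult by auto
      qed
      have "\<bar>Kl es f x - Kl es f y\<bar> \<le> 2 + \<beta> * (\<gamma> * w + 2 * C)"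
        using abs_f[of x] abs_f[of y] unfolding w_def by (simp add: ring_distribs)
      also have "\<dots> \<le> 2 + \<beta> * (\<gamma>' * w)"
      proof -
        have "4 * C \<le> (1 - \<gamma>) * w"
          using R True \<gamma> by (elim order_trans) (auto intro!: mult_left_mono)
        then have "\<gamma> * w + 2 * C \<le> \<gamma>' * w" by (simp add: \<gamma>'_def field_simps)
        then show ?thesis using \<beta> by simp
      qed
      also have "\<dots> \<le> a1 * (2 + \<beta> * w)"
      proof -
        have "0 \<le> 2 * \<beta> * (w - R) * (1 - \<gamma>')" using \<beta> True \<gamma>' by auto
        then have "(2 + \<beta> * (\<gamma>' * w)) * (2 + \<beta> * R) \<le> (2 + \<beta> * \<gamma>' * R) * (2 + \<beta> * w)"
          by (simp add: algebra_simps)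
        moreover have "0 < 2 + \<beta> * R" using \<beta> R by (simp add: add_pos_pos)
        ultimately show ?thesis by (simp add: a1_def field_simps)
      qed
      also have "\<dots> \<le> a * (2 + \<beta> * w)"
        using \<beta> w0 by (intro mult_right_mono) (auto simp: a_def)
      finally show ?thesis .
    next
      case False
      \<comment> \<open>Clipping \<open>f\<close> to values between -1 and 1 and rescaling gives a
        function to which the minorisation applies; the excess \<open>f2\<close> is bounded by
        \<open>\<beta> * V\<close> and is left to the drift.\<close>
      define g1 where "g1 = (\<lambda>x. (max (- 1) (min 1 (f x)) + 1) / 2)"
      define f2 where "f2 = (\<lambda>x. f x - max (- 1) (min 1 (f x)))"
      have [measurable]: "g1 \<in> borel_measurable borel" unfolding g1_def by measurable
      have g1: "0 \<le> g1 x" "g1 x \<le> 1" for x by (auto simp: g1_def)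
      have f2: "\<bar>f2 x\<bar> \<le> \<beta> * V x" for x
        using f[of x] \<beta> V0[of x] by (auto simp: f2_def max_def min_def)
      have pg1: "poly_growth 2 g1" using g1 by (intro poly_growth_bounded[of _ 1]) auto
      have f2_eq: "f2 = (\<lambda>x. f x + ((- 2) * g1 x + 1))" by (auto simp: f2_def g1_def field_simps)
      have pg2: "poly_growth 2 f2"
        unfolding f2_eq using pgf pg1 by (intro poly_growth_add poly_growth_cmult poly_growth_const)
      have f_eq: "f = (\<lambda>x. f2 x + (2 * g1 x + (- 1)))" by (auto simp: f2_eq)
      have Kf: "Kl es f x = Kl es f2 x + 2 * Kl es g1 x - 1" for x
      proof -
        have "Kl es f x = Kl es (\<lambda>x. f2 x + (2 * g1 x + (- 1))) x"
          by (subst f_eq) simp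
        also have "\<dots> = Kl es f2 x + Kl es (\<lambda>x. 2 * g1 x + (- 1)) x"
          using pg1 pg2 ge by (intro Kl_add[of 2] poly_growth_add poly_growth_cmult poly_growth_const)
        also have "Kl es (\<lambda>x. 2 * g1 x + (- 1)) x = Kl es (\<lambda>x. 2 * g1 x) x + Kl es (\<lambda>_. - 1) x"
          using pg1 ge by (intro Kl_add[of 2] poly_growth_cmult poly_growth_const)
        finally show ?thesis by (simp add: Kl_cmult)
      qed
      have abs_f2: "\<bar>Kl es f2 x\<bar> \<le> \<beta> * (\<gamma> * V x + C)" for x
      proof -
        have pg: "poly_growth 2 (\<lambda>x. \<beta> * V x)" "poly_growth 2 (\<lambda>x. - 1 * f2 x)"
          by (intro poly_growth_cmult pgV pg2)+
        have "Kl es (\<lambda>x. \<beta> * V x) x \<le> \<beta> * (\<gamma> * V x + C)"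
          unfolding Kl_cmult using V \<beta> by simp
        moreover have "f2 x \<le> \<beta> * V x" "- 1 * f2 x \<le> \<beta> * V x" for x using f2[of x] by auto
        then have "Kl es f2 x \<le> Kl es (\<lambda>x. \<beta> * V x) x"
          "Kl es (\<lambda>x. - 1 * f2 x) x \<le> Kl es (\<lambda>x. \<beta> * V x) x"
          using pg pg2 ge by (auto intro!: Kl_mono[of 2])
        ultimately show ?thesis unfolding Kl_cmult by auto
      qed
      have "(norm (x - y))\<^sup>2 \<le> 2 * w"
      proof -
        have "(norm (x - y))\<^sup>2 + (norm (x + y))\<^sup>2 = 2 * w"
          by (simp add: w_def V_def power2_norm_eq_inner inner_simps inner_commute)
        moreover have "0 \<le> (norm (x + y))\<^sup>2" by simp
        ultimately show ?thesis by linarith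
      qed
      also have "\<dots> \<le> 2 * R" using False by simp
      finally have "norm (x - y) \<le> sqrt (2 * R)" by (simp add: real_le_rsqrt)
      then have "\<bar>Kl es g1 x - Kl es g1 y\<bar> \<le> 1 - \<epsilon>"
        using es g1 by (intro doeblin) auto
      then have "\<bar>Kl es f x - Kl es f y\<bar> \<le> 2 * (1 - \<epsilon>) + \<beta> * (\<gamma> * w + 2 * C)"
        using abs_f2[of x] abs_f2[of y] unfolding Kf w_def by (simp add: ring_distribs abs_le_iff)
      also have "\<beta> * (\<gamma> * w + 2 * C) \<le> \<beta> * (R + 2 * C)"
      proof -
        have "\<gamma> * w \<le> 1 * R" using \<gamma> w0 False by (intro mult_mono) auto
        then show ?thesis using \<beta>(1) by (intro mult_left_mono) auto
      qed
      also have "2 * (1 - \<epsilon>) + \<beta> * (R + 2 * C) = (1 - \<epsilon> / 2) * 2" using \<beta> by simp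
      also have "\<dots> \<le> a * (2 + \<beta> * w)"
        using \<beta> w0 \<epsilon> a by (intro mult_mono) (auto simp: a_def)
      finally show ?thesis by simp
    qed
    then show ?thesis unfolding gf w_def V_def by (simp add: add.commute)
  qed
  show ?thesis using \<beta>(1) a main by blast
qed

text \<open>Each window uses at most 2 units of time, so a list of total \<open>2 * m\<close> has
  room for \<open>m\<close> of them. The base case is the oscillation bound 2 of a function bounded
  by 1.\<close>

lemma Kl_contraction:
  "\<exists>\<beta>>0. \<exists>a>0. a < 1 \<and> (\<forall>m es g x y. (\<forall>e\<in>set es. 0 < e \<and> e \<le> e0) \<longrightarrow> 2 * real m \<le> sum_list es \<longrightarrow>
     g \<in> borel_measurable borel \<longrightarrow> (\<forall>x. \<bar>g x\<bar> \<le> 1) \<longrightarrow>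
     \<bar>Kl es g x - Kl es g y\<bar> \<le> a ^ m * (2 + \<beta> * ((norm x)\<^sup>2 + (norm y)\<^sup>2)))"
proof -
  obtain \<beta> a where \<beta>: "0 < \<beta>" and a: "0 < a" "a < 1" and window:
    "\<And>es g x y. (\<forall>e\<in>set es. 0 < e \<and> e \<le> e0) \<Longrightarrow> 1 \<le> sum_list es \<Longrightarrow> sum_list es \<le> 2 \<Longrightarrow>
     g \<in> borel_measurable borel \<Longrightarrow>
     (\<forall>x y. \<bar>g x - g y\<bar> \<le> 2 + \<beta> * ((norm x)\<^sup>2 + (norm y)\<^sup>2)) \<Longrightarrow>
     \<bar>Kl es g x - Kl es g y\<bar> \<le> a * (2 + \<beta> * ((norm x)\<^sup>2 + (norm y)\<^sup>2))"
    using Kl_contraction_window by blast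
  have "\<bar>Kl es g x - Kl es g y\<bar> \<le> a ^ m * (2 + \<beta> * ((norm x)\<^sup>2 + (norm y)\<^sup>2))"
    if "\<forall>e\<in>set es. 0 < e \<and> e \<le> e0" "2 * real m \<le> sum_list es"
      "g \<in> borel_measurable borel" "\<forall>x. \<bar>g x\<bar> \<le> 1" for m es g x y
    using that
  proof (induction m arbitrary: es x y)
    case 0
    then have "\<bar>Kl es g x\<bar> \<le> 1" for x
      using Kl_bounds[of g "-1" 1 es x] by (fastforce simp: abs_le_iff)
    from this[of x] this[of y] have "\<bar>Kl es g x - Kl es g y\<bar> \<le> 2" by simp
    then show ?case using \<beta> by (auto intro: order_trans)
  next
    case (Suc m)
    obtain fs gs where fg: "es = fs @ gs" "1 \<le> sum_list fs" "sum_list fs \<le> 1 + 1"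
      using split_list_sum[of es 1] Suc.prems e0 by force
    \<comment> \<open>Division by \<open>a ^ m\<close> restores the normalisation that
      \<open>window\<close> requires.\<close>
    define G where "G = (\<lambda>x. inverse (a ^ m) * Kl gs g x)"
    have [measurable]: "g \<in> borel_measurable borel" by fact
    have "\<bar>Kl gs g x - Kl gs g y\<bar> \<le> a ^ m * (2 + \<beta> * ((norm x)\<^sup>2 + (norm y)\<^sup>2))" for x y
      using Suc.prems fg by (intro Suc.IH) auto
    then have "\<bar>G x - G y\<bar> \<le> 2 + \<beta> * ((norm x)\<^sup>2 + (norm y)\<^sup>2)" for x y
      using a by (simp add: G_def right_diff_distrib[symmetric] abs_mult field_simps)
    then have "\<bar>Kl fs G x - Kl fs G y\<bar> \<le> a * (2 + \<beta> * ((norm x)\<^sup>2 + (norm y)\<^sup>2))"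
      using Suc.prems fg by (intro window) (auto simp: G_def)
    moreover have "Kl fs G x = inverse (a ^ m) * Kl es g x" for x
      unfolding G_def Kl_cmult fg by (simp add: Kl_append)
    ultimately show ?case
      using a by (simp add: right_diff_distrib[symmetric] abs_mult field_simps)
  qed
  then show ?thesis using \<beta> a by blast
qed

end


section \<open>The chain as a Markov process\<close>

lemma integrable_gauss_one_plus_norm1: "integrable gauss (\<lambda>z :: real^'n. (1 + norm z) ^ k)"
  by (subst binomial_ring) auto

locale iid_noise = prob_space M for M :: "'a measure" +
  fixes \<xi> :: "nat \<Rightarrow> 'a \<Rightarrow> real^'n"
  assumes indep_noise: "indep_vars (\<lambda>_. borel) \<xi> {1..}"
    and distributed_noise: "1 \<le> k \<Longrightarrow> distributed M lborel (\<xi> k) (isotropic_normal_density 1)"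
begin

section \<open>The past of the noise and integration over the next variable\<close>

lemma measurable_noise [measurable]: "1 \<le> k \<Longrightarrow> \<xi> k \<in> borel_measurable M"
  using distributed_measurable[OF distributed_noise[of k]] by simp

lemma measurable_noise_Suc [measurable]: "\<xi> (Suc k) \<in> borel_measurable M"
  by (rule measurable_noise) simp

lemma distr_noise: "1 \<le> k \<Longrightarrow> distr M borel (\<xi> k) = gauss"
proof -
  assume "1 \<le> k"
  then have "distr M lborel (\<xi> k) = gauss"
    using distributed_distr_eq_density[OF distributed_noise[of k]] by (simp add: gauss_def)
  moreover have "distr M borel (\<xi> k) = distr M lborel (\<xi> k)"
    by (rule distr_cong) auto
  ultimately show ?thesis by simp
qed

text \<open>Generated by the tuple of the first \<open>k\<close> noise variables, so an event of the
  past is the preimage of a set of tuples and independence of blocks of noise applies to it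
  directly.\<close>

definition F :: "nat \<Rightarrow> 'a measure" where
  "F k = vimage_algebra (space M) (\<lambda>\<omega>. \<lambda>i\<in>{1..k}. \<xi> i \<omega>) (\<Pi>\<^sub>M i\<in>{1..k}. borel)"

lemma space_F [simp]: "space (F k) = space M"
  by (simp add: F_def)

lemma measurable_past: "(\<lambda>\<omega>. \<lambda>i\<in>{1..k}. \<xi> i \<omega>) \<in> measurable M (\<Pi>\<^sub>M i\<in>{1..k}. borel)"
  by (rule measurable_restrict) auto

lemma sets_F: "sets (F k) = {(\<lambda>\<omega>. \<lambda>i\<in>{1..k}. \<xi> i \<omega>) -` A \<inter> space M | A. A \<in> sets (\<Pi>\<^sub>M i\<in>{1..k}. borel)}"
  unfolding F_def by (rule sets_vimage_algebra2) (use measurable_space[OF measurable_past] in auto)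

lemma sets_F_subset: "sets (F k) \<subseteq> sets M"
  unfolding sets_F using measurable_sets[OF measurable_past] by auto

lemma measurable_F_M: "Y \<in> measurable (F k) N \<Longrightarrow> Y \<in> measurable M N"
  using sets_F_subset[of k] by (auto simp: measurable_def)

lemma measurable_noise_F: "1 \<le> i \<Longrightarrow> i \<le> k \<Longrightarrow> \<xi> i \<in> borel_measurable (F k)"
proof -
  assume i: "1 \<le> i" "i \<le> k"
  have "(\<lambda>\<omega>. \<lambda>i\<in>{1..k}. \<xi> i \<omega>) \<in> measurable (F k) (\<Pi>\<^sub>M i\<in>{1..k}. borel)"
    unfolding F_def by (rule measurable_vimage_algebra1) (use measurable_space[OF measurable_past] in auto)
  moreover have "(\<lambda>f. f i) \<in> measurable (\<Pi>\<^sub>M i\<in>{1..k}. borel) (borel :: (real^'n) measure)"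
    using i by (intro measurable_component_singleton) auto
  ultimately have "(\<lambda>\<omega>. (\<lambda>i\<in>{1..k}. \<xi> i \<omega>) i) \<in> borel_measurable (F k)"
    by (rule measurable_compose)
  then show ?thesis using i by simp
qed

lemma measurable_F_mono:
  assumes "j \<le> k" "Y \<in> measurable (F j) N"
  shows "Y \<in> measurable (F k) N"
proof -
  have *: "(\<lambda>\<omega>. \<lambda>i\<in>{1..j}. \<xi> i \<omega>) \<in> measurable (F k) (\<Pi>\<^sub>M i\<in>{1..j}. borel)"
    using assms(1) by (intro measurable_restrict measurable_noise_F) auto
  have "sets (F j) \<subseteq> sets (F k)"
    unfolding sets_F[of j] using measurable_sets[OF *] by auto
  then show ?thesis using assms(2) by (auto simp: measurable_def)
qed

lemma prob_past_noise:
  assumes A: "A \<in> sets (F k)" and B: "B \<in> sets borel"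
  shows "emeasure M (A \<inter> (\<xi> (Suc k) -` B \<inter> space M)) = emeasure M A * emeasure gauss B"
proof -
  have ind: "indep_var (\<Pi>\<^sub>M i\<in>{1..k}. borel) (\<lambda>\<omega>. \<lambda>i\<in>{1..k}. \<xi> i \<omega>)
      (\<Pi>\<^sub>M i\<in>{Suc k}. borel) (\<lambda>\<omega>. \<lambda>i\<in>{Suc k}. \<xi> i \<omega>)"
    by (rule indep_var_restrict[OF indep_noise]) auto
  let ?B = "(\<lambda>f. f (Suc k)) -` B \<inter> space (\<Pi>\<^sub>M i\<in>{Suc k}. (borel :: (real^'n) measure))"
  have B': "?B \<in> sets (\<Pi>\<^sub>M i\<in>{Suc k}. borel)"
    using measurable_sets[OF measurable_component_singleton[of "Suc k" "{Suc k}" "\<lambda>_. borel"] B] by simp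
  obtain A' where A': "A = (\<lambda>\<omega>. \<lambda>i\<in>{1..k}. \<xi> i \<omega>) -` A' \<inter> space M" "A' \<in> sets (\<Pi>\<^sub>M i\<in>{1..k}. borel)"
    using A unfolding sets_F by auto
  have "prob (A \<inter> (\<xi> (Suc k) -` B \<inter> space M)) =
      prob (A) * prob (\<xi> (Suc k) -` B \<inter> space M)"
  proof -
    have 1: "(\<lambda>\<omega>. (\<lambda>i\<in>{1..k}. \<xi> i \<omega>, \<lambda>i\<in>{Suc k}. \<xi> i \<omega>)) -` (A' \<times> ?B) \<inter> space M =
        A \<inter> (\<xi> (Suc k) -` B \<inter> space M)"
      unfolding A'(1) by (auto simp: space_PiM)
    have 2: "(\<lambda>\<omega>. \<lambda>i\<in>{Suc k}. \<xi> i \<omega>) -` ?B \<inter> space M = \<xi> (Suc k) -` B \<inter> space M"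
      by (auto simp: space_PiM)
    show ?thesis using indep_varD[OF ind A'(2) B'] unfolding 1 2 A'(1)[symmetric] .
  qed
  moreover have "emeasure M (\<xi> (Suc k) -` B \<inter> space M) = emeasure gauss B"
    using B by (simp add: distr_noise[of "Suc k", symmetric] emeasure_distr)
  ultimately show ?thesis
    by (simp add: emeasure_eq_measure ennreal_mult)
qed

lemma distr_past_noise:
  assumes Y: "Y \<in> measurable (F k) S"
  shows "distr M (S \<Otimes>\<^sub>M borel) (\<lambda>\<omega>. (Y \<omega>, \<xi> (Suc k) \<omega>)) = distr M S Y \<Otimes>\<^sub>M gauss"
proof (rule pair_measure_eqI[symmetric])
  note [measurable] = measurable_F_M[OF Y]
  interpret Y: prob_space "distr M S Y" by (rule prob_space_distr) measurable
  show "sigma_finite_measure (distr M S Y)" "sigma_finite_measure (gauss :: (real^'n) measure)"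
    by unfold_locales
  show "sets (distr M S Y \<Otimes>\<^sub>M gauss) = sets (distr M (S \<Otimes>\<^sub>M borel) (\<lambda>\<omega>. (Y \<omega>, \<xi> (Suc k) \<omega>)))"
    by (simp cong: sets_pair_measure_cong)
  fix A and B :: "(real^'n) set"
  assume "A \<in> sets (distr M S Y)" "B \<in> sets gauss"
  then have [measurable]: "A \<in> sets S" "B \<in> sets borel" by auto
  have "Y -` A \<inter> space M \<in> sets (F k)"
    using measurable_sets[OF Y] by auto
  moreover have "(\<lambda>\<omega>. (Y \<omega>, \<xi> (Suc k) \<omega>)) -` (A \<times> B) \<inter> space M =
      (Y -` A \<inter> space M) \<inter> (\<xi> (Suc k) -` B \<inter> space M)"
    by auto
  ultimately show "emeasure (distr M S Y) A * emeasure gauss B =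
      emeasure (distr M (S \<Otimes>\<^sub>M borel) (\<lambda>\<omega>. (Y \<omega>, \<xi> (Suc k) \<omega>))) (A \<times> B)"
    using prob_past_noise[of "Y -` A \<inter> space M" k B] by (simp add: emeasure_distr)
qed

text \<open>Freezing: a variable of the past is held fixed while the next noise is integrated out.
  This takes the place of conditional expectations; the nonnegative form serves where integrability
  is still to be shown.\<close>

lemma nn_integral_next:
  assumes Y: "Y \<in> measurable (F k) S" and [measurable]: "f \<in> borel_measurable (S \<Otimes>\<^sub>M borel)"
  shows "(\<integral>\<^sup>+ \<omega>. f (Y \<omega>, \<xi> (Suc k) \<omega>) \<partial>M) = (\<integral>\<^sup>+ \<omega>. (\<integral>\<^sup>+ z. f (Y \<omega>, z) \<partial>gauss) \<partial>M)"
proof -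
  note [measurable] = measurable_F_M[OF Y]
  have "(\<integral>\<^sup>+ \<omega>. f (Y \<omega>, \<xi> (Suc k) \<omega>) \<partial>M) =
      (\<integral>\<^sup>+ w. f w \<partial>distr M (S \<Otimes>\<^sub>M borel) (\<lambda>\<omega>. (Y \<omega>, \<xi> (Suc k) \<omega>)))"
    by (subst nn_integral_distr) auto
  also have "\<dots> = (\<integral>\<^sup>+ y. (\<integral>\<^sup>+ z. f (y, z) \<partial>gauss) \<partial>distr M S Y)"
    unfolding distr_past_noise[OF Y]
    by (rule gauss.nn_integral_fst[symmetric]) (simp cong: measurable_cong_sets sets_pair_measure_cong)
  also have "\<dots> = (\<integral>\<^sup>+ \<omega>. (\<integral>\<^sup>+ z. f (Y \<omega>, z) \<partial>gauss) \<partial>M)"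
    by (subst nn_integral_distr) auto
  finally show ?thesis .
qed

lemma integral_next:
  fixes f :: "'b \<times> (real^'n) \<Rightarrow> 'c :: {banach, second_countable_topology}"
  assumes Y: "Y \<in> measurable (F k) S" and [measurable]: "f \<in> borel_measurable (S \<Otimes>\<^sub>M borel)"
    and int: "integrable M (\<lambda>\<omega>. f (Y \<omega>, \<xi> (Suc k) \<omega>))"
  shows "(\<integral>\<omega>. f (Y \<omega>, \<xi> (Suc k) \<omega>) \<partial>M) = (\<integral>\<omega>. (\<integral>z. f (Y \<omega>, z) \<partial>gauss) \<partial>M)"
proof -
  note [measurable] = measurable_F_M[OF Y]
  interpret Y: prob_space "distr M S Y" by (rule prob_space_distr) measurable
  interpret P: pair_sigma_finite "distr M S Y" "gauss :: (real^'n) measure" by unfold_locales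
  have "(\<integral>\<omega>. f (Y \<omega>, \<xi> (Suc k) \<omega>) \<partial>M) =
      (\<integral>w. f w \<partial>distr M (S \<Otimes>\<^sub>M borel) (\<lambda>\<omega>. (Y \<omega>, \<xi> (Suc k) \<omega>)))"
    by (subst integral_distr) auto
  also have "\<dots> = (\<integral>y. (\<integral>z. f (y, z) \<partial>gauss) \<partial>distr M S Y)"
    unfolding distr_past_noise[OF Y]
  proof (rule P.integral_fst'[symmetric])
    show "integrable (distr M S Y \<Otimes>\<^sub>M gauss) f"
      unfolding distr_past_noise[OF Y, symmetric] using int by (subst integrable_distr_eq) auto
  qed
  also have "\<dots> = (\<integral>\<omega>. (\<integral>z. f (Y \<omega>, z) \<partial>gauss) \<partial>M)"
    by (subst integral_distr) auto
  finally show ?thesis .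
qed

end

section \<open>Markov property and uniform moments\<close>

locale em_chain = em_kernel b \<sigma> L K1 K2 + iid_noise M \<xi>
  for b :: "real^'n \<Rightarrow> real^'n" and \<sigma> L K1 K2 and M :: "'a measure" and \<xi> :: "nat \<Rightarrow> 'a \<Rightarrow> real^'n" +
  fixes \<eta> :: "nat \<Rightarrow> real" and x0 :: "real^'n"
  assumes \<eta>_pos: "1 \<le> k \<Longrightarrow> 0 < \<eta> k"
begin

abbreviation \<theta> :: "nat \<Rightarrow> 'a \<Rightarrow> real^'n" where
  "\<theta> \<equiv> euler_maruyama b \<sigma> \<eta> \<xi> x0"

lemma \<theta>_Suc: "\<theta> (Suc k) \<omega> = em_step (\<eta> (Suc k)) (\<theta> k \<omega>) (\<xi> (Suc k) \<omega>)"
  by (simp add: em_step_def)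

lemma measurable_\<theta>_F: "j \<le> k \<Longrightarrow> \<theta> j \<in> borel_measurable (F k)"
proof (induction j)
  case 0
  then show ?case by simp
next
  case (Suc j)
  then have [measurable]: "\<theta> j \<in> borel_measurable (F k)" "\<xi> (Suc j) \<in> borel_measurable (F k)"
    by (auto intro!: measurable_noise_F)
  show ?case unfolding \<theta>_Suc by measurable
qed

lemma measurable_\<theta> [measurable]: "\<theta> k \<in> borel_measurable M"
  by (rule measurable_F_M[OF measurable_\<theta>_F[OF order_refl]])

lemma \<eta>_Suc_pos [simp]: "0 < \<eta> (Suc k)" and \<eta>_Suc_nonneg [simp]: "0 \<le> \<eta> (Suc k)"
  using \<eta>_pos[of "Suc k"] by auto

text \<open>The factor \<open>Y\<close> from the past makes one identity serve for means and for
  covariances. The step from \<open>\<theta> i\<close> to \<open>\<theta> (Suc i)\<close> has size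
  \<open>\<eta> (Suc i)\<close>, which explains the range of the list.\<close>

lemma markov:
  assumes "j \<le> k" and Y: "Y \<in> borel_measurable (F j)" "\<And>\<omega>. \<bar>Y \<omega>\<bar> \<le> c"
    and [measurable]: "f \<in> borel_measurable borel" and f: "\<And>x. \<bar>f x\<bar> \<le> d"
  shows "(\<integral>\<omega>. Y \<omega> * f (\<theta> k \<omega>) \<partial>M) = (\<integral>\<omega>. Y \<omega> * Kl (map \<eta> [Suc j..<Suc k]) f (\<theta> j \<omega>) \<partial>M)"
  using assms(1,4) f
\<comment> \<open>The last step is integrated out, which replaces \<open>f\<close> by
  \<open>K (\<eta> (Suc k)) f\<close>; hence \<open>f\<close> is generalised.\<close>
proof (induction k arbitrary: f rule: dec_induct)
  case base
  then show ?case by simp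
next
  case (step k)
  note [measurable] = \<open>f \<in> borel_measurable borel\<close>
  have "\<theta> k \<in> borel_measurable (F k)" by (rule measurable_\<theta>_F) simp
  moreover have YF: "Y \<in> borel_measurable (F k)" by (rule measurable_F_mono[OF step.hyps(1) Y(1)])
  ultimately have Z: "(\<lambda>\<omega>. (Y \<omega>, \<theta> k \<omega>)) \<in> measurable (F k) (borel \<Otimes>\<^sub>M borel)" by measurable
  note [measurable] = measurable_F_M[OF YF]
  let ?g = "\<lambda>(p, z). fst p * f (em_step (\<eta> (Suc k)) (snd p) z)"
  have "(\<integral>\<omega>. Y \<omega> * f (\<theta> (Suc k) \<omega>) \<partial>M) = (\<integral>\<omega>. ?g ((Y \<omega>, \<theta> k \<omega>), \<xi> (Suc k) \<omega>) \<partial>M)"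
    by (simp add: \<theta>_Suc del: euler_maruyama.simps)
  also have "\<dots> = (\<integral>\<omega>. (\<integral>z. ?g ((Y \<omega>, \<theta> k \<omega>), z) \<partial>gauss) \<partial>M)"
  proof (rule integral_next[OF Z])
    show "integrable M (\<lambda>\<omega>. ?g ((Y \<omega>, \<theta> k \<omega>), \<xi> (Suc k) \<omega>))"
      by (rule integrable_const_bound[of _ "c * d"])
        (auto simp: abs_mult intro!: mult_mono Y step.prems order_trans[OF abs_ge_zero Y(2)])
  qed measurable
  also have "\<dots> = (\<integral>\<omega>. Y \<omega> * K (\<eta> (Suc k)) f (\<theta> k \<omega>) \<partial>M)"
    by (simp add: K_def)
  also have "\<dots> = (\<integral>\<omega>. Y \<omega> * Kl (map \<eta> [Suc j..<Suc k]) (K (\<eta> (Suc k)) f) (\<theta> j \<omega>) \<partial>M)"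
  proof (rule step.IH)
    show "\<bar>K (\<eta> (Suc k)) f x\<bar> \<le> d" for x
      using Kl_bounds[of f "-d" d "[\<eta> (Suc k)]" x] step.prems by (auto simp: abs_le_iff minus_le_iff)
  qed measurable
  finally show ?case
    using step.hyps by (simp add: Kl_append)
qed

lemma expectation_Kl:
  assumes [measurable]: "f \<in> borel_measurable borel" and f: "\<And>x. \<bar>f x\<bar> \<le> d"
  shows "(\<integral>\<omega>. f (\<theta> k \<omega>) \<partial>M) = Kl (map \<eta> [1..<Suc k]) f x0"
  using markov[of 0 k "\<lambda>_. 1" 1 f d] f prob_space by simp

lemma moment_bound_even:
  assumes \<eta>: "\<And>k. 1 \<le> k \<Longrightarrow> \<eta> k \<le> e0"
  shows "\<exists>C\<ge>0. \<forall>k. integrable M (\<lambda>\<omega>. norm (\<theta> k \<omega>) ^ (2 * Suc q)) \<and>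
    (\<integral>\<omega>. norm (\<theta> k \<omega>) ^ (2 * Suc q) \<partial>M) \<le> C"
proof -
  let ?V = "\<lambda>x :: real^'n. norm x ^ (2 * Suc q)"
  obtain C where C: "0 \<le> C" "\<And>e x. 0 < e \<Longrightarrow> e \<le> e0 \<Longrightarrow> K e ?V x \<le> (1 - K1 / 4 * e) * ?V x + C * e"
    using drift_power[of q] by blast
  \<comment> \<open>\<open>4 * C / K1\<close> is the fixed point of the drift recursion for every
    step size, so a mean that starts below \<open>B\<close> stays below it.\<close>
  define B where "B = max (?V x0) (4 * C / K1)"
  have "K1 * (4 * C / K1) \<le> K1 * B" using K1 by (intro mult_left_mono) (auto simp: B_def)
  then have B: "?V x0 \<le> B" "C \<le> K1 / 4 * B" "0 \<le> B"
    using K1 C(1) by (auto simp: B_def le_max_iff_disj)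
  have pg: "poly_growth (2 * Suc q) ?V" by (rule poly_growth_norm_power) simp
  have "integrable M (\<lambda>\<omega>. ?V (\<theta> k \<omega>)) \<and> (\<integral>\<omega>. ?V (\<theta> k \<omega>) \<partial>M) \<le> B" for k
  proof (induction k)
    case 0
    then show ?case using B prob_space by simp
  next
    case (Suc k)
    define e where "e = \<eta> (Suc k)"
    have e: "0 < e" "e \<le> e0"
      using \<eta>[of "Suc k"] by (auto simp: e_def)
    have "e \<le> 1 / K1" using e by (simp add: e0_def)
    then have "e * K1 \<le> 1" using K1 by (simp add: pos_le_divide_eq)
    then have "K1 / 4 * e \<le> 1" by (simp add: mult.commute)
    note e = e this
    have int: "integrable M (\<lambda>\<omega>. (1 - K1 / 4 * e) * ?V (\<theta> k \<omega>) + C * e)" using Suc by auto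
    \<comment> \<open>The nonnegative integral is used first, since finiteness of the moment at
      \<open>Suc k\<close> is part of the claim.\<close>
    have "(\<integral>\<^sup>+ \<omega>. ennreal (?V (\<theta> (Suc k) \<omega>)) \<partial>M) =
        (\<integral>\<^sup>+ \<omega>. (\<lambda>(y, z). ennreal (?V (em_step e y z))) (\<theta> k \<omega>, \<xi> (Suc k) \<omega>) \<partial>M)"
      by (simp add: \<theta>_Suc e_def del: euler_maruyama.simps power_Suc)
    also have "\<dots> = (\<integral>\<^sup>+ \<omega>. (\<integral>\<^sup>+ z. ennreal (?V (em_step e (\<theta> k \<omega>) z)) \<partial>gauss) \<partial>M)"
      by (subst nn_integral_next[OF measurable_\<theta>_F[OF order_refl]]) (auto simp del: power_Suc)
    also have "\<dots> = (\<integral>\<^sup>+ \<omega>. ennreal (K e ?V (\<theta> k \<omega>)) \<partial>M)"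
      unfolding K_def using integrable_em_step(1)[OF pg] e
      by (intro nn_integral_cong nn_integral_eq_integral) (auto simp del: power_Suc)
    also have "\<dots> \<le> (\<integral>\<^sup>+ \<omega>. ennreal ((1 - K1 / 4 * e) * ?V (\<theta> k \<omega>) + C * e) \<partial>M)"
      by (intro nn_integral_mono ennreal_leI C e)
    also have "\<dots> = ennreal (\<integral>\<omega>. (1 - K1 / 4 * e) * ?V (\<theta> k \<omega>) + C * e \<partial>M)"
      using e C by (intro nn_integral_eq_integral int AE_I2 add_nonneg_nonneg mult_nonneg_nonneg) auto
    also have "(\<integral>\<omega>. (1 - K1 / 4 * e) * ?V (\<theta> k \<omega>) + C * e \<partial>M) = (1 - K1 / 4 * e) * (\<integral>\<omega>. ?V (\<theta> k \<omega>) \<partial>M) + C * e"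
      using Suc prob_space by (simp del: power_Suc)
    also have "\<dots> \<le> (1 - K1 / 4 * e) * B + (K1 / 4 * B) * e"
      using Suc e B by (intro add_mono mult_left_mono mult_right_mono) auto
    also have "\<dots> = B" by (simp add: algebra_simps)
    finally have le: "(\<integral>\<^sup>+ \<omega>. ennreal (?V (\<theta> (Suc k) \<omega>)) \<partial>M) \<le> ennreal B"
      using ennreal_leI by simp
    have int': "integrable M (\<lambda>\<omega>. ?V (\<theta> (Suc k) \<omega>))"
      by (rule integrableI_nonneg) (use le in \<open>auto simp del: euler_maruyama.simps intro: le_less_trans\<close>)
    then show ?case
      using le B(3) by (subst (asm) nn_integral_eq_integral) (auto simp del: euler_maruyama.simps power_Suc)
  qed
  then show ?thesis using B by blast
qed

text \<open>The terms of the later expansion are bounded by such products. The two factors are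
  independent, and the power of \<open>1 + norm (\<theta> k \<omega>)\<close> is dominated by an
  even power of the norm, for which the drift is known.\<close>

lemma moment_bound:
  assumes \<eta>: "\<And>k. 1 \<le> k \<Longrightarrow> \<eta> k \<le> e0"
  shows "\<exists>C\<ge>0. \<forall>k. integrable M (\<lambda>\<omega>. (1 + norm (\<theta> k \<omega>)) ^ q * (1 + norm (\<xi> (Suc k) \<omega>)) ^ r) \<and>
    (\<integral>\<omega>. (1 + norm (\<theta> k \<omega>)) ^ q * (1 + norm (\<xi> (Suc k) \<omega>)) ^ r \<partial>M) \<le> C"
proof -
  obtain C where C: "0 \<le> C" "\<And>k. integrable M (\<lambda>\<omega>. norm (\<theta> k \<omega>) ^ (2 * Suc q))"
    "\<And>k. (\<integral>\<omega>. norm (\<theta> k \<omega>) ^ (2 * Suc q) \<partial>M) \<le> C"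
    using moment_bound_even[OF \<eta>, of q] by blast
  define c where "c = (\<integral>z. (1 + norm (z :: real^'n)) ^ r \<partial>gauss)"
  have c: "0 \<le> c" unfolding c_def by (intro integral_nonneg_AE) auto
  have pw: "(1 + norm y) ^ q \<le> 2 ^ q * (1 + norm y ^ (2 * Suc q))" for y :: "real^'n"
  proof (cases "norm y \<le> 1")
    case True
    then have "(1 + norm y) ^ q \<le> 2 ^ q * 1" by (simp add: power_mono)
    also have "\<dots> \<le> 2 ^ q * (1 + norm y ^ (2 * Suc q))" by (intro mult_left_mono) auto
    finally show ?thesis .
  next
    case False
    then have "(1 + norm y) ^ q \<le> (2 * norm y) ^ q" by (intro power_mono) auto
    also have "\<dots> = 2 ^ q * norm y ^ q" by (simp add: power_mult_distrib)
    also have "\<dots> \<le> 2 ^ q * norm y ^ (2 * Suc q)" using False by (intro mult_left_mono power_increasing) auto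
    finally show ?thesis by (simp add: ring_distribs add_increasing del: power_Suc)
  qed
  define B where "B = 2 ^ q * (1 + C) * c"
  have B: "0 \<le> B" using C c by (auto simp: B_def)
  let ?X = "\<lambda>k \<omega>. (1 + norm (\<theta> k \<omega>)) ^ q * (1 + norm (\<xi> (Suc k) \<omega>)) ^ r"
  have "integrable M (?X k) \<and> (\<integral>\<omega>. ?X k \<omega> \<partial>M) \<le> B" for k
  proof -
    have int: "integrable M (\<lambda>\<omega>. 2 ^ q * (1 + norm (\<theta> k \<omega>) ^ (2 * Suc q)) * c)" using C(2)[of k] by auto
    have "(\<integral>\<^sup>+ \<omega>. ennreal (?X k \<omega>) \<partial>M) =
        (\<integral>\<^sup>+ \<omega>. (\<lambda>(y, z). ennreal ((1 + norm y) ^ q * (1 + norm z) ^ r)) (\<theta> k \<omega>, \<xi> (Suc k) \<omega>) \<partial>M)"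
      by simp
    also have "\<dots> = (\<integral>\<^sup>+ \<omega>. (\<integral>\<^sup>+ z. ennreal ((1 + norm (\<theta> k \<omega>)) ^ q * (1 + norm (z :: real^'n)) ^ r) \<partial>gauss) \<partial>M)"
      by (subst nn_integral_next[OF measurable_\<theta>_F[OF order_refl]]) auto
    also have "\<dots> = (\<integral>\<^sup>+ \<omega>. ennreal ((1 + norm (\<theta> k \<omega>)) ^ q * c) \<partial>M)"
    proof (rule nn_integral_cong)
      fix \<omega>
      have "integrable gauss (\<lambda>z :: real^'n. (1 + norm (\<theta> k \<omega>)) ^ q * (1 + norm z) ^ r)"
        by (simp add: integrable_gauss_one_plus_norm1)
      then show "(\<integral>\<^sup>+ z. ennreal ((1 + norm (\<theta> k \<omega>)) ^ q * (1 + norm (z :: real^'n)) ^ r) \<partial>gauss) =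
          ennreal ((1 + norm (\<theta> k \<omega>)) ^ q * c)"
        unfolding c_def by (subst nn_integral_eq_integral) auto
    qed
    also have "\<dots> \<le> (\<integral>\<^sup>+ \<omega>. ennreal (2 ^ q * (1 + norm (\<theta> k \<omega>) ^ (2 * Suc q)) * c) \<partial>M)"
      using c by (intro nn_integral_mono ennreal_leI mult_right_mono pw)
    also have "\<dots> = ennreal (\<integral>\<omega>. 2 ^ q * (1 + norm (\<theta> k \<omega>) ^ (2 * Suc q)) * c \<partial>M)"
      using c by (intro nn_integral_eq_integral int AE_I2 mult_nonneg_nonneg add_nonneg_nonneg) auto
    also have "(\<integral>\<omega>. 2 ^ q * (1 + norm (\<theta> k \<omega>) ^ (2 * Suc q)) * c \<partial>M) =
        2 ^ q * (1 + (\<integral>\<omega>. norm (\<theta> k \<omega>) ^ (2 * Suc q) \<partial>M)) * c"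
      using C(2)[of k] prob_space by (simp del: power_Suc)
    also have "ennreal \<dots> \<le> ennreal B"
      unfolding B_def using C c by (intro ennreal_leI mult_right_mono mult_left_mono add_left_mono) auto
    finally have le: "(\<integral>\<^sup>+ \<omega>. ennreal (?X k \<omega>) \<partial>M) \<le> ennreal B" .
    have int': "integrable M (?X k)"
      by (rule integrableI_nonneg) (use le in \<open>auto intro: le_less_trans\<close>)
    then show ?thesis
      using le B by (subst (asm) nn_integral_eq_integral) auto
  qed
  then show ?thesis using B by blast
qed

end


section \<open>Comparison with the diffusion\<close>

lemma isotropic_normal_density_scale:
  assumes v: "0 < v"
  shows "sqrt v ^ CARD('n) * isotropic_normal_density v (sqrt v *\<^sub>R (z :: real^'n)) = isotropic_normal_density 1 z"
proof -
  have "sqrt v ^ CARD('n) * isotropic_normal_density v (sqrt v *\<^sub>R z) =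
      (\<Prod>i\<in>(UNIV :: 'n set). sqrt v * normal_density 0 (sqrt v) (sqrt v * z $ i))"
    by (simp add: isotropic_normal_density_def prod.distrib)
  also have "\<dots> = (\<Prod>i\<in>(UNIV :: 'n set). normal_density 0 1 (z $ i))"
    using v by (intro prod.cong refl) (simp add: normal_density_def real_sqrt_mult power_mult_distrib)
  finally show ?thesis by (simp add: isotropic_normal_density_def)
qed

lemma distr_density_isotropic_scale:
  assumes v: "0 < v"
  shows "distr (density lborel (\<lambda>z. ennreal (isotropic_normal_density v (z :: real^'n)))) borel
      (\<lambda>z. (1 / sqrt v) *\<^sub>R z) = gauss"
proof (rule measure_eqI)
  fix A :: "(real^'n) set"
  assume "A \<in> sets (distr (density lborel (\<lambda>z. ennreal (isotropic_normal_density v z))) borel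
      (\<lambda>z. (1 / sqrt v) *\<^sub>R z))"
  then have [measurable]: "A \<in> sets borel" by simp
  have vm: "(\<lambda>z. (1 / sqrt v) *\<^sub>R z) -` A \<in> sets borel"
    by (rule measurable_sets_borel) measurable
  let ?T = "\<lambda>x :: real^'n. 0 + (\<Sum>j\<in>Basis. (sqrt v * (x \<bullet> j)) *\<^sub>R j)"
  have T: "?T = (\<lambda>x. sqrt v *\<^sub>R x)"
    by (auto simp: scaleR_scaleR[symmetric] scaleR_sum_right[symmetric] euclidean_representation simp del: scaleR_scaleR)
  have lb: "lborel = density (distr lborel borel (\<lambda>x :: real^'n. sqrt v *\<^sub>R x)) (\<lambda>_. ennreal (sqrt v ^ CARD('n)))"
    using lborel_affine_euclidean[of "\<lambda>_ :: real^'n. sqrt v" 0] v unfolding T by simp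
  have "emeasure (distr (density lborel (\<lambda>z. ennreal (isotropic_normal_density v z))) borel
      (\<lambda>z. (1 / sqrt v) *\<^sub>R z)) A =
      (\<integral>\<^sup>+ z. ennreal (isotropic_normal_density v z) * indicator A ((1 / sqrt v) *\<^sub>R z) \<partial>lborel)"
    using vm by (subst emeasure_distr)
      (auto simp: emeasure_density intro!: nn_integral_cong split: split_indicator)
  also have "\<dots> = (\<integral>\<^sup>+ z. ennreal (sqrt v ^ CARD('n)) * (ennreal (isotropic_normal_density v (sqrt v *\<^sub>R z)) * indicator A z) \<partial>lborel)"
    using v by (subst lb) (simp add: nn_integral_density nn_integral_distr)
  also have "\<dots> = (\<integral>\<^sup>+ z. ennreal (isotropic_normal_density 1 z) * indicator A z \<partial>lborel)"
    using v by (simp add: isotropic_normal_density_scale[OF v, symmetric] ennreal_mult mult.assoc)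
  also have "\<dots> = emeasure gauss A"
    by (simp add: gauss_def emeasure_density)
  finally show "emeasure (distr (density lborel (\<lambda>z. ennreal (isotropic_normal_density v z))) borel
      (\<lambda>z. (1 / sqrt v) *\<^sub>R z)) A = emeasure gauss A" .
qed simp

definition partial_time :: "(nat \<Rightarrow> real) \<Rightarrow> nat \<Rightarrow> real" where
  "partial_time \<eta> k = (\<Sum>i=1..k. \<eta> i)"

lemma partial_time_0 [simp]: "partial_time \<eta> 0 = 0"
  and partial_time_Suc [simp]: "partial_time \<eta> (Suc k) = partial_time \<eta> k + \<eta> (Suc k)"
  by (simp_all add: partial_time_def)

text \<open>With these variables as noise, the Euler chain on the time grid is driven by the same
  Brownian path as the diffusion.\<close>

definition brownian_noise :: "(real \<Rightarrow> 'w \<Rightarrow> real^'n) \<Rightarrow> (nat \<Rightarrow> real) \<Rightarrow> nat \<Rightarrow> 'w \<Rightarrow> real^'n" where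
  "brownian_noise B \<eta> k \<omega> =
    (1 / sqrt (\<eta> k)) *\<^sub>R (B (partial_time \<eta> k) \<omega> - B (partial_time \<eta> (k - 1)) \<omega>)"

text \<open>Independence is given for finitely many increments along a monotone grid; it extends to
  the whole sequence because independence of a family concerns its finite subfamilies only.\<close>

lemma iid_noise_brownian:
  fixes B :: "real \<Rightarrow> 'w \<Rightarrow> real^'n"
  assumes BM: "standard_brownian_motion W B" and \<eta>: "\<And>k. 1 \<le> k \<Longrightarrow> 0 < \<eta> k"
  shows "iid_noise W (brownian_noise B \<eta>)"
proof -
  interpret prob_space W using BM by (simp add: standard_brownian_motion_def)
  \<comment> \<open>Shifted by one, so that the increment from \<open>\<tau> i\<close> to
    \<open>\<tau> (Suc i)\<close> is the one in \<open>brownian_noise B \<eta> i\<close>; at index 0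
    truncated subtraction gives an empty interval.\<close>
  define \<tau> where "\<tau> k = partial_time \<eta> (k - 1)" for k
  have \<eta>0: "0 \<le> \<eta> k" if "1 \<le> k" for k using \<eta>[OF that] by simp
  have pt: "0 \<le> partial_time \<eta> k" for k
    unfolding partial_time_def by (intro sum_nonneg \<eta>0) auto
  have \<tau>: "0 \<le> \<tau> 0" "\<tau> i \<le> \<tau> (Suc i)" for i
    using \<eta>0[of i] by (cases i; auto simp: \<tau>_def pt)+
  have Bm: "B t \<in> borel_measurable W" if "0 \<le> t" for t
    using BM that by (simp add: standard_brownian_motion_def)
  have fin: "indep_vars (\<lambda>_. borel) (\<lambda>i \<omega>. B (\<tau> (Suc i)) \<omega> - B (\<tau> i) \<omega>) {..<m}" for m
    using BM \<tau> unfolding standard_brownian_motion_def by blast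
  have ind: "indep_vars (\<lambda>_. borel) (\<lambda>i \<omega>. B (\<tau> (Suc i)) \<omega> - B (\<tau> i) \<omega>) {1..}"
    unfolding indep_vars_def
  proof
    show "\<forall>i\<in>{1..}. random_variable borel (\<lambda>\<omega>. B (\<tau> (Suc i)) \<omega> - B (\<tau> i) \<omega>)"
      by (auto intro!: borel_measurable_diff Bm simp: \<tau>_def pt)
    show "indep_sets (\<lambda>i. sigma_sets (space W) {(\<lambda>\<omega>. B (\<tau> (Suc i)) \<omega> - B (\<tau> i) \<omega>) -` A \<inter> space W |A. A \<in> sets borel}) {1..}"
    proof (subst indep_sets_finite_index_sets, intro allI impI)
      fix J :: "nat set" assume "finite J"
      then obtain m where "J \<subseteq> {..<m}" using finite_nat_bounded by blast
      then show "indep_sets (\<lambda>i. sigma_sets (space W) {(\<lambda>\<omega>. B (\<tau> (Suc i)) \<omega> - B (\<tau> i) \<omega>) -` A \<inter> space W |A. A \<in> sets borel}) J"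
        using fin[of m] indep_sets_mono_index[of J "{..<m}"] unfolding indep_vars_def by blast
    qed
  qed
  have "indep_vars (\<lambda>_. borel) (\<lambda>i \<omega>. (1 / sqrt (\<eta> i)) *\<^sub>R (B (\<tau> (Suc i)) \<omega> - B (\<tau> i) \<omega>)) {1..}"
    by (rule indep_vars_compose2[OF ind]) measurable
  then have 1: "indep_vars (\<lambda>_. borel) (brownian_noise B \<eta>) {1..}"
    by (simp add: brownian_noise_def[abs_def] \<tau>_def)
  have 2: "distributed W lborel (brownian_noise B \<eta> k) (isotropic_normal_density 1)" if k: "1 \<le> k" for k
  proof -
    let ?D = "\<lambda>\<omega>. B (partial_time \<eta> k) \<omega> - B (partial_time \<eta> (k - 1)) \<omega>"
    have diff: "partial_time \<eta> k - partial_time \<eta> (k - 1) = \<eta> k"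
      using k by (cases k) auto
    have "distributed W lborel ?D (isotropic_normal_density (\<eta> k))"
    proof -
      have "0 \<le> partial_time \<eta> (k - 1) \<and> partial_time \<eta> (k - 1) < partial_time \<eta> k"
        using diff pt[of "k - 1"] \<eta>[OF k] by linarith
      with BM have "distributed W lborel ?D (isotropic_normal_density (partial_time \<eta> k - partial_time \<eta> (k - 1)))"
        by (simp only: standard_brownian_motion_def)
      then show ?thesis by (simp only: diff)
    qed
    then have D: "distr W lborel ?D = density lborel (isotropic_normal_density (\<eta> k))"
      by (auto dest: distributed_distr_eq_density)
    have [measurable]: "B (partial_time \<eta> k) \<in> borel_measurable W" "B (partial_time \<eta> (k - 1)) \<in> borel_measurable W"
      by (intro Bm pt)+
    have bm: "brownian_noise B \<eta> k \<in> borel_measurable W"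
      unfolding brownian_noise_def[abs_def] by measurable
    have "distr W lborel (brownian_noise B \<eta> k) = distr (distr W lborel ?D) borel (\<lambda>z. (1 / sqrt (\<eta> k)) *\<^sub>R z)"
      by (subst distr_distr) (auto simp: o_def brownian_noise_def[abs_def] simp del: One_nat_def intro!: distr_cong)
    also have "\<dots> = gauss"
      unfolding D by (rule distr_density_isotropic_scale[OF \<eta>[OF k]])
    finally show ?thesis
      using bm by (auto simp: distributed_def gauss_def)
  qed
  show ?thesis
    by unfold_locales (use 1 2 in auto)
qed

context em_kernel
begin

section \<open>Pathwise error and convergence of the operators\<close>

lemma em_chain_brownian:
  fixes B :: "real \<Rightarrow> 'w \<Rightarrow> real^'n" and W :: "'w measure" and \<eta> :: "nat \<Rightarrow> real"
  assumes "standard_brownian_motion W B" and "\<And>k. 1 \<le> k \<Longrightarrow> 0 < \<eta> k"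
  shows "em_chain b \<sigma> L K1 K2 W (brownian_noise B \<eta>) \<eta>"
  by (intro em_chain.intro em_chain_axioms.intro em_kernel_axioms iid_noise_brownian assms)

text \<open>The noise is additive and cancels in the difference of the two paths, so this is a
  deterministic Gronwall argument. The only source of error is the oscillation of \<open>X\<close>
  over one grid interval, bounded by \<open>r\<close>.\<close>

lemma euler_path_error:
  fixes X w :: "real \<Rightarrow> real^'n"
  assumes X: "continuous_on {0..} X" "\<And>t. 0 \<le> t \<Longrightarrow> X t = x + integral {0..t} (\<lambda>s. b (X s)) + \<sigma> *v w t"
    and w0: "w 0 = 0" and \<eta>: "\<And>k. 1 \<le> k \<Longrightarrow> 0 < \<eta> k"
    and y: "y 0 = x" "\<And>k. y (Suc k) = y k + \<eta> (Suc k) *\<^sub>R b (y k) +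
      \<sigma> *v (w (partial_time \<eta> (Suc k)) - w (partial_time \<eta> k))"
    and osc: "\<And>k s. k < N \<Longrightarrow> partial_time \<eta> k \<le> s \<Longrightarrow> s \<le> partial_time \<eta> (Suc k) \<Longrightarrow>
      norm (X s - X (partial_time \<eta> k)) \<le> r"
    and r: "0 \<le> r" and "k \<le> N"
  shows "norm (X (partial_time \<eta> k) - y k) \<le> r * (exp (L * partial_time \<eta> k) - 1)"
  using \<open>k \<le> N\<close>
proof (induction k)
  case 0
  then show ?case using X(2)[of 0] w0 y(1) by simp
next
  case (Suc k)
  define s where "s = partial_time \<eta> k"
  define e where "e = \<eta> (Suc k)"
  define d where "d = norm (X s - y k)"
  have e: "0 < e" using \<eta>[of "Suc k"] by (simp add: e_def)
  have s: "0 \<le> s" unfolding s_def partial_time_def using \<eta> by (intro sum_nonneg less_imp_le) auto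
  have IH: "d \<le> r * (exp (L * s) - 1)" using Suc by (simp add: d_def s_def)
  have cb: "continuous_on {0..} (\<lambda>u. b (X u))"
    by (rule continuous_on_compose2[OF continuous_b X(1)]) auto
  have ib: "(\<lambda>u. b (X u)) integrable_on {u..v}" if "0 \<le> u" for u v
    using that by (intro integrable_continuous_interval continuous_on_subset[OF cb]) auto
  have split: "integral {0..s + e} (\<lambda>u. b (X u)) = integral {0..s} (\<lambda>u. b (X u)) + integral {s..s + e} (\<lambda>u. b (X u))"
    using s e ib[of 0] by (subst Henstock_Kurzweil_Integration.integral_combine) auto
  have "X (s + e) - y (Suc k) = (X s - y k) + (integral {s..s + e} (\<lambda>u. b (X u)) - e *\<^sub>R b (y k))"
    using X(2)[of "s + e"] X(2)[of s] s e split y(2)[of k]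
    by (simp add: s_def[symmetric] e_def[symmetric] matrix_vector_mult_diff_distrib algebra_simps)
  also have "integral {s..s + e} (\<lambda>u. b (X u)) - e *\<^sub>R b (y k) = integral {s..s + e} (\<lambda>u. b (X u) - b (y k))"
    using e ib[OF s] by (subst Henstock_Kurzweil_Integration.integral_diff) auto
  finally have "norm (X (s + e) - y (Suc k)) \<le> d + norm (integral {s..s + e} (\<lambda>u. b (X u) - b (y k)))"
    unfolding d_def by (metis norm_triangle_ineq)
  also have "norm (integral {s..s + e} (\<lambda>u. b (X u) - b (y k))) \<le> L * (r + d) * (s + e - s)"
  proof (rule integral_bound)
    show "continuous_on {s..s + e} (\<lambda>u. b (X u) - b (y k))"
      using s by (intro continuous_intros continuous_on_subset[OF cb]) auto
    fix u assume u: "u \<in> {s..s + e}"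
    have "norm (b (X u) - b (y k)) \<le> L * norm (X u - y k)" by (rule lip)
    also have "norm (X u - y k) \<le> norm (X u - X s) + d"
      unfolding d_def using norm_triangle_ineq[of "X u - X s" "X s - y k"] by simp
    also have "norm (X u - X s) \<le> r" using osc[of k u] Suc.prems u by (simp add: s_def e_def)
    finally show "norm (b (X u) - b (y k)) \<le> L * (r + d)" using L by (simp add: mult_left_mono)
  qed (use e in auto)
  \<comment> \<open>In one step \<open>d + r\<close> grows by the factor \<open>1 + L * e\<close>,
    at most \<open>exp (L * e)\<close>; this is the reason for subtracting 1 in the claimed
    bound.\<close>
  also have "d + L * (r + d) * (s + e - s) = (d + r) * (1 + L * e) - r" by (simp add: algebra_simps)
  also have "\<dots> \<le> (r * exp (L * s)) * exp (L * e) - r"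
  proof -
    have "(d + r) * (1 + L * e) \<le> (r * exp (L * s)) * exp (L * e)"
      using IH r L e exp_ge_add_one_self[of "L * e"] by (intro mult_mono) (auto simp: algebra_simps)
    then show ?thesis by simp
  qed
  also have "\<dots> = r * (exp (L * (s + e)) - 1)"
    by (simp add: exp_add algebra_simps)
  finally show ?case by (simp add: s_def e_def)
qed

text \<open>The null sets added by the augmentation are measurable sets of \<open>W\<close>, so the
  augmented filtration stays inside the sigma-algebra of \<open>W\<close>.\<close>

lemma measurable_augmented:
  assumes "standard_brownian_motion W B" "0 \<le> t" "Y \<in> borel_measurable (augmented_filtration W B t)"
  shows "Y \<in> borel_measurable W"
proof -
  let ?G = "{B s -` A \<inter> space W | s A. 0 \<le> s \<and> s \<le> t \<and> A \<in> sets borel} \<union> null_sets W"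
  have G: "?G \<subseteq> sets W"
    using assms(1) by (auto simp: standard_brownian_motion_def intro!: measurable_sets)
  then have "sigma_sets (space W) ?G \<subseteq> sets W" by (rule sets.sigma_sets_subset)
  moreover have "?G \<subseteq> Pow (space W)" using G sets.space_closed by blast
  ultimately show ?thesis
    using assms(3) unfolding augmented_filtration_def
    by (auto simp: measurable_def sets_measure_of space_measure_of)
qed

text \<open>Chain and diffusion share one Brownian path; as the mesh tends to 0 their final
  positions approach each other almost surely, and dominated convergence gives the means. The total
  times may vary with \<open>n\<close>, so the claim concerns a difference.\<close>

lemma Kl_tendsto_solution:
  fixes B :: "real \<Rightarrow> 'w \<Rightarrow> real^'n" and X :: "real \<Rightarrow> 'w \<Rightarrow> real^'n"
  assumes BM: "standard_brownian_motion W B" and sol: "strong_solution W B b \<sigma> x X"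
    and es: "\<And>n e. e \<in> set (es n) \<Longrightarrow> 0 < e \<and> e \<le> \<delta> n" and \<delta>: "\<delta> \<longlonglongrightarrow> 0"
    and T: "\<And>n. sum_list (es n) \<le> T"
    and g: "continuous_on UNIV g" "\<And>x. \<bar>g x\<bar> \<le> c"
  shows "(\<lambda>n. Kl (es n) g x - (\<integral>\<omega>. g (X (sum_list (es n)) \<omega>) \<partial>W)) \<longlonglongrightarrow> 0"
proof -
  interpret W: prob_space W using BM by (simp add: standard_brownian_motion_def)
  have [measurable]: "g \<in> borel_measurable borel" by (rule borel_measurable_continuous_onI[OF g(1)])
  \<comment> \<open>The list as a step sequence indexed from 1. The value 1 outside the list is a
    filler that keeps all steps positive.\<close>
  define H where "H n k = (if 1 \<le> k \<and> k \<le> length (es n) then es n ! (k - 1) else 1)" for n k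
  define N where "N n = length (es n)" for n
  have Hpos: "0 < H n k" for n k using es[of _ n] by (auto simp: H_def)
  have Hle: "H n (Suc k) \<le> \<delta> n" if "k < N n" for n k
    using es[of "es n ! k" n] that by (auto simp: H_def N_def)
  have map_H: "map (H n) [1..<Suc (N n)] = es n" for n
    by (rule nth_equalityI) (auto simp: H_def N_def simp del: upt_Suc)
  have pt: "partial_time (H n) k = sum_list (map (H n) [1..<Suc k])" for n k
    by (induction k) simp_all
  have ptN: "partial_time (H n) (N n) = sum_list (es n)" for n
    unfolding pt map_H ..
  have pt0: "0 \<le> partial_time (H n) k" for n k
    unfolding partial_time_def using Hpos by (intro sum_nonneg less_imp_le)
  have pt_mono: "partial_time (H n) j \<le> partial_time (H n) k" if "j \<le> k" for n j k
    unfolding partial_time_def using that Hpos by (intro sum_mono2) (auto intro: less_imp_le)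
  have ptT: "partial_time (H n) k \<le> T" if "k \<le> N n" for n k
    using pt_mono[OF that, of n] ptN[of n] T[of n] by simp
  define t where "t n = sum_list (es n)" for n
  have t: "0 \<le> t n" "t n \<le> T" for n using pt0[of n "N n"] T ptN[of n] by (auto simp: t_def)
  define Y where "Y n \<omega> = euler_maruyama b \<sigma> (H n) (brownian_noise B (H n)) x (N n) \<omega>" for n \<omega>
  have chain: "em_chain b \<sigma> L K1 K2 W (brownian_noise B (H n)) (H n)" for n
    by (rule em_chain_brownian[OF BM]) (rule Hpos)
  have [measurable]: "Y n \<in> borel_measurable W" for n
  proof -
    interpret em_chain b \<sigma> L K1 K2 W "brownian_noise B (H n)" "H n" x by (rule chain)
    show ?thesis using measurable_\<theta>[of "N n"] by (simp add: Y_def[abs_def])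
  qed
  have EY: "(\<integral>\<omega>. g (Y n \<omega>) \<partial>W) = Kl (es n) g x" for n
  proof -
    interpret em_chain b \<sigma> L K1 K2 W "brownian_noise B (H n)" "H n" x by (rule chain)
    show ?thesis using expectation_Kl[of g c "N n"] g(2) unfolding map_H by (simp add: Y_def)
  qed
  have Xm: "X s \<in> borel_measurable W" if "0 \<le> s" for s
    using sol that measurable_augmented[OF BM that] unfolding strong_solution_def by blast
  have Xt [measurable]: "X (t n) \<in> borel_measurable W" for n by (rule Xm) (rule t)
  have "(\<lambda>n. \<integral>\<omega>. g (Y n \<omega>) - g (X (t n) \<omega>) \<partial>W) \<longlonglongrightarrow> (\<integral>\<omega>. 0 \<partial>W)"
  proof (rule integral_dominated_convergence[where w = "\<lambda>_. 2 * c"])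
    show "AE \<omega> in W. norm (g (Y n \<omega>) - g (X (t n) \<omega>)) \<le> 2 * c" for n
    proof (rule AE_I2)
      fix \<omega> show "norm (g (Y n \<omega>) - g (X (t n) \<omega>)) \<le> 2 * c"
        using g(2)[of "Y n \<omega>"] g(2)[of "X (t n) \<omega>"] by simp
    qed
    have "AE \<omega> in W. B 0 \<omega> = 0" using BM by (simp add: standard_brownian_motion_def)
    moreover have "AE \<omega> in W. continuous_on {0..} (\<lambda>t. X t \<omega>) \<and>
        (\<forall>t\<ge>0. X t \<omega> = x + integral {0..t} (\<lambda>s. b (X s \<omega>)) + \<sigma> *v B t \<omega>)"
      using sol by (simp add: strong_solution_def)
    ultimately show "AE \<omega> in W. (\<lambda>n. g (Y n \<omega>) - g (X (t n) \<omega>)) \<longlonglongrightarrow> 0"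
    proof eventually_elim
      fix \<omega> assume B0: "B 0 \<omega> = 0" and X': "continuous_on {0..} (\<lambda>t. X t \<omega>) \<and>
        (\<forall>t\<ge>0. X t \<omega> = x + integral {0..t} (\<lambda>s. b (X s \<omega>)) + \<sigma> *v B t \<omega>)"
      have cont: "continuous_on {0..T} (\<lambda>t. X t \<omega>)"
        by (rule continuous_on_subset[of "{0..}"]) (use X' in auto)
      have uc: "uniformly_continuous_on {0..T} (\<lambda>t. X t \<omega>)"
        by (rule compact_uniformly_continuous[OF cont]) simp
      have "compact ((\<lambda>t. X t \<omega>) ` {0..T})"
        by (rule compact_continuous_image[OF cont]) simp
      then have "bounded ((\<lambda>t. X t \<omega>) ` {0..T})"
        by (rule compact_imp_bounded)
      then obtain R where R: "\<And>s. s \<in> {0..T} \<Longrightarrow> norm (X s \<omega>) \<le> R"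
        unfolding bounded_iff by blast
      \<comment> \<open>Uniform continuity of the path on \<open>{0..T}\<close> makes its
        oscillation over a grid interval at most \<open>r\<close> once \<open>\<delta> n\<close> is
        small; the error bound then holds with the fixed factor \<open>exp (L * T)\<close>.\<close>
      have near: "\<exists>m. \<forall>n\<ge>m. norm (X (t n) \<omega> - Y n \<omega>) \<le> r * exp (L * T)" if r: "0 < r" for r
      proof -
        obtain d where d: "0 < d" "\<And>s u. s \<in> {0..T} \<Longrightarrow> u \<in> {0..T} \<Longrightarrow> dist u s < d \<Longrightarrow> dist (X u \<omega>) (X s \<omega>) < r"
          using uc r unfolding uniformly_continuous_on_def by metis
        obtain m where m: "\<And>n. n \<ge> m \<Longrightarrow> \<delta> n < d"
          using order_tendstoD(2)[OF \<delta> d(1)] unfolding eventually_sequentially by auto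
        have "norm (X (t n) \<omega> - Y n \<omega>) \<le> r * exp (L * T)" if n: "n \<ge> m" for n
        proof -
          let ?\<theta> = "\<lambda>k. euler_maruyama b \<sigma> (H n) (brownian_noise B (H n)) x k \<omega>"
          have "norm (X (partial_time (H n) (N n)) \<omega> - ?\<theta> (N n)) \<le>
              r * (exp (L * partial_time (H n) (N n)) - 1)"
          proof (rule euler_path_error[where w = "\<lambda>t. B t \<omega>" and x = x and N = "N n"])
            show "continuous_on {0..} (\<lambda>t. X t \<omega>)" using X' by simp
            show "X t \<omega> = x + integral {0..t} (\<lambda>s. b (X s \<omega>)) + \<sigma> *v B t \<omega>" if "0 \<le> t" for t
              using X' that by simp
            show "?\<theta> (Suc k) = ?\<theta> k + H n (Suc k) *\<^sub>R b (?\<theta> k) +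
                \<sigma> *v (B (partial_time (H n) (Suc k)) \<omega> - B (partial_time (H n) k) \<omega>)" for k
            proof -
              have "sqrt (H n (Suc k)) *\<^sub>R (\<sigma> *v ((1 / sqrt (H n (Suc k))) *\<^sub>R z)) = \<sigma> *v z" for z
                using Hpos[of n "Suc k"] by (simp add: linear_scale[OF matrix_vector_mul_linear])
              then show ?thesis by (simp add: brownian_noise_def del: partial_time_Suc)
            qed
            fix k s assume k: "k < N n" "partial_time (H n) k \<le> s" "s \<le> partial_time (H n) (Suc k)"
            have "dist s (partial_time (H n) k) < d"
              using k Hle[OF k(1)] m[OF n] by (simp add: dist_real_def)
            moreover have "partial_time (H n) k \<in> {0..T}" "s \<in> {0..T}"
              using k ptT[of k n] ptT[of "Suc k" n] pt0[of n k] by (auto simp del: partial_time_Suc)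
            ultimately show "norm (X s \<omega> - X (partial_time (H n) k) \<omega>) \<le> r"
              using d(2) by (auto simp: dist_norm intro: less_imp_le)
          qed (use Hpos B0 r in auto)
          also have "\<dots> \<le> r * exp (L * T)"
          proof -
            have "exp (L * partial_time (H n) (N n)) \<le> exp (L * T)" using ptT[of "N n" n] L by simp
            then have "exp (L * partial_time (H n) (N n)) - 1 \<le> exp (L * T)" by linarith
            then show ?thesis using r by (rule mult_left_mono[OF _ less_imp_le])
          qed
          finally show ?thesis by (simp add: Y_def t_def ptN)
        qed
        then show ?thesis by blast
      qed
      show "(\<lambda>n. g (Y n \<omega>) - g (X (t n) \<omega>)) \<longlonglongrightarrow> 0"
      proof (rule LIMSEQ_I)
        fix r :: real assume r: "0 < r"
        \<comment> \<open>\<open>g\<close> is only continuous, but the points to be compared lie in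
          the ball of radius \<open>R + 1\<close>, where it is uniformly continuous.\<close>
        have "uniformly_continuous_on (cball 0 (R + 1)) g"
          by (intro compact_uniformly_continuous continuous_on_subset[OF g(1)]) auto
        then obtain d where d: "0 < d" "\<And>y z. norm y \<le> R + 1 \<Longrightarrow> norm z \<le> R + 1 \<Longrightarrow>
            dist z y < d \<Longrightarrow> dist (g z) (g y) < r"
          using r unfolding uniformly_continuous_on_def by (metis mem_cball_0)
        define q where "q = min (d / 2) 1"
        have q: "0 < q" "q < d" "q \<le> 1" using d by (auto simp: q_def)
        obtain m where m: "\<And>n. n \<ge> m \<Longrightarrow> norm (X (t n) \<omega> - Y n \<omega>) \<le> q * exp (- L * T) * exp (L * T)"
          using near[of "q * exp (- L * T)"] q by auto
        show "\<exists>m. \<forall>n\<ge>m. norm (g (Y n \<omega>) - g (X (t n) \<omega>) - 0) < r"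
        proof (intro exI[of _ m] allI impI)
          fix n assume "n \<ge> m"
          from m[OF this] have XY: "norm (X (t n) \<omega> - Y n \<omega>) \<le> q" by (simp add: mult.assoc exp_add[symmetric])
          moreover have "norm (X (t n) \<omega>) \<le> R" using R t by auto
          moreover have "norm (Y n \<omega>) \<le> norm (X (t n) \<omega>) + norm (X (t n) \<omega> - Y n \<omega>)"
            using norm_triangle_ineq4[of "X (t n) \<omega>" "X (t n) \<omega> - Y n \<omega>"] by simp
          ultimately have "dist (g (Y n \<omega>)) (g (X (t n) \<omega>)) < r"
            using q by (intro d(2)) (auto simp: dist_norm norm_minus_commute)
          then show "norm (g (Y n \<omega>) - g (X (t n) \<omega>) - 0) < r" by (simp add: dist_norm)
        qed
      qed
    qed
  qed auto
  moreover have "(\<integral>\<omega>. g (Y n \<omega>) - g (X (t n) \<omega>) \<partial>W) = Kl (es n) g x - (\<integral>\<omega>. g (X (t n) \<omega>) \<partial>W)" for n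
    unfolding EY[symmetric]
    by (intro Bochner_Integration.integral_diff W.integrable_const_bound[of _ c]) (auto simp: g(2))
  ultimately show ?thesis by (simp add: t_def)
qed

end

section \<open>The diffusion semigroup and its invariant measure\<close>

locale em_sde = em_kernel b \<sigma> L K1 K2 for b :: "real^'n \<Rightarrow> real^'n" and \<sigma> L K1 K2 +
  fixes W :: "'w measure" and B :: "real \<Rightarrow> 'w \<Rightarrow> real^'n"
    and X :: "real^'n \<Rightarrow> real \<Rightarrow> 'w \<Rightarrow> real^'n" and \<mu> :: "(real^'n) measure"
  assumes BM: "standard_brownian_motion W B"
    and sol: "\<And>x. strong_solution W B b \<sigma> x (X x)"
    and invariant: "invariant_probability_measure W X \<mu>"
begin

sublocale W: prob_space W
  using BM by (simp add: standard_brownian_motion_def)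

sublocale \<mu>: prob_space \<mu>
  using invariant by (simp add: invariant_probability_measure_def)

lemma sets_\<mu> [simp, measurable_cong]: "sets \<mu> = sets borel"
  using invariant by (simp add: invariant_probability_measure_def)

lemma space_\<mu> [simp]: "space \<mu> = UNIV"
  using sets_eq_imp_space_eq[OF sets_\<mu>] by simp

lemma measurable_X: "0 \<le> t \<Longrightarrow> X x t \<in> borel_measurable W"
  using sol[of x] measurable_augmented[OF BM] unfolding strong_solution_def by blast

text \<open>Solutions are given for each starting point separately, so measurability in
  \<open>x\<close> is not immediate. It is inherited from the operators \<open>Kl\<close> of
  equidistant grids, whose pointwise limit this mean is.\<close>

lemma measurable_solution_semigroup:
  fixes g :: "real^'n \<Rightarrow> real"
  assumes t: "0 < t" and g: "continuous_on UNIV g" "\<And>x. \<bar>g x\<bar> \<le> c"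
  shows "(\<lambda>x. \<integral>\<omega>. g (X x t \<omega>) \<partial>W) \<in> borel_measurable borel"
proof (rule borel_measurable_LIMSEQ_real)
  have [measurable]: "g \<in> borel_measurable borel" by (rule borel_measurable_continuous_onI[OF g(1)])
  let ?es = "\<lambda>n. replicate (Suc n) (t / real (Suc n))"
  have sum: "sum_list (?es n) = t" for n
    by (simp add: sum_list_replicate del: of_nat_Suc replicate.simps)
  fix x
  have "(\<lambda>n. Kl (?es n) g x - (\<integral>\<omega>. g (X x (sum_list (?es n)) \<omega>) \<partial>W)) \<longlonglongrightarrow> 0"
  proof (rule Kl_tendsto_solution[OF BM sol])
    show "(\<lambda>n. t / real (Suc n)) \<longlonglongrightarrow> 0"
      by (rule LIMSEQ_Suc[OF lim_const_over_n])
    show "sum_list (?es n) \<le> t" for n by (simp only: sum)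
  qed (use t g in auto)
  then show "(\<lambda>n. Kl (?es n) g x) \<longlonglongrightarrow> (\<integral>\<omega>. g (X x t \<omega>) \<partial>W)"
    unfolding sum by (rule LIM_zero_cancel)
next
  have "g \<in> borel_measurable borel" by (rule borel_measurable_continuous_onI[OF g(1)])
  then show "Kl (replicate (Suc n) (t / real (Suc n))) g \<in> borel_measurable borel" for n
    by (rule measurable_Kl)
qed

text \<open>Open sets form an intersection-stable generator, and the indicator of an open set is a
  limit of bounded continuous functions, whose means under the solution are measurable.\<close>

lemma measurable_solution_kernel:
  assumes t: "0 < t"
  shows "(\<lambda>x. distr W borel (X x t)) \<in> measurable borel (prob_algebra borel)"
proof (rule measurable_prob_algebra_generated[where \<Omega> = UNIV and G = "Collect open"])
  show "sets (borel :: (real^'n) measure) = sigma_sets UNIV (Collect open)"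
    by (simp add: borel_def)
  show "Int_stable (Collect open :: (real^'n) set set)"
    by (auto simp: Int_stable_def)
  note Xm = measurable_X[OF less_imp_le[OF t]]
  show "prob_space (distr W borel (X x t))" for x
    by (rule W.prob_space_distr[OF Xm])
  fix A :: "(real^'n) set" assume "A \<in> Collect open"
  then have A: "open A" by simp
  show "(\<lambda>x. emeasure (distr W borel (X x t)) A) \<in> borel_measurable borel"
  \<comment> \<open>The distance to an empty complement is 0 by convention, so the approximation by
    \<open>g\<close> below would fail for the whole space.\<close>
  proof (cases "A = UNIV")
    case True
    have "emeasure (distr W borel (X x t)) UNIV = 1" for x
      using prob_space.emeasure_space_1[OF W.prob_space_distr[OF Xm[of x]]] by simp
    then show ?thesis using True by simp
  next
    case False
    define g where "g n x = min 1 (real n * infdist x (- A))" for n and x :: "real^'n"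
    have gc: "continuous_on UNIV (g n)" for n
      unfolding g_def by (intro continuous_intros)
    have [measurable]: "g n \<in> borel_measurable borel" for n
      by (rule borel_measurable_continuous_onI[OF gc])
    have g01: "0 \<le> g n x" "g n x \<le> 1" for n x by (auto simp: g_def infdist_nonneg)
    have lim: "(\<lambda>n. g n x) \<longlonglongrightarrow> indicator A x" for x
    proof (cases "x \<in> A")
      case True
      have "infdist x (- A) \<noteq> 0"
        using in_closed_iff_infdist_zero[of "- A" x] A \<open>A \<noteq> UNIV\<close> True by auto
      then have pos: "0 < infdist x (- A)" using infdist_nonneg[of x "- A"] by linarith
      obtain m where m: "1 / infdist x (- A) < real m" using reals_Archimedean2 by blast
      have "g n x = 1" if "m \<le> n" for n
      proof -
        have "1 < real m * infdist x (- A)" using m pos by (simp add: divide_less_eq)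
        also have "\<dots> \<le> real n * infdist x (- A)" using that pos by (intro mult_right_mono) auto
        finally show ?thesis by (simp add: g_def)
      qed
      then show ?thesis
        using True by (intro tendsto_eventually eventually_sequentiallyI[of m]) auto
    next
      case False
      then show ?thesis by (simp add: g_def)
    qed
    have conv: "(\<lambda>n. \<integral>\<omega>. g n (X x t \<omega>) \<partial>W) \<longlonglongrightarrow> (\<integral>\<omega>. indicator A (X x t \<omega>) \<partial>W)" for x
    proof (rule integral_dominated_convergence[where w = "\<lambda>_. 1"])
      have [measurable]: "A \<in> sets borel" "X x t \<in> borel_measurable W" using A Xm by auto
      show "(\<lambda>\<omega>. indicator A (X x t \<omega>) :: real) \<in> borel_measurable W"
        "(\<lambda>\<omega>. g n (X x t \<omega>)) \<in> borel_measurable W" for n by measurable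
    qed (use lim g01 in auto)
    have "(\<lambda>x. \<integral>\<omega>. g n (X x t \<omega>) \<partial>W) \<in> borel_measurable borel" for n
      by (rule measurable_solution_semigroup[OF t gc, of _ 1]) (use g01 in \<open>auto simp: abs_le_iff intro: order_trans[of _ 0]\<close>)
    from borel_measurable_LIMSEQ_real[OF conv this]
    have "(\<lambda>x. \<integral>\<omega>. indicator A (X x t \<omega>) \<partial>W :: real) \<in> borel_measurable borel" .
    moreover have "emeasure (distr W borel (X x t)) A = ennreal (\<integral>\<omega>. indicator A (X x t \<omega>) \<partial>W)" for x
    proof -
      have "(\<integral>\<omega>. indicator A (X x t \<omega>) \<partial>W) = (\<integral>y. (indicator A y :: real) \<partial>distr W borel (X x t))"
        using Xm[of x] A by (subst integral_distr) auto
      also have "\<dots> = measure (distr W borel (X x t)) A" using A by simp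
      finally show ?thesis
        using finite_measure.emeasure_eq_measure[OF prob_space.finite_measure[OF W.prob_space_distr[OF Xm[of x]]]]
        by simp
    qed
    ultimately show ?thesis by simp
  qed
qed auto

text \<open>Invariance is stated for sets. Rewritten as the equation that composing
  \<open>\<mu>\<close> with the solution kernel gives \<open>\<mu>\<close> again, it transfers to
  integrals.\<close>

lemma integral_invariant:
  fixes g :: "real^'n \<Rightarrow> real"
  assumes t: "0 < t" and g: "continuous_on UNIV g" "\<And>x. \<bar>g x\<bar> \<le> c"
  shows "(\<integral>x. (\<integral>\<omega>. g (X x t \<omega>) \<partial>W) \<partial>\<mu>) = integral\<^sup>L \<mu> g"
proof -
  have [measurable]: "g \<in> borel_measurable borel" by (rule borel_measurable_continuous_onI[OF g(1)])
  note [measurable] = measurable_X[OF less_imp_le[OF t]] measurable_solution_semigroup[OF t g]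
  let ?\<kappa> = "\<lambda>x. distr W borel (X x t)"
  have \<kappa>: "?\<kappa> \<in> measurable \<mu> (subprob_algebra borel)"
    using measurable_prob_algebraD[OF measurable_solution_kernel[OF t]] by (simp cong: measurable_cong_sets)
  have bind: "\<mu> \<bind> ?\<kappa> = \<mu>"
  proof (rule measure_eqI)
    show s: "sets (\<mu> \<bind> ?\<kappa>) = sets \<mu>" by (subst sets_bind[where N = borel]) auto
    fix A assume "A \<in> sets (\<mu> \<bind> ?\<kappa>)"
    then have A: "A \<in> sets borel" using s by simp
    have "emeasure (\<mu> \<bind> ?\<kappa>) A = (\<integral>\<^sup>+ x. emeasure (?\<kappa> x) A \<partial>\<mu>)"
      by (rule emeasure_bind[OF _ \<kappa> A]) simp
    also have "\<dots> = (\<integral>\<^sup>+ x. emeasure W {\<omega> \<in> space W. X x t \<omega> \<in> A} \<partial>\<mu>)"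
      using A by (auto simp: emeasure_distr vimage_def Int_def conj_commute intro!: nn_integral_cong arg_cong[where f = "emeasure W"])
    also have "\<dots> = emeasure \<mu> A"
      using invariant A less_imp_le[OF t] unfolding invariant_probability_measure_def by blast
    finally show "emeasure (\<mu> \<bind> ?\<kappa>) A = emeasure \<mu> A" .
  qed
  define u where "u x = (\<integral>\<omega>. g (X x t \<omega>) \<partial>W)" for x
  have u[measurable]: "u \<in> borel_measurable borel"
    unfolding u_def by (rule measurable_solution_semigroup[OF t g])
  have gX: "integrable W (\<lambda>\<omega>. g (X x t \<omega>))" for x
    by (rule W.integrable_const_bound[of _ c]) (auto simp: g)
  have ub: "\<bar>u x\<bar> \<le> c" for x
  proof -
    have "\<bar>u x\<bar> \<le> (\<integral>\<omega>. \<bar>g (X x t \<omega>)\<bar> \<partial>W)" unfolding u_def by (rule integral_abs_bound)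
    also have "\<dots> \<le> (\<integral>\<omega>. c \<partial>W)" using gX g(2) by (intro integral_mono) auto
    finally show ?thesis using W.prob_space by simp
  qed
  \<comment> \<open>Adding \<open>c\<close> makes the integrands nonnegative, as the integration
    rule for the composition requires.\<close>
  have gp: "0 \<le> g x + c" for x using g(2)[of x] by auto
  have up: "0 \<le> u x + c" for x using ub[of x] by auto
  have gi: "integrable \<mu> g" by (rule \<mu>.integrable_const_bound[of _ c]) (auto simp: g)
  have ui: "integrable \<mu> u" by (rule \<mu>.integrable_const_bound[of _ c]) (auto simp: ub)
  have "ennreal (integral\<^sup>L \<mu> g + c) = (\<integral>\<^sup>+ y. ennreal (g y + c) \<partial>\<mu>)"
    using gi gp \<mu>.prob_space by (subst nn_integral_eq_integral) auto
  also have "\<dots> = (\<integral>\<^sup>+ y. ennreal (g y + c) \<partial>(\<mu> \<bind> ?\<kappa>))" by (simp only: bind)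
  also have "\<dots> = (\<integral>\<^sup>+ x. (\<integral>\<^sup>+ y. ennreal (g y + c) \<partial>?\<kappa> x) \<partial>\<mu>)"
    by (rule nn_integral_bind[OF _ \<kappa>]) measurable
  also have "\<dots> = (\<integral>\<^sup>+ x. ennreal (u x + c) \<partial>\<mu>)"
  proof (rule nn_integral_cong)
    fix x
    have "(\<integral>\<^sup>+ y. ennreal (g y + c) \<partial>?\<kappa> x) = (\<integral>\<^sup>+ \<omega>. ennreal (g (X x t \<omega>) + c) \<partial>W)"
      by (subst nn_integral_distr) auto
    also have "\<dots> = ennreal (u x + c)"
      using gX[of x] gp W.prob_space unfolding u_def by (subst nn_integral_eq_integral) auto
    finally show "(\<integral>\<^sup>+ y. ennreal (g y + c) \<partial>?\<kappa> x) = ennreal (u x + c)" .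
  qed
  also have "\<dots> = ennreal (integral\<^sup>L \<mu> u + c)"
    using ui up \<mu>.prob_space by (subst nn_integral_eq_integral) auto
  finally have "ennreal (integral\<^sup>L \<mu> g + c) = ennreal (integral\<^sup>L \<mu> u + c)" .
  moreover have "0 \<le> integral\<^sup>L \<mu> g + c" "0 \<le> integral\<^sup>L \<mu> u + c"
  proof -
    have "0 \<le> (\<integral>x. g x + c \<partial>\<mu>)" using gp by (intro integral_nonneg_AE) auto
    then show "0 \<le> integral\<^sup>L \<mu> g + c" using gi \<mu>.prob_space by simp
    have "0 \<le> (\<integral>x. u x + c \<partial>\<mu>)" using up by (intro integral_nonneg_AE) auto
    then show "0 \<le> integral\<^sup>L \<mu> u + c" using ui \<mu>.prob_space by simp
  qed
  ultimately show ?thesis unfolding u_def[symmetric] by simp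
qed

text \<open>Uniformity over all fine lists is obtained from a sequential statement: counterexamples
  with meshes tending to 0 would contradict the convergence of \<open>Kl\<close> to the diffusion
  semigroup, integrated against \<open>\<mu>\<close> by dominated convergence.\<close>

lemma integral_Kl_near_invariant:
  fixes g :: "real^'n \<Rightarrow> real"
  assumes T: "0 < T" and \<epsilon>: "0 < \<epsilon>" and g: "continuous_on UNIV g" "\<And>x. \<bar>g x\<bar> \<le> c"
  shows "\<exists>\<delta>>0. \<forall>es. (\<forall>e\<in>set es. 0 < e \<and> e \<le> \<delta>) \<longrightarrow> T \<le> sum_list es \<longrightarrow> sum_list es \<le> T + 1 \<longrightarrow>
    \<bar>(\<integral>x. Kl es g x \<partial>\<mu>) - integral\<^sup>L \<mu> g\<bar> \<le> \<epsilon>"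
proof (rule ccontr)
  have [measurable]: "g \<in> borel_measurable borel" by (rule borel_measurable_continuous_onI[OF g(1)])
  assume "\<not> ?thesis"
  then have "\<exists>es. (\<forall>e\<in>set es. 0 < e \<and> e \<le> inverse (real (Suc n))) \<and> T \<le> sum_list es \<and> sum_list es \<le> T + 1 \<and>
      \<epsilon> < \<bar>(\<integral>x. Kl es g x \<partial>\<mu>) - integral\<^sup>L \<mu> g\<bar>" for n
    by (auto simp: not_le dest: spec[of _ "inverse (real (Suc n))"])
  then obtain es where es: "\<And>n. \<forall>e\<in>set (es n). 0 < e \<and> e \<le> inverse (real (Suc n))"
    "\<And>n. T \<le> sum_list (es n)" "\<And>n. sum_list (es n) \<le> T + 1"
    "\<And>n. \<epsilon> < \<bar>(\<integral>x. Kl (es n) g x \<partial>\<mu>) - integral\<^sup>L \<mu> g\<bar>"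
    by metis
  have t: "0 < sum_list (es n)" for n using T es(2)[of n] by linarith
  define u where "u n x = (\<integral>\<omega>. g (X x (sum_list (es n)) \<omega>) \<partial>W)" for n x
  have [measurable]: "u n \<in> borel_measurable borel" for n
    unfolding u_def by (rule measurable_solution_semigroup[OF t g])
  have c0: "0 \<le> c" using g(2)[of 0] by linarith
  have ub: "\<bar>u n x\<bar> \<le> c" for n x
  proof -
    have [measurable]: "X x (sum_list (es n)) \<in> borel_measurable W" by (rule measurable_X) (use t[of n] in simp)
    have "\<bar>u n x\<bar> \<le> (\<integral>\<omega>. \<bar>g (X x (sum_list (es n)) \<omega>)\<bar> \<partial>W)" unfolding u_def by (rule integral_abs_bound)
    also have "\<dots> \<le> (\<integral>\<omega>. c \<partial>W)"
      by (intro integral_mono W.integrable_const_bound[of _ c]) (auto simp: g c0)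
    finally show ?thesis using W.prob_space by simp
  qed
  have Kb: "\<bar>Kl (es n) g x\<bar> \<le> c" for n x
    using Kl_bounds[of g "- c" c "es n" x] g(2) es(1)[of n] by (auto simp: abs_le_iff minus_le_iff intro: less_imp_le)
  have "(\<lambda>n. \<integral>x. Kl (es n) g x - u n x \<partial>\<mu>) \<longlonglongrightarrow> (\<integral>x. 0 \<partial>\<mu>)"
  proof (rule integral_dominated_convergence[where w = "\<lambda>_. 2 * c"])
    show "AE x in \<mu>. norm (Kl (es n) g x - u n x) \<le> 2 * c" for n
    proof (rule AE_I2)
      fix x show "norm (Kl (es n) g x - u n x) \<le> 2 * c" using ub[of n x] Kb[of n x] by simp
    qed
    show "AE x in \<mu>. (\<lambda>n. Kl (es n) g x - u n x) \<longlonglongrightarrow> 0"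
      unfolding u_def
      by (intro AE_I2 Kl_tendsto_solution[OF BM sol _ LIMSEQ_inverse_real_of_nat es(3) g]) (use es(1) in blast)
  qed auto
  then have lim: "(\<lambda>n. \<integral>x. Kl (es n) g x - u n x \<partial>\<mu>) \<longlonglongrightarrow> 0" by simp
  obtain n where "\<bar>\<integral>x. Kl (es n) g x - u n x \<partial>\<mu>\<bar> < \<epsilon>"
    using LIMSEQ_D[OF lim \<epsilon>] by auto
  moreover have "(\<integral>x. Kl (es n) g x - u n x \<partial>\<mu>) = (\<integral>x. Kl (es n) g x \<partial>\<mu>) - (\<integral>x. u n x \<partial>\<mu>)"
    using ub Kb by (intro Bochner_Integration.integral_diff \<mu>.integrable_const_bound[of _ c]) auto
  moreover have "(\<integral>x. u n x \<partial>\<mu>) = integral\<^sup>L \<mu> g"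
    unfolding u_def by (rule integral_invariant[OF t g])
  ultimately show False using es(4)[of n] by simp
qed

text \<open>The contraction bound grows like the squared norm, whose integrability under
  \<open>\<mu>\<close> is not known; a level beyond which \<open>\<mu>\<close> has little mass takes
  its place.\<close>

lemma tail_\<mu>:
  assumes "0 < \<epsilon>"
  shows "\<exists>R\<ge>0. measure \<mu> {x. R < (norm x)\<^sup>2} \<le> \<epsilon>"
proof -
  have "(\<lambda>n. measure \<mu> {x. real n < (norm x)\<^sup>2}) \<longlonglongrightarrow> measure \<mu> (\<Inter>n. {x. real n < (norm x)\<^sup>2})"
    by (intro \<mu>.finite_Lim_measure_decseq) (auto simp: decseq_def)
  moreover have "(\<Inter>n. {x :: real^'n. real n < (norm x)\<^sup>2}) = {}"
  proof -
    have "\<exists>n. \<not> real n < (norm x)\<^sup>2" for x :: "real^'n"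
      using reals_Archimedean2[of "(norm x)\<^sup>2"] by (auto simp: not_less intro: less_imp_le)
    then show ?thesis by auto
  qed
  ultimately have "(\<lambda>n. measure \<mu> {x. real n < (norm x)\<^sup>2}) \<longlonglongrightarrow> 0" by simp
  from LIMSEQ_D[OF this assms] obtain n where "measure \<mu> {x. real n < (norm x)\<^sup>2} < \<epsilon>" by auto
  then show ?thesis by (intro exI[of _ "real n"]) auto
qed

text \<open>For a list with total between \<open>T\<close> and \<open>T + 1\<close> the contraction
  compares the start at \<open>y\<close> with a start distributed as \<open>\<mu>\<close>, from
  which the mean is close to that of \<open>g\<close> under \<open>\<mu>\<close>. A longer list is a
  prefix followed by such a window; the prefix only moves the starting point, at the price of the
  drift bound.\<close>

lemma Kl_mixing:
  fixes g :: "real^'n \<Rightarrow> real"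
  assumes \<epsilon>: "0 < \<epsilon>" and g: "continuous_on UNIV g" "\<And>x. \<bar>g x\<bar> \<le> c"
  shows "\<exists>T \<delta>. 0 < \<delta> \<and> 0 \<le> T \<and> (\<forall>es y. (\<forall>e\<in>set es. 0 < e \<and> e \<le> \<delta>) \<longrightarrow> T \<le> sum_list es \<longrightarrow>
    \<bar>Kl es g y - integral\<^sup>L \<mu> g\<bar> \<le> \<epsilon> * (1 + (norm y)\<^sup>2))"
proof -
  have [measurable]: "g \<in> borel_measurable borel" by (rule borel_measurable_continuous_onI[OF g(1)])
  have c: "0 \<le> c" using g(2)[of 0] by linarith
  \<comment> \<open>Strictly positive, so that \<open>g\<close> can be normalised to a function
    bounded by 1.\<close>
  define c' where "c' = c + 1"
  have c': "0 < c'" "\<And>x. \<bar>g x\<bar> \<le> c'" using c order_trans[OF g(2)] by (auto simp: c'_def)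
  obtain \<beta> a where \<beta>: "0 < \<beta>" and a: "0 < a" "a < 1" and contr:
    "\<And>m es g x y. (\<forall>e\<in>set es. 0 < e \<and> e \<le> e0) \<Longrightarrow> 2 * real m \<le> sum_list es \<Longrightarrow>
     g \<in> borel_measurable borel \<Longrightarrow> (\<forall>x. \<bar>g x\<bar> \<le> 1) \<Longrightarrow>
     \<bar>Kl es g x - Kl es g y\<bar> \<le> a ^ m * (2 + \<beta> * ((norm x)\<^sup>2 + (norm y)\<^sup>2))"
    using Kl_contraction by blast
  obtain C where C: "0 \<le> C"
    "\<And>es x. (\<forall>e\<in>set es. 0 < e \<and> e \<le> e0) \<Longrightarrow>
      Kl es (\<lambda>y. (norm y)\<^sup>2) x \<le> exp (- (K1 / 4) * sum_list es) * (norm x)\<^sup>2 + C"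
    using Kl_drift by blast
  \<comment> \<open>The factor \<open>1 + C\<close> is reserved for the squared norm along the
    prefix, the factor \<open>2 * c' + 2\<close> below for the tail, the contraction and the error
    under \<open>\<mu>\<close>.\<close>
  define \<epsilon>1 where "\<epsilon>1 = \<epsilon> / (1 + C)"
  have \<epsilon>1: "0 < \<epsilon>1" "\<epsilon>1 * (1 + C) = \<epsilon>" using \<epsilon> C(1) by (auto simp: \<epsilon>1_def)
  define \<epsilon>2 where "\<epsilon>2 = \<epsilon>1 / (2 * c' + 2)"
  have \<epsilon>2: "0 < \<epsilon>2" "\<epsilon>2 * (2 * c' + 2) = \<epsilon>1" using \<epsilon>1 c' by (auto simp: \<epsilon>2_def)
  obtain R where R: "0 \<le> R" "measure \<mu> {x. R < (norm x)\<^sup>2} \<le> \<epsilon>2" using tail_\<mu>[OF \<epsilon>2(1)] by blast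
  define D where "D = c' * (2 + \<beta> * R + \<beta>)"
  have D: "0 < D" using c' \<beta> R by (auto simp: D_def add_pos_nonneg)
  have "(\<lambda>m. a ^ m * D) \<longlonglongrightarrow> 0" using a by (auto intro!: tendsto_eq_intros LIMSEQ_power_zero)
  from LIMSEQ_D[OF this \<epsilon>2(1)] obtain m0 where m0: "\<And>m. m \<ge> m0 \<Longrightarrow> a ^ m * D < \<epsilon>2"
    using a D by auto
  define m where "m = Suc m0"
  have m: "a ^ m * D \<le> \<epsilon>2" using m0[of m] by (simp add: m_def)
  define T where "T = 2 * real m"
  have T: "0 < T" by (simp add: T_def m_def)
  obtain \<delta>1 where \<delta>1: "0 < \<delta>1" and near: "\<And>es. (\<forall>e\<in>set es. 0 < e \<and> e \<le> \<delta>1) \<Longrightarrow> T \<le> sum_list es \<Longrightarrow>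
     sum_list es \<le> T + 1 \<Longrightarrow> \<bar>(\<integral>x. Kl es g x \<partial>\<mu>) - integral\<^sup>L \<mu> g\<bar> \<le> \<epsilon>2"
    using integral_Kl_near_invariant[OF T \<epsilon>2(1) g] by blast
  define \<delta> where "\<delta> = min \<delta>1 e0"
  have \<delta>: "0 < \<delta>" "\<delta> \<le> \<delta>1" "\<delta> \<le> e0" "\<delta> \<le> 1" using \<delta>1 e0 by (auto simp: \<delta>_def)
  have short: "\<bar>Kl es g y - integral\<^sup>L \<mu> g\<bar> \<le> \<epsilon>1 * (1 + (norm y)\<^sup>2)"
    if es: "\<forall>e\<in>set es. 0 < e \<and> e \<le> \<delta>" "T \<le> sum_list es" "sum_list es \<le> T + 1" for es y
  proof -
    have ese0: "\<forall>e\<in>set es. 0 < e \<and> e \<le> e0" using es(1) \<delta> by auto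
    have Kb: "\<bar>Kl es g x\<bar> \<le> c'" for x
      using Kl_bounds[of g "- c'" c' es x] c'(2) es(1) by (auto simp: abs_le_iff minus_le_iff intro: less_imp_le)
    have K2: "\<bar>Kl es g y - Kl es g x\<bar> \<le> 2 * c'" for x using Kb[of x] Kb[of y] by linarith
    have K1: "\<bar>Kl es g y - Kl es g x\<bar> \<le> c' * (a ^ m * (2 + \<beta> * ((norm y)\<^sup>2 + (norm x)\<^sup>2)))" for x
    proof -
      have "\<bar>Kl es (\<lambda>x. inverse c' * g x) y - Kl es (\<lambda>x. inverse c' * g x) x\<bar> \<le>
          a ^ m * (2 + \<beta> * ((norm y)\<^sup>2 + (norm x)\<^sup>2))"
        using c' es(2) by (intro contr ese0) (auto simp: T_def abs_mult field_simps)
      then show ?thesis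
        using c' unfolding Kl_cmult by (simp add: right_diff_distrib[symmetric] abs_mult field_simps)
    qed
    define V where "V = c' * (a ^ m * (2 + \<beta> * ((norm y)\<^sup>2 + R)))"
    have V0: "0 \<le> V" unfolding V_def using c' a \<beta> R by (intro mult_nonneg_nonneg add_nonneg_nonneg) auto
    \<comment> \<open>The contraction is used for \<open>x\<close> within the level
      \<open>R\<close>, the trivial bound \<open>2 * c'\<close> outside.\<close>
    have pw: "\<bar>Kl es g y - Kl es g x\<bar> \<le> 2 * c' * indicator {x. R < (norm x)\<^sup>2} x + V" for x
    proof (cases "R < (norm x)\<^sup>2")
      case True
      then show ?thesis using K2[of x] V0 by simp
    next
      case False
      have "c' * (a ^ m * (2 + \<beta> * ((norm y)\<^sup>2 + (norm x)\<^sup>2))) \<le> V"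
        unfolding V_def using False c' a \<beta> by (intro mult_left_mono add_left_mono) auto
      then show ?thesis using K1[of x] False by simp
    qed
    have int: "integrable \<mu> (Kl es g)" by (rule \<mu>.integrable_const_bound[of _ c']) (auto simp: Kb)
    have "Kl es g y - (\<integral>x. Kl es g x \<partial>\<mu>) = (\<integral>x. Kl es g y - Kl es g x \<partial>\<mu>)"
      using int \<mu>.prob_space by simp
    then have "\<bar>Kl es g y - (\<integral>x. Kl es g x \<partial>\<mu>)\<bar> \<le> (\<integral>x. \<bar>Kl es g y - Kl es g x\<bar> \<partial>\<mu>)"
      using integral_abs_bound[of \<mu> "\<lambda>x. Kl es g y - Kl es g x"] by simp
    also have "\<dots> \<le> (\<integral>x. 2 * c' * indicator {x. R < (norm x)\<^sup>2} x + V \<partial>\<mu>)"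
      using int pw by (intro integral_mono) (auto simp: \<mu>.emeasure_eq_measure)
    also have "\<dots> = 2 * c' * measure \<mu> {x. R < (norm x)\<^sup>2} + V"
      using \<mu>.prob_space by (simp add: \<mu>.emeasure_eq_measure)
    also have "\<dots> \<le> 2 * c' * \<epsilon>2 + \<epsilon>2 * (1 + (norm y)\<^sup>2)"
    proof (intro add_mono mult_left_mono R)
      have "2 + \<beta> * ((norm y)\<^sup>2 + R) \<le> (2 + \<beta> * R + \<beta>) * (1 + (norm y)\<^sup>2)"
        using \<beta> R by (simp add: algebra_simps)
      then have "V \<le> c' * (a ^ m * ((2 + \<beta> * R + \<beta>) * (1 + (norm y)\<^sup>2)))"
        unfolding V_def using c' a by (intro mult_left_mono) auto
      also have "\<dots> = a ^ m * D * (1 + (norm y)\<^sup>2)" by (simp add: D_def mult_ac)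
      also have "\<dots> \<le> \<epsilon>2 * (1 + (norm y)\<^sup>2)" using m by (intro mult_right_mono) auto
      finally show "V \<le> \<epsilon>2 * (1 + (norm y)\<^sup>2)" .
    qed (use c' in auto)
    finally have "\<bar>Kl es g y - (\<integral>x. Kl es g x \<partial>\<mu>)\<bar> \<le> 2 * c' * \<epsilon>2 + \<epsilon>2 * (1 + (norm y)\<^sup>2)" .
    moreover have "\<bar>(\<integral>x. Kl es g x \<partial>\<mu>) - integral\<^sup>L \<mu> g\<bar> \<le> \<epsilon>2" using es \<delta> by (intro near) auto
    ultimately have "\<bar>Kl es g y - integral\<^sup>L \<mu> g\<bar> \<le> (2 * c' + 1) * \<epsilon>2 * 1 + \<epsilon>2 * (1 + (norm y)\<^sup>2)"
      by (simp add: algebra_simps abs_le_iff)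
    also have "(2 * c' + 1) * \<epsilon>2 * 1 \<le> (2 * c' + 1) * \<epsilon>2 * (1 + (norm y)\<^sup>2)"
      using c' \<epsilon>2 by (intro mult_left_mono) auto
    also have "(2 * c' + 1) * \<epsilon>2 * (1 + (norm y)\<^sup>2) + \<epsilon>2 * (1 + (norm y)\<^sup>2) = \<epsilon>1 * (1 + (norm y)\<^sup>2)"
      unfolding \<epsilon>2(2)[symmetric] by (simp add: algebra_simps)
    finally show ?thesis by simp
  qed
  have "\<bar>Kl es g y - integral\<^sup>L \<mu> g\<bar> \<le> \<epsilon> * (1 + (norm y)\<^sup>2)"
    if es: "\<forall>e\<in>set es. 0 < e \<and> e \<le> \<delta>" "T \<le> sum_list es" for es y
  proof -
    \<comment> \<open>The window sits at the end of the list, because the operators there act on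
      \<open>g\<close> first.\<close>
    obtain fs gs where fg: "es = fs @ gs" "T \<le> sum_list gs" "sum_list gs \<le> T + 1"
      using split_list_sum_suffix[of es T] es T \<delta>(4) by fastforce
    have fs: "\<forall>e\<in>set fs. 0 < e \<and> e \<le> e0" and ge: "\<And>e. e \<in> set fs \<Longrightarrow> 0 \<le> e" "\<And>e. e \<in> set gs \<Longrightarrow> 0 \<le> e"
      using es(1) fg(1) \<delta>(3) by (auto intro: order_trans less_imp_le)
    have gs: "\<bar>Kl gs g x - integral\<^sup>L \<mu> g\<bar> \<le> \<epsilon>1 * (1 + (norm x)\<^sup>2)" for x
      using es(1) fg by (intro short) auto
    define G where "G = (\<lambda>x. Kl gs g x + (- integral\<^sup>L \<mu> g))"
    have pgK: "poly_growth 2 (Kl gs g)" using g(2) by (intro poly_growth_Kl poly_growth_bounded[of _ c] ge) auto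
    have pgG: "poly_growth 2 G" "poly_growth 2 (\<lambda>x. - 1 * G x)"
      unfolding G_def by (intro poly_growth_add poly_growth_cmult poly_growth_const pgK)+
    have pgV: "poly_growth 2 (\<lambda>x :: real^'n. 1 + (norm x)\<^sup>2)" "poly_growth 2 (\<lambda>x :: real^'n. \<epsilon>1 * (1 + (norm x)\<^sup>2))"
      by (intro poly_growth_add poly_growth_cmult poly_growth_const poly_growth_norm_power order_refl)+
    have KG: "Kl fs G y = Kl es g y - integral\<^sup>L \<mu> g"
      unfolding G_def fg(1) using Kl_add[OF pgK poly_growth_const ge(1), of fs "- integral\<^sup>L \<mu> g" y] by (simp add: Kl_append)
    have "Kl fs (\<lambda>x. 1 + (norm x)\<^sup>2) y = 1 + Kl fs (\<lambda>x. (norm x)\<^sup>2) y"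
      using Kl_add[of 2 "\<lambda>_. 1" "\<lambda>x. (norm x)\<^sup>2" fs y] ge by auto
    also have "\<dots> \<le> 1 + (exp (- (K1 / 4) * sum_list fs) * (norm y)\<^sup>2 + C)"
      using C(2)[OF fs] by simp
    also have "\<dots> \<le> 1 + (1 * (norm y)\<^sup>2 + C)"
      using K1 ge(1) by (intro add_left_mono add_right_mono mult_right_mono) (auto intro!: mult_nonneg_nonneg sum_list_nonneg_real)
    also have "\<dots> \<le> (1 + C) * (1 + (norm y)\<^sup>2)" using C(1) by (simp add: algebra_simps)
    finally have "Kl fs (\<lambda>x. \<epsilon>1 * (1 + (norm x)\<^sup>2)) y \<le> \<epsilon> * (1 + (norm y)\<^sup>2)"
      unfolding Kl_cmult \<epsilon>1(2)[symmetric] using \<epsilon>1(1) by (simp add: mult_left_mono mult.assoc)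
    moreover have "G x \<le> \<epsilon>1 * (1 + (norm x)\<^sup>2)" "- 1 * G x \<le> \<epsilon>1 * (1 + (norm x)\<^sup>2)" for x
      using gs[of x] by (auto simp: G_def)
    then have "Kl fs G y \<le> Kl fs (\<lambda>x. \<epsilon>1 * (1 + (norm x)\<^sup>2)) y"
      "Kl fs (\<lambda>x. - 1 * G x) y \<le> Kl fs (\<lambda>x. \<epsilon>1 * (1 + (norm x)\<^sup>2)) y"
      using pgG pgV ge by (auto intro!: Kl_mono[of 2])
    ultimately show ?thesis unfolding KG[symmetric] Kl_cmult by auto
  qed
  then show ?thesis using \<delta>(1) T by (intro exI[of _ T] exI[of _ \<delta>]) auto
qed

end


section \<open>Martingales with Gaussian increments\<close>

lemma exp_diff_le:
  fixes x y c :: real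
  assumes "x \<le> c" "y \<le> c"
  shows "\<bar>exp x - exp y\<bar> \<le> exp c * \<bar>x - y\<bar>"
proof -
  have *: "exp v - exp u \<le> exp c * (v - u)" if "u \<le> v" "v \<le> c" for u v :: real
  proof -
    have "exp v - exp u = exp v * (1 - exp (u - v))" by (simp add: right_diff_distrib exp_add[symmetric])
    also have "\<dots> \<le> exp v * (v - u)"
    proof (intro mult_left_mono)
      show "1 - exp (u - v) \<le> v - u" using exp_ge_add_one_self[of "u - v"] by linarith
    qed auto
    also have "\<dots> \<le> exp c * (v - u)" using that by (intro mult_right_mono) auto
    finally show ?thesis .
  qed
  show ?thesis
  proof (cases "x \<le> y")
    case True
    then show ?thesis using *[of x y] assms by simp
  next
    case False
    then show ?thesis using *[of y x] assms by simp
  qed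
qed

context iid_noise
begin

text \<open>The noise is Gaussian, so for a bounded quadratic variation \<open>V\<close> the variable
  \<open>exp (isX + s\<^sup>2V/2)\<close> has mean exactly \<open>1\<close>; the summands are switched off once the quadratic
  variation exceeds \<open>v + 1\<close>.\<close>

lemma martingale_char_bound:
  fixes a :: "nat \<Rightarrow> 'a \<Rightarrow> real^'n"
  assumes a: "\<And>k. a k \<in> borel_measurable (F k)" and v: "0 \<le> v"
    and int: "integrable M (\<lambda>\<omega>. \<Sum>k<n. (norm (a k \<omega>))\<^sup>2)"
  shows "cmod ((\<integral>\<omega>. iexp (s * (\<Sum>k<n. a k \<omega> \<bullet> \<xi> (Suc k) \<omega>)) \<partial>M) - exp (- s\<^sup>2 * v / 2)) \<le>
    (2 + s\<^sup>2 / 2 * exp (s\<^sup>2 * (v + 1) / 2) * (1 + v)) * (\<integral>\<omega>. \<bar>(\<Sum>k<n. (norm (a k \<omega>))\<^sup>2) - v\<bar> \<partial>M)"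
proof -
  define S where "S m \<omega> = (\<Sum>k<m. (norm (a k \<omega>))\<^sup>2)" for m \<omega>
  \<comment> \<open>The cut-off looks at \<open>S (Suc k)\<close>, which already contains
    \<open>a k\<close> but involves the noise up to index \<open>k\<close> only; so
    \<open>a'\<close> is predictable, and its quadratic variation never exceeds
    \<open>v + 1\<close>.\<close>
  define a' where "a' k \<omega> = (if S (Suc k) \<omega> \<le> v + 1 then a k \<omega> else 0)" for k \<omega>
  define X where "X m \<omega> = (\<Sum>k<m. a k \<omega> \<bullet> \<xi> (Suc k) \<omega>)" for m \<omega>
  define X' where "X' m \<omega> = (\<Sum>k<m. a' k \<omega> \<bullet> \<xi> (Suc k) \<omega>)" for m \<omega>
  define V' where "V' m \<omega> = (\<Sum>k<m. (norm (a' k \<omega>))\<^sup>2)" for m \<omega>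
  have aF: "a k \<in> borel_measurable (F m)" if "k \<le> m" for k m
    by (rule measurable_F_mono[OF that a])
  have SF: "S k \<in> borel_measurable (F m)" if "k \<le> Suc m" for k m
    unfolding S_def
  proof (rule borel_measurable_sum)
    fix j assume "j \<in> {..<k}"
    then have "j \<le> m" using that by simp
    from aF[OF this] show "(\<lambda>\<omega>. (norm (a j \<omega>))\<^sup>2) \<in> borel_measurable (F m)" by measurable
  qed
  have a'F: "a' k \<in> borel_measurable (F m)" if "k \<le> m" for k m
  proof -
    note [measurable] = aF[OF that] SF[OF Suc_le_mono[THEN iffD2, OF that]]
    show ?thesis unfolding a'_def by measurable
  qed
  have X'F: "X' m \<in> borel_measurable (F m)" for m
    unfolding X'_def by (intro borel_measurable_sum borel_measurable_inner a'F measurable_noise_F) auto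
  have V'F: "V' m \<in> borel_measurable (F m)" for m
    unfolding V'_def
  proof (rule borel_measurable_sum)
    fix j assume "j \<in> {..<m}"
    then have "j \<le> m" by simp
    from a'F[OF this] show "(\<lambda>\<omega>. (norm (a' j \<omega>))\<^sup>2) \<in> borel_measurable (F m)" by measurable
  qed
  note [measurable] = measurable_F_M[OF X'F] measurable_F_M[OF V'F] measurable_F_M[OF a]
    measurable_F_M[OF a'F[OF order_refl]] measurable_F_M[OF SF[OF le_SucI[OF order_refl]]]
  have [measurable]: "X m \<in> borel_measurable M" for m unfolding X_def by measurable
  have V'S: "V' m \<omega> \<le> S m \<omega> \<and> V' m \<omega> \<le> v + 1" for m \<omega>
    by (induction m) (use v in \<open>auto simp: V'_def S_def a'_def\<close>)
  have V'0: "0 \<le> V' m \<omega>" for m \<omega> unfolding V'_def by (intro sum_nonneg) auto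
  have Smono: "S k \<omega> \<le> S m \<omega>" if "k \<le> m" for k m \<omega>
    unfolding S_def using that by (intro sum_mono2) auto
  have same: "a' k \<omega> = a k \<omega>" if "S n \<omega> \<le> v + 1" "k < n" for k \<omega>
    using Smono[of "Suc k" n \<omega>] that by (simp add: a'_def)
  have X'X: "X' n \<omega> = X n \<omega>" and V'V: "V' n \<omega> = S n \<omega>" if "S n \<omega> \<le> v + 1" for \<omega>
    using same[OF that] by (auto simp: X'_def X_def V'_def S_def intro!: sum.cong)
  define E where "E = exp (s\<^sup>2 * (v + 1) / 2)"
  have expV': "exp (s\<^sup>2 * V' m \<omega> / 2) \<le> E" for m \<omega>
    unfolding E_def using V'S[of m \<omega>] by (auto intro!: mult_left_mono)
  \<comment> \<open>One step multiplies by an exponential whose Gaussian mean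
    \<open>exp (- (s\<^sup>2 * (norm (a' m \<omega>))\<^sup>2) / 2)\<close> is cancelled exactly by
    the growth of the compensating factor.\<close>
  have one: "(\<integral>\<omega>. iexp (s * X' m \<omega>) * exp (s\<^sup>2 * V' m \<omega> / 2) \<partial>M) = 1" for m
  proof (induction m)
    case 0
    then show ?case using prob_space by (simp add: X'_def V'_def)
  next
    case (Suc m)
    define f :: "(real \<times> real \<times> (real^'n)) \<times> (real^'n) \<Rightarrow> complex" where
      "f = (\<lambda>p. iexp (s * (fst (fst p) + snd (snd (fst p)) \<bullet> snd p)) *
        exp (s\<^sup>2 * (fst (snd (fst p)) + (norm (snd (snd (fst p))))\<^sup>2) / 2))"
    have [measurable]: "f \<in> borel_measurable ((borel \<Otimes>\<^sub>M borel \<Otimes>\<^sub>M borel) \<Otimes>\<^sub>M borel)"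
      unfolding f_def by measurable
    let ?Y = "\<lambda>\<omega>. (X' m \<omega>, V' m \<omega>, a' m \<omega>)"
    have Y: "?Y \<in> measurable (F m) (borel \<Otimes>\<^sub>M borel \<Otimes>\<^sub>M borel)"
      by (intro measurable_Pair X'F V'F a'F order_refl)
    have feq: "f (?Y \<omega>, \<xi> (Suc m) \<omega>) = iexp (s * X' (Suc m) \<omega>) * exp (s\<^sup>2 * V' (Suc m) \<omega> / 2)" for \<omega>
      by (simp add: f_def X'_def V'_def)
    have "(\<integral>\<omega>. iexp (s * X' (Suc m) \<omega>) * exp (s\<^sup>2 * V' (Suc m) \<omega> / 2) \<partial>M) = (\<integral>\<omega>. f (?Y \<omega>, \<xi> (Suc m) \<omega>) \<partial>M)"
      by (simp only: feq)
    also have "\<dots> = (\<integral>\<omega>. (\<integral>z. f (?Y \<omega>, z) \<partial>gauss) \<partial>M)"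
    proof (rule integral_next[OF Y])
      show "integrable M (\<lambda>\<omega>. f (?Y \<omega>, \<xi> (Suc m) \<omega>))"
        unfolding feq by (rule integrable_const_bound[of _ E]) (auto simp: norm_mult expV')
    qed measurable
    also have "\<dots> = (\<integral>\<omega>. iexp (s * X' m \<omega>) * exp (s\<^sup>2 * V' m \<omega> / 2) \<partial>M)"
    proof (rule Bochner_Integration.integral_cong[OF refl])
      fix \<omega>
      let ?u = "a' m \<omega>"
      have "f (?Y \<omega>, z) = (iexp (s * X' m \<omega>) * exp (s\<^sup>2 * (V' m \<omega> + (norm ?u)\<^sup>2) / 2)) * iexp ((s *\<^sub>R ?u) \<bullet> z)" for z
        by (simp add: f_def ring_distribs exp_add)
      then have "(\<integral>z. f (?Y \<omega>, z) \<partial>gauss) =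
          (iexp (s * X' m \<omega>) * exp (s\<^sup>2 * (V' m \<omega> + (norm ?u)\<^sup>2) / 2)) * exp (- (norm (s *\<^sub>R ?u))\<^sup>2 / 2)"
        by (simp only: integral_mult_right_zero char_gauss)
      also have "\<dots> = iexp (s * X' m \<omega>) * exp (complex_of_real (s\<^sup>2 * (V' m \<omega> + (norm ?u)\<^sup>2) / 2 + - (norm (s *\<^sub>R ?u))\<^sup>2 / 2))"
        by (simp only: of_real_add exp_add of_real_exp mult.assoc of_real_minus of_real_divide of_real_power of_real_numeral)
      also have "s\<^sup>2 * (V' m \<omega> + (norm ?u)\<^sup>2) / 2 + - (norm (s *\<^sub>R ?u))\<^sup>2 / 2 = s\<^sup>2 * V' m \<omega> / 2"
        by (simp add: power_mult_distrib field_simps)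
      finally show "(\<integral>z. f (?Y \<omega>, z) \<partial>gauss) = iexp (s * X' m \<omega>) * exp (s\<^sup>2 * V' m \<omega> / 2)"
        by (simp only: of_real_exp)
    qed
    finally show ?case using Suc.IH by simp
  qed
  define D where "D = (\<integral>\<omega>. \<bar>S n \<omega> - v\<bar> \<partial>M)"
  have intS: "integrable M (\<lambda>\<omega>. \<bar>S n \<omega> - v\<bar>)" using int by (auto simp: S_def)
  \<comment> \<open>Where the bound \<open>v + 1\<close> is exceeded,
    \<open>S n \<omega> - v\<close> is larger than 1, which pays for the crude bound
    \<open>1 + v\<close>.\<close>
  have close: "\<bar>V' n \<omega> - v\<bar> \<le> (1 + v) * \<bar>S n \<omega> - v\<bar>" for \<omega>
  proof (cases "S n \<omega> \<le> v + 1")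
    case True
    have "1 * \<bar>S n \<omega> - v\<bar> \<le> (1 + v) * \<bar>S n \<omega> - v\<bar>" using v by (intro mult_right_mono) auto
    then show ?thesis using V'V[OF True] by simp
  next
    case False
    have "\<bar>V' n \<omega> - v\<bar> \<le> 1 + v" using V'S[of n \<omega>] V'0[of n \<omega>] v by (auto simp: abs_le_iff)
    also have "\<dots> \<le> (1 + v) * \<bar>S n \<omega> - v\<bar>" using False v mult_left_mono[of 1 "\<bar>S n \<omega> - v\<bar>" "1 + v"] by simp
    finally show ?thesis .
  qed
  let ?c = "exp (s\<^sup>2 * v / 2)"
  \<comment> \<open>The constant \<open>?c\<close> replaces the random compensator of
    \<open>one\<close>; on the bounded range their difference is Lipschitz in the quadratic
    variation.\<close>
  have "cmod (?c * (\<integral>\<omega>. iexp (s * X' n \<omega>) \<partial>M) - 1) \<le> s\<^sup>2 / 2 * E * (1 + v) * D"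
  proof -
    have i1: "integrable M (\<lambda>\<omega>. iexp (s * X' n \<omega>))"
      by (rule integrable_const_bound[of _ 1]) auto
    have i2: "integrable M (\<lambda>\<omega>. iexp (s * X' n \<omega>) * exp (s\<^sup>2 * V' n \<omega> / 2))"
      by (rule integrable_const_bound[of _ E]) (auto simp: norm_mult expV')
    have eq: "?c * (\<integral>\<omega>. iexp (s * X' n \<omega>) \<partial>M) - 1 =
        (\<integral>\<omega>. ?c * iexp (s * X' n \<omega>) - iexp (s * X' n \<omega>) * exp (s\<^sup>2 * V' n \<omega> / 2) \<partial>M)"
      using i1 i2 one[of n] by simp
    have "cmod (?c * (\<integral>\<omega>. iexp (s * X' n \<omega>) \<partial>M) - 1) \<le> (\<integral>\<omega>. cmod (?c * iexp (s * X' n \<omega>) - iexp (s * X' n \<omega>) * exp (s\<^sup>2 * V' n \<omega> / 2)) \<partial>M)"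
      unfolding eq by (rule integral_norm_bound)
    also have "\<dots> \<le> (\<integral>\<omega>. s\<^sup>2 / 2 * E * (1 + v) * \<bar>S n \<omega> - v\<bar> \<partial>M)"
    proof (rule integral_mono)
      show "integrable M (\<lambda>\<omega>. cmod (?c * iexp (s * X' n \<omega>) - iexp (s * X' n \<omega>) * exp (s\<^sup>2 * V' n \<omega> / 2)))"
        using i1 i2 by auto
      show "integrable M (\<lambda>\<omega>. s\<^sup>2 / 2 * E * (1 + v) * \<bar>S n \<omega> - v\<bar>)" using intS by auto
      fix \<omega>
      have "?c * iexp (s * X' n \<omega>) - iexp (s * X' n \<omega>) * exp (s\<^sup>2 * V' n \<omega> / 2) =
          iexp (s * X' n \<omega>) * complex_of_real (?c - exp (s\<^sup>2 * V' n \<omega> / 2))"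
        by (simp add: algebra_simps of_real_exp)
      then have "cmod (?c * iexp (s * X' n \<omega>) - iexp (s * X' n \<omega>) * exp (s\<^sup>2 * V' n \<omega> / 2)) =
          \<bar>?c - exp (s\<^sup>2 * V' n \<omega> / 2)\<bar>"
        by (simp only: norm_mult norm_of_real norm_exp_i_times mult_1_left)
      also have "\<dots> \<le> E * \<bar>s\<^sup>2 * v / 2 - s\<^sup>2 * V' n \<omega> / 2\<bar>"
        unfolding E_def using V'S[of n \<omega>] by (intro exp_diff_le) (auto intro!: mult_left_mono)
      also have "\<bar>s\<^sup>2 * v / 2 - s\<^sup>2 * V' n \<omega> / 2\<bar> = s\<^sup>2 / 2 * \<bar>V' n \<omega> - v\<bar>"
        by (simp add: right_diff_distrib[symmetric] diff_divide_distrib[symmetric] abs_mult abs_minus_commute)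
      also have "E * (s\<^sup>2 / 2 * \<bar>V' n \<omega> - v\<bar>) \<le> E * (s\<^sup>2 / 2 * ((1 + v) * \<bar>S n \<omega> - v\<bar>))"
        using close[of \<omega>] by (intro mult_left_mono) (auto simp: E_def)
      finally show "cmod (?c * iexp (s * X' n \<omega>) - iexp (s * X' n \<omega>) * exp (s\<^sup>2 * V' n \<omega> / 2)) \<le>
          s\<^sup>2 / 2 * E * (1 + v) * \<bar>S n \<omega> - v\<bar>" by (simp only: mult_ac)
    qed
    also have "\<dots> = s\<^sup>2 / 2 * E * (1 + v) * D" by (simp add: D_def)
    finally show ?thesis .
  qed
  moreover have "(\<integral>\<omega>. iexp (s * X' n \<omega>) \<partial>M) - exp (- s\<^sup>2 * v / 2) =
      complex_of_real (exp (- s\<^sup>2 * v / 2)) * (?c * (\<integral>\<omega>. iexp (s * X' n \<omega>) \<partial>M) - 1)"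
    by (simp add: right_diff_distrib mult.assoc[symmetric] of_real_exp exp_add[symmetric])
  moreover have "cmod (complex_of_real (exp (- s\<^sup>2 * v / 2))) \<le> 1"
    using v by simp
  ultimately have part1: "cmod ((\<integral>\<omega>. iexp (s * X' n \<omega>) \<partial>M) - exp (- s\<^sup>2 * v / 2)) \<le> s\<^sup>2 / 2 * E * (1 + v) * D"
    by (simp only: norm_mult) (rule order_trans[OF mult_left_le_one_le], auto)
  \<comment> \<open>The switched-off sum differs from the original one only where \<open>S n\<close>
    exceeds \<open>v + 1\<close>; there the exponentials differ by at most 2, hence by at most
    \<open>2 * \<bar>S n \<omega> - v\<bar>\<close>.\<close>
  have eq: "(\<integral>\<omega>. iexp (s * X n \<omega>) \<partial>M) - (\<integral>\<omega>. iexp (s * X' n \<omega>) \<partial>M) =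
      (\<integral>\<omega>. iexp (s * X n \<omega>) - iexp (s * X' n \<omega>) \<partial>M)"
    by (intro Bochner_Integration.integral_diff[symmetric] integrable_const_bound[of _ 1]) auto
  have "cmod ((\<integral>\<omega>. iexp (s * X n \<omega>) \<partial>M) - (\<integral>\<omega>. iexp (s * X' n \<omega>) \<partial>M)) \<le>
      (\<integral>\<omega>. cmod (iexp (s * X n \<omega>) - iexp (s * X' n \<omega>)) \<partial>M)"
    unfolding eq by (rule integral_norm_bound)
  also have "\<dots> \<le> (\<integral>\<omega>. 2 * \<bar>S n \<omega> - v\<bar> \<partial>M)"
  proof (rule integral_mono)
    fix \<omega>
    show "cmod (iexp (s * X n \<omega>) - iexp (s * X' n \<omega>)) \<le> 2 * \<bar>S n \<omega> - v\<bar>"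
    proof (cases "S n \<omega> \<le> v + 1")
      case True
      then show ?thesis using X'X[OF True] by simp
    next
      case False
      have "cmod (iexp (s * X n \<omega>) - iexp (s * X' n \<omega>)) \<le> 1 + 1"
        by (rule order_trans[OF norm_triangle_ineq4]) simp
      then show ?thesis using False by simp
    qed
    have "cmod (iexp (s * X n \<omega>) - iexp (s * X' n \<omega>)) \<le> 2" for \<omega>
      using norm_triangle_ineq4[of "iexp (s * X n \<omega>)" "iexp (s * X' n \<omega>)"] by simp
    then show "integrable M (\<lambda>\<omega>. cmod (iexp (s * X n \<omega>) - iexp (s * X' n \<omega>)))"
      by (intro integrable_const_bound[of _ 2] AE_I2) (simp, measurable)
    show "integrable M (\<lambda>\<omega>. 2 * \<bar>S n \<omega> - v\<bar>)" using intS by auto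
  qed
  also have "\<dots> = 2 * D" by (simp add: D_def)
  finally have part2: "cmod ((\<integral>\<omega>. iexp (s * X n \<omega>) \<partial>M) - (\<integral>\<omega>. iexp (s * X' n \<omega>) \<partial>M)) \<le> 2 * D" .
  have "cmod ((\<integral>\<omega>. iexp (s * X n \<omega>) \<partial>M) - exp (- s\<^sup>2 * v / 2)) \<le> 2 * D + s\<^sup>2 / 2 * E * (1 + v) * D"
    using norm_triangle_mono[OF part2 part1] by simp
  also have "\<dots> = (2 + s\<^sup>2 / 2 * E * (1 + v)) * D" by (simp add: algebra_simps)
  finally show ?thesis by (simp only: E_def D_def S_def X_def)
qed

text \<open>Orthogonality of martingale differences: the sum up to \<open>n\<close> belongs to the
  past, and the next increment has mean 0 for every frozen value of the past, which kills the cross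
  term.\<close>

lemma martingale_difference_square:
  fixes f :: "nat \<Rightarrow> 'b \<times> (real^'n) \<Rightarrow> real"
  assumes Y: "\<And>k. Y k \<in> measurable (F k) S" and f: "\<And>k. f k \<in> borel_measurable (S \<Otimes>\<^sub>M borel)"
    and mean: "\<And>k y. (\<integral>z. f k (y, z) \<partial>gauss) = 0"
    and sq: "\<And>k. integrable M (\<lambda>\<omega>. (f k (Y k \<omega>, \<xi> (Suc k) \<omega>))\<^sup>2)"
  shows "integrable M (\<lambda>\<omega>. (\<Sum>k<n. f k (Y k \<omega>, \<xi> (Suc k) \<omega>))\<^sup>2) \<and>
    (\<integral>\<omega>. (\<Sum>k<n. f k (Y k \<omega>, \<xi> (Suc k) \<omega>))\<^sup>2 \<partial>M) =
      (\<Sum>k<n. (\<integral>\<omega>. (f k (Y k \<omega>, \<xi> (Suc k) \<omega>))\<^sup>2 \<partial>M))"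
proof (induction n)
  case (Suc n)
  note [measurable] = f
  define Q where "Q \<omega> = (\<Sum>k<n. f k (Y k \<omega>, \<xi> (Suc k) \<omega>))" for \<omega>
  define q where "q \<omega> = f n (Y n \<omega>, \<xi> (Suc n) \<omega>)" for \<omega>
  have QF: "Q \<in> borel_measurable (F n)"
    unfolding Q_def
    by (intro borel_measurable_sum measurable_compose[OF _ f] measurable_Pair measurable_F_mono[OF _ Y] measurable_noise_F) auto
  note [measurable] = measurable_F_M[OF QF] measurable_F_M[OF Y]
  have [measurable]: "q \<in> borel_measurable M" unfolding q_def by measurable
  have Q2: "integrable M (\<lambda>\<omega>. (Q \<omega>)\<^sup>2)" and q2: "integrable M (\<lambda>\<omega>. (q \<omega>)\<^sup>2)"
    using Suc.IH sq[of n] by (auto simp: Q_def q_def)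
  have Qq: "integrable M (\<lambda>\<omega>. Q \<omega> * q \<omega>)"
  proof (rule Bochner_Integration.integrable_bound)
    show "integrable M (\<lambda>\<omega>. (Q \<omega>)\<^sup>2 + (q \<omega>)\<^sup>2)" using Q2 q2 by auto
    have "\<bar>Q \<omega> * q \<omega>\<bar> \<le> (Q \<omega>)\<^sup>2 + (q \<omega>)\<^sup>2" for \<omega>
    proof -
      have "0 \<le> \<bar>Q \<omega>\<bar> * \<bar>q \<omega>\<bar>" by simp
      moreover have "2 * (\<bar>Q \<omega>\<bar> * \<bar>q \<omega>\<bar>) \<le> (Q \<omega>)\<^sup>2 + (q \<omega>)\<^sup>2"
        using sum_squares_bound[of "\<bar>Q \<omega>\<bar>" "\<bar>q \<omega>\<bar>"] by simp
      ultimately show ?thesis unfolding abs_mult by linarith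
    qed
    then show "AE \<omega> in M. norm (Q \<omega> * q \<omega>) \<le> norm ((Q \<omega>)\<^sup>2 + (q \<omega>)\<^sup>2)" by auto
  qed measurable
  have "(\<integral>\<omega>. Q \<omega> * q \<omega> \<partial>M) = (\<integral>\<omega>. (\<lambda>p. fst (fst p) * f n (snd (fst p), snd p)) ((Q \<omega>, Y n \<omega>), \<xi> (Suc n) \<omega>) \<partial>M)"
    by (simp add: q_def)
  also have "\<dots> = (\<integral>\<omega>. (\<integral>z. (\<lambda>p. fst (fst p) * f n (snd (fst p), snd p)) ((Q \<omega>, Y n \<omega>), z) \<partial>gauss) \<partial>M)"
  proof (rule integral_next)
    show "(\<lambda>\<omega>. (Q \<omega>, Y n \<omega>)) \<in> measurable (F n) (borel \<Otimes>\<^sub>M S)" by (intro measurable_Pair QF Y)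
    show "(\<lambda>p. fst (fst p) * f n (snd (fst p), snd p)) \<in> borel_measurable ((borel \<Otimes>\<^sub>M S) \<Otimes>\<^sub>M borel)" by measurable
    show "integrable M (\<lambda>\<omega>. (\<lambda>p. fst (fst p) * f n (snd (fst p), snd p)) ((Q \<omega>, Y n \<omega>), \<xi> (Suc n) \<omega>))"
      using Qq by (simp add: q_def)
  qed
  also have "\<dots> = 0" by (simp add: mean)
  finally have cross: "(\<integral>\<omega>. Q \<omega> * q \<omega> \<partial>M) = 0" .
  have eq: "(\<Sum>k<Suc n. f k (Y k \<omega>, \<xi> (Suc k) \<omega>))\<^sup>2 = (Q \<omega>)\<^sup>2 + 2 * (Q \<omega> * q \<omega>) + (q \<omega>)\<^sup>2" for \<omega>
    by (simp add: Q_def q_def power2_sum algebra_simps)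
  have "(\<integral>\<omega>. (\<Sum>k<Suc n. f k (Y k \<omega>, \<xi> (Suc k) \<omega>))\<^sup>2 \<partial>M) = (\<integral>\<omega>. (Q \<omega>)\<^sup>2 \<partial>M) + (\<integral>\<omega>. (q \<omega>)\<^sup>2 \<partial>M)"
    unfolding eq using Q2 q2 Qq cross by simp
  moreover have "integrable M (\<lambda>\<omega>. (\<Sum>k<Suc n. f k (Y k \<omega>, \<xi> (Suc k) \<omega>))\<^sup>2)"
    unfolding eq using Q2 q2 Qq by auto
  ultimately show ?case using Suc.IH by (simp add: Q_def q_def)
qed simp

end


section \<open>Weighted ergodic averages\<close>

text \<open>At most \<open>2 * r + 1\<close> integers lie within distance \<open>r\<close> of
  \<open>j\<close>, and each weight is at most \<open>u\<close>.\<close>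

lemma weighted_sum_near_diagonal:
  fixes w :: "nat \<Rightarrow> real"
  assumes w: "\<And>k. k < n \<Longrightarrow> 0 \<le> w k" "\<And>k. k < n \<Longrightarrow> w k \<le> u" and u: "0 \<le> u" and r: "0 \<le> r"
  shows "(\<Sum>k<n. w k * (if \<bar>real j - real k\<bar> < r then 1 else 0)) \<le> (2 * r + 1) * u"
proof -
  define A where "A = {k. k < n \<and> \<bar>real j - real k\<bar> < r}"
  define q where "q = nat \<lfloor>r\<rfloor>"
  have "A \<subseteq> {j - q..j + q}"
  proof
    fix k assume "k \<in> A"
    then have "real_of_int \<bar>int j - int k\<bar> \<le> r" by (simp add: A_def)
    then have "\<bar>int j - int k\<bar> \<le> \<lfloor>r\<rfloor>" by (simp only: le_floor_iff)
    then have "\<bar>int j - int k\<bar> \<le> int q" using r by (simp add: q_def)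
    then show "k \<in> {j - q..j + q}" by auto
  qed
  then have "card A \<le> card {j - q..j + q}" by (rule card_mono[rotated]) simp
  also have "\<dots> \<le> 2 * q + 1" by simp
  finally have "real (card A) \<le> 2 * real q + 1" by linarith
  also have "\<dots> \<le> 2 * r + 1" using r by (simp add: q_def)
  finally have card: "real (card A) \<le> 2 * r + 1" .
  have "(\<Sum>k<n. w k * (if \<bar>real j - real k\<bar> < r then 1 else 0)) = (\<Sum>k\<in>A. w k)"
    by (rule sum.mono_neutral_cong_right) (auto simp: A_def)
  also have "\<dots> \<le> (\<Sum>k\<in>A. u)" by (intro sum_mono w) (auto simp: A_def)
  also have "\<dots> = real (card A) * u" by simp
  also have "\<dots> \<le> (2 * r + 1) * u" using card u by (rule mult_right_mono)
  finally show ?thesis .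
qed

text \<open>The step-size conditions appear in the form in which they enter the estimates:
  \<open>\<eta>_sq\<close> follows from the summable powers, \<open>\<eta>_T\<close> from the null
  sequence with the numerator tending to infinity.\<close>

locale em_full = em_sde b \<sigma> L K1 K2 W B X \<mu> + em_chain b \<sigma> L K1 K2 M \<xi> \<eta> x0
  for b :: "real^'n \<Rightarrow> real^'n" and \<sigma> L K1 K2 and W :: "'w measure" and B X \<mu>
    and M :: "'a measure" and \<xi> \<eta> x0 +
  assumes \<eta>_dec: "1 \<le> k \<Longrightarrow> \<eta> (Suc k) \<le> \<eta> k"
    and \<eta>_le: "1 \<le> k \<Longrightarrow> \<eta> k \<le> e0"
    and \<eta>_sq: "summable (\<lambda>k. (\<eta> (Suc k))\<^sup>2)"
    and \<eta>_T: "(\<lambda>n. 1 / (\<eta> n * sqrt (T_sum \<eta> n))) \<longlonglongrightarrow> 0"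
begin

text \<open>Weight of the position \<open>\<theta> k\<close>, shifted by one because the step that
  leaves \<open>\<theta> k\<close> has size \<open>\<eta> (Suc k)\<close>.\<close>

definition w :: "nat \<Rightarrow> real" where "w k = inverse (\<eta> (Suc k))"

lemma T_sum_eq: "T_sum \<eta> n = (\<Sum>k<n. w k)"
  unfolding T_sum_def w_def by (induction n) auto

lemma w_pos: "0 < w k" by (simp add: w_def)

lemma \<eta>_antimono: "1 \<le> j \<Longrightarrow> j \<le> k \<Longrightarrow> \<eta> k \<le> \<eta> j"
proof (induction k)
  case (Suc k)
  then show ?case
    using \<eta>_dec[of k] by (cases "j = Suc k") (auto intro: order_trans)
qed simp

lemma \<eta>_le_1: "1 \<le> k \<Longrightarrow> \<eta> k \<le> 1"
  using \<eta>_le[of k] e0 by simp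

lemma T_sum_pos: "0 < n \<Longrightarrow> 0 < T_sum \<eta> n"
  unfolding T_sum_eq by (intro sum_pos) (auto simp: w_pos)

lemma T_sum_nonneg: "0 \<le> T_sum \<eta> n"
  unfolding T_sum_eq by (intro sum_nonneg) (auto simp: w_pos less_imp_le)

lemma w_le: "k < n \<Longrightarrow> w k \<le> inverse (\<eta> n)"
  unfolding w_def using \<eta>_antimono[of "Suc k" n] \<eta>_pos[of n] by (intro le_imp_inverse_le) auto

lemma \<eta>_tendsto_0: "(\<lambda>k. \<eta> (Suc k)) \<longlonglongrightarrow> 0"
proof -
  have "(\<lambda>k. sqrt ((\<eta> (Suc k))\<^sup>2)) \<longlonglongrightarrow> sqrt 0"
    by (intro tendsto_real_sqrt summable_LIMSEQ_zero[OF \<eta>_sq])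
  then show ?thesis by simp
qed

lemma \<eta>_T_sq: "(\<lambda>n. 1 / ((\<eta> n)\<^sup>2 * T_sum \<eta> n)) \<longlonglongrightarrow> 0"
  using tendsto_power[OF \<eta>_T, of 2] T_sum_nonneg by (simp add: power_divide power_mult_distrib)

lemma T_sum_ge: "real n \<le> T_sum \<eta> n"
proof -
  have "(\<Sum>k<n. 1) \<le> (\<Sum>k<n. w k)"
    unfolding w_def using \<eta>_le_1 by (intro sum_mono) (auto simp: one_le_inverse_iff)
  then show ?thesis by (simp add: T_sum_eq)
qed

lemma T_sum_at_top: "filterlim (T_sum \<eta>) at_top sequentially"
  by (rule filterlim_at_top_mono[OF filterlim_real_sequentially]) (simp add: T_sum_ge)

lemma moments:
  "\<exists>C\<ge>0. \<forall>k. integrable M (\<lambda>\<omega>. (1 + norm (\<theta> k \<omega>)) ^ q * (1 + norm (\<xi> (Suc k) \<omega>)) ^ r) \<and>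
    (\<integral>\<omega>. (1 + norm (\<theta> k \<omega>)) ^ q * (1 + norm (\<xi> (Suc k) \<omega>)) ^ r \<partial>M) \<le> C"
  by (rule moment_bound) (rule \<eta>_le)

section \<open>Decay of covariances and convergence in mean square\<close>

lemma centred_bound:
  fixes g :: "real^'n \<Rightarrow> real"
  assumes [measurable]: "g \<in> borel_measurable borel" and g: "\<And>x. \<bar>g x\<bar> \<le> c"
  shows "\<bar>g x - integral\<^sup>L \<mu> g\<bar> \<le> 2 * c"
proof -
  have c: "0 \<le> c" using g[of 0] by linarith
  have "\<bar>integral\<^sup>L \<mu> g\<bar> \<le> (\<integral>x. \<bar>g x\<bar> \<partial>\<mu>)" by (rule integral_abs_bound)
  also have "\<dots> \<le> (\<integral>x. c \<partial>\<mu>)"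
    by (intro integral_mono \<mu>.integrable_const_bound[of _ c]) (auto simp: g c)
  finally show ?thesis using g[of x] \<mu>.prob_space by simp
qed

text \<open>Integrating out the steps after \<open>j\<close> turns the covariance into the mean of
  \<open>G (\<theta> j)\<close> times the centred operator at \<open>\<theta> j\<close>, which is
  small by mixing. The elapsed time is at least \<open>(k - j) * \<eta> n\<close>, since steps do
  not increase; from \<open>J\<close> on they are short enough for mixing.\<close>

lemma decorrelation:
  fixes g :: "real^'n \<Rightarrow> real"
  assumes \<epsilon>: "0 < \<epsilon>" and g: "continuous_on UNIV g" "\<And>x. \<bar>g x\<bar> \<le> c"
  shows "\<exists>J T. 0 \<le> T \<and> (\<forall>j k n. J \<le> j \<longrightarrow> j \<le> k \<longrightarrow> k < n \<longrightarrow> T \<le> real (k - j) * \<eta> n \<longrightarrow>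
    \<bar>\<integral>\<omega>. (g (\<theta> j \<omega>) - integral\<^sup>L \<mu> g) * (g (\<theta> k \<omega>) - integral\<^sup>L \<mu> g) \<partial>M\<bar> \<le> \<epsilon>)"
proof -
  have [measurable]: "g \<in> borel_measurable borel" by (rule borel_measurable_continuous_onI[OF g(1)])
  have c: "0 \<le> c" using g(2)[of 0] by linarith
  obtain C where C: "0 \<le> C" "\<And>k. integrable M (\<lambda>\<omega>. (1 + norm (\<theta> k \<omega>)) ^ 2)"
    "\<And>k. (\<integral>\<omega>. (1 + norm (\<theta> k \<omega>)) ^ 2 \<partial>M) \<le> C"
    using moments[of 2 0] by auto
  define G where "G = (\<lambda>x. g x - integral\<^sup>L \<mu> g)"
  have [measurable]: "G \<in> borel_measurable borel" unfolding G_def by measurable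
  have G: "\<bar>G x\<bar> \<le> 2 * c" for x unfolding G_def by (rule centred_bound) (auto simp: g)
  \<comment> \<open>The mixing bound is \<open>\<epsilon>'\<close> times a quadratic function of the
    position, whose mean is at most \<open>C\<close>; the summand 1 keeps the denominator
    positive.\<close>
  define \<epsilon>' where "\<epsilon>' = \<epsilon> / (2 * c * C + 1)"
  have \<epsilon>': "0 < \<epsilon>'" "2 * c * (\<epsilon>' * C) \<le> \<epsilon>"
  proof -
    have p: "0 < 2 * c * C + 1" using c C(1) by (simp add: add_nonneg_pos)
    then show "0 < \<epsilon>'" using \<epsilon> by (simp add: \<epsilon>'_def)
    have "2 * c * (\<epsilon>' * C) = \<epsilon> * (2 * c * C / (2 * c * C + 1))" by (simp add: \<epsilon>'_def)
    also have "\<dots> \<le> \<epsilon> * 1" using p \<epsilon> by (intro mult_left_mono) auto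
    finally show "2 * c * (\<epsilon>' * C) \<le> \<epsilon>" by simp
  qed
  obtain T \<delta> where \<delta>: "0 < \<delta>" "0 \<le> T" and mix: "\<And>es y. (\<forall>e\<in>set es. 0 < e \<and> e \<le> \<delta>) \<Longrightarrow> T \<le> sum_list es \<Longrightarrow>
    \<bar>Kl es g y - integral\<^sup>L \<mu> g\<bar> \<le> \<epsilon>' * (1 + (norm y)\<^sup>2)"
    using Kl_mixing[OF \<epsilon>'(1) g] by blast
  obtain J where J: "\<And>k. J \<le> k \<Longrightarrow> \<eta> (Suc k) < \<delta>"
    using order_tendstoD(2)[OF \<eta>_tendsto_0 \<delta>(1)] unfolding eventually_sequentially by blast
  have "\<bar>\<integral>\<omega>. G (\<theta> j \<omega>) * G (\<theta> k \<omega>) \<partial>M\<bar> \<le> \<epsilon>"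
    if jk: "J \<le> j" "j \<le> k" "k < n" "T \<le> real (k - j) * \<eta> n" for j k n
  proof -
    define es where "es = map \<eta> [Suc j..<Suc k]"
    have es: "\<forall>e\<in>set es. 0 < e \<and> e \<le> \<delta>"
    proof
      fix e assume "e \<in> set es"
      then obtain i where i: "e = \<eta> i" "Suc j \<le> i" by (auto simp: es_def)
      then show "0 < e \<and> e \<le> \<delta>" using J[of "i - 1"] jk(1) \<eta>_pos[of i] by (cases i) auto
    qed
    have "sum_list es = (\<Sum>i\<in>{Suc j..<Suc k}. \<eta> i)"
      unfolding es_def by (simp add: sum_list_distinct_conv_sum_set del: upt_Suc)
    also have "\<dots> \<ge> (\<Sum>i\<in>{Suc j..<Suc k}. \<eta> n)"
      using jk by (intro sum_mono \<eta>_antimono) auto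
    finally have sum: "T \<le> sum_list es" using jk(2,4) by simp
    have "(\<lambda>\<omega>. G (\<theta> j \<omega>)) \<in> borel_measurable (F j)"
      using measurable_\<theta>_F[OF order_refl, of j] by measurable
    from markov[OF jk(2) this, of "2 * c" G "2 * c"] G
    have eq: "(\<integral>\<omega>. G (\<theta> j \<omega>) * G (\<theta> k \<omega>) \<partial>M) = (\<integral>\<omega>. G (\<theta> j \<omega>) * Kl es G (\<theta> j \<omega>) \<partial>M)"
      by (simp add: es_def del: upt_Suc)
    have "\<bar>\<integral>\<omega>. G (\<theta> j \<omega>) * G (\<theta> k \<omega>) \<partial>M\<bar> \<le> (\<integral>\<omega>. \<bar>G (\<theta> j \<omega>) * Kl es G (\<theta> j \<omega>)\<bar> \<partial>M)"
      unfolding eq by (rule integral_abs_bound)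
    also have "\<dots> \<le> (\<integral>\<omega>. 2 * c * (\<epsilon>' * (1 + norm (\<theta> j \<omega>)) ^ 2) \<partial>M)"
    proof (rule integral_mono)
      have KG: "Kl es G y = Kl es g y - integral\<^sup>L \<mu> g" for y
      proof -
        have "poly_growth 0 g" using g(2) by (intro poly_growth_bounded) auto
        from Kl_add[OF this poly_growth_const, of es "- integral\<^sup>L \<mu> g" y] show ?thesis
          using es by (simp add: G_def less_imp_le)
      qed
      have KGb: "\<bar>Kl es G y\<bar> \<le> 2 * c" for y
        using Kl_bounds[of G "- (2 * c)" "2 * c" es y] G es by (auto simp: abs_le_iff minus_le_iff less_imp_le)
      show "integrable M (\<lambda>\<omega>. \<bar>G (\<theta> j \<omega>) * Kl es G (\<theta> j \<omega>)\<bar>)"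
      proof (rule integrable_const_bound[of _ "(2 * c) * (2 * c)"], rule AE_I2)
        show "norm \<bar>G (\<theta> j \<omega>) * Kl es G (\<theta> j \<omega>)\<bar> \<le> (2 * c) * (2 * c)" for \<omega>
          unfolding real_norm_def abs_abs abs_mult by (intro mult_mono G KGb) (auto simp: c)
      qed measurable
      show "integrable M (\<lambda>\<omega>. 2 * c * (\<epsilon>' * (1 + norm (\<theta> j \<omega>)) ^ 2))" using C(2)[of j] by auto
      fix \<omega>
      have "\<bar>Kl es G (\<theta> j \<omega>)\<bar> \<le> \<epsilon>' * (1 + (norm (\<theta> j \<omega>))\<^sup>2)" unfolding KG by (rule mix[OF es sum])
      also have "\<dots> \<le> \<epsilon>' * (1 + norm (\<theta> j \<omega>)) ^ 2"
        using \<epsilon>'(1) by (intro mult_left_mono) (auto simp: power2_eq_square algebra_simps)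
      finally show "\<bar>G (\<theta> j \<omega>) * Kl es G (\<theta> j \<omega>)\<bar> \<le> 2 * c * (\<epsilon>' * (1 + norm (\<theta> j \<omega>)) ^ 2)"
        unfolding abs_mult using c by (intro mult_mono G) auto
    qed
    also have "\<dots> = 2 * c * (\<epsilon>' * (\<integral>\<omega>. (1 + norm (\<theta> j \<omega>)) ^ 2 \<partial>M))" by simp
    also have "\<dots> \<le> 2 * c * (\<epsilon>' * C)"
      using c \<epsilon>'(1) C(3) by (intro mult_left_mono) auto
    finally show ?thesis using \<epsilon>'(2) by simp
  qed
  then show ?thesis unfolding G_def using \<delta>(2) by blast
qed

text \<open>The second moment is a weighted double sum of covariances. Far pairs are small by
  decorrelation; pairs with an index below \<open>J\<close> have total weight of order
  \<open>T_sum \<eta> n\<close>, and pairs closer than \<open>T / \<eta> n\<close> at most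
  \<open>(2 * T + 1) / (\<eta> n)\<^sup>2 * T_sum \<eta> n\<close>. The last two vanish against the
  square of \<open>T_sum \<eta> n\<close>.\<close>

lemma ergodic_bounded:
  fixes g :: "real^'n \<Rightarrow> real"
  assumes g: "continuous_on UNIV g" "\<And>x. \<bar>g x\<bar> \<le> c"
  shows "(\<lambda>n. \<integral>\<omega>. ((\<Sum>k<n. w k * (g (\<theta> k \<omega>) - integral\<^sup>L \<mu> g)) / T_sum \<eta> n)\<^sup>2 \<partial>M) \<longlonglongrightarrow> 0"
proof -
  have [measurable]: "g \<in> borel_measurable borel" by (rule borel_measurable_continuous_onI[OF g(1)])
  have c: "0 \<le> c" using g(2)[of 0] by linarith
  define G where "G = (\<lambda>x. g x - integral\<^sup>L \<mu> g)"
  have [measurable]: "G \<in> borel_measurable borel" unfolding G_def by measurable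
  have G: "\<bar>G x\<bar> \<le> 2 * c" for x unfolding G_def by (rule centred_bound) (auto simp: g)
  define D where "D = (2 * c) * (2 * c)"
  have D: "0 \<le> D" using c by (simp add: D_def)
  define cv where "cv j k = (\<integral>\<omega>. G (\<theta> j \<omega>) * G (\<theta> k \<omega>) \<partial>M)" for j k
  have GG: "\<bar>G x * G y\<bar> \<le> D" for x y
    unfolding abs_mult D_def using c by (intro mult_mono G) auto
  have GGi: "integrable M (\<lambda>\<omega>. G (\<theta> j \<omega>) * G (\<theta> k \<omega>))" for j k
    by (rule integrable_const_bound[of _ D]) (use GG in auto)
  have cvD: "\<bar>cv j k\<bar> \<le> D" for j k
  proof -
    have "\<bar>cv j k\<bar> \<le> (\<integral>\<omega>. \<bar>G (\<theta> j \<omega>) * G (\<theta> k \<omega>)\<bar> \<partial>M)" unfolding cv_def by (rule integral_abs_bound)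
    also have "\<dots> \<le> (\<integral>\<omega>. D \<partial>M)" using GGi GG by (intro integral_mono) auto
    finally show ?thesis using prob_space by simp
  qed
  have cv_sym: "cv j k = cv k j" for j k by (simp add: cv_def mult.commute)
  have second: "(\<integral>\<omega>. ((\<Sum>k<n. w k * G (\<theta> k \<omega>)) / T_sum \<eta> n)\<^sup>2 \<partial>M) =
      (\<Sum>j<n. \<Sum>k<n. w j * w k * cv j k) / (T_sum \<eta> n)\<^sup>2" for n
  proof -
    have "((\<Sum>k<n. w k * G (\<theta> k \<omega>)) / T_sum \<eta> n)\<^sup>2 =
        (\<Sum>j<n. \<Sum>k<n. w j * w k * (G (\<theta> j \<omega>) * G (\<theta> k \<omega>))) / (T_sum \<eta> n)\<^sup>2" for \<omega>
      by (simp add: power_divide power2_eq_square sum_product mult_ac)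
    then show ?thesis using GGi by (simp add: cv_def)
  qed
  show ?thesis
  proof (rule LIMSEQ_I)
    fix r :: real assume r: "0 < r"
    define \<epsilon> where "\<epsilon> = r / 2"
    have \<epsilon>: "0 < \<epsilon>" using r by (simp add: \<epsilon>_def)
    obtain J T where T: "0 \<le> T" and dec: "\<And>j k n. J \<le> j \<Longrightarrow> j \<le> k \<Longrightarrow> k < n \<Longrightarrow> T \<le> real (k - j) * \<eta> n \<Longrightarrow>
        \<bar>cv j k\<bar> \<le> \<epsilon>"
      using decorrelation[OF \<epsilon> g] unfolding cv_def G_def by blast
    define TJ where "TJ = T_sum \<eta> J"
    have bound: "(\<Sum>j<n. \<Sum>k<n. w j * w k * cv j k) / (T_sum \<eta> n)\<^sup>2 \<le>
        \<epsilon> + D * (2 * TJ * (1 / T_sum \<eta> n) + (2 * T + 1) * (1 / ((\<eta> n)\<^sup>2 * T_sum \<eta> n)))" if n: "0 < n" for n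
    proof -
      define Tn where "Tn = T_sum \<eta> n"
      have Tn: "0 < Tn" "(\<Sum>k<n. w k) = Tn" using T_sum_pos[OF n] by (auto simp: Tn_def T_sum_eq)
      have \<eta>n: "0 < \<eta> n" "\<eta> n \<le> 1" using n \<eta>_pos[of n] \<eta>_le_1[of n] by auto
      \<comment> \<open>Index distance that guarantees the elapsed time \<open>T\<close>, because
        every step up to \<open>n\<close> is at least \<open>\<eta> n\<close>.\<close>
      define R where "R = T / \<eta> n"
      have R: "0 \<le> R" using T \<eta>n by (simp add: R_def)
      \<comment> \<open>Indicators of early indices and of near-diagonal pairs; with them the case
        distinction becomes one bound valid for all pairs.\<close>
      define I where "I i = (if i < J then 1 else 0 :: real)" for i :: nat
      define N where "N j k = (if \<bar>real j - real k\<bar> < R then 1 else 0 :: real)" for j k :: nat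
      have cv_le: "cv j k \<le> \<epsilon> + D * (I j + I k + N j k)" if "j < n" "k < n" for j k
      proof -
        have *: "cv i l \<le> \<epsilon> + D * (I i + I l + N i l)" if il: "i \<le> l" "l < n" for i l
        proof (cases "i < J \<or> l < J \<or> \<bar>real i - real l\<bar> < R")
          case True
          then have "1 \<le> I i + I l + N i l" by (auto simp: I_def N_def)
          then have "D * 1 \<le> D * (I i + I l + N i l)" using D by (rule mult_left_mono)
          then show ?thesis using cvD[of i l] \<epsilon> by linarith
        next
          case False
          then have "R \<le> real (l - i)" using il by (simp add: of_nat_diff)
          then have "T \<le> real (l - i) * \<eta> n" using \<eta>n by (simp add: R_def divide_le_eq)
          then have "\<bar>cv i l\<bar> \<le> \<epsilon>" using False il by (intro dec) auto
          moreover have "0 \<le> D * (I i + I l + N i l)" using D by (auto simp: I_def N_def)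
          ultimately show ?thesis by linarith
        qed
        show ?thesis
        proof (cases "j \<le> k")
          case True
          then show ?thesis using *[of j k] that by simp
        next
          case False
          then show ?thesis using *[of k j] that by (simp add: cv_sym[of j k] N_def abs_minus_commute add_ac)
        qed
      qed
      have sI: "(\<Sum>k<n. w k * I k) \<le> TJ"
      proof -
        have "(\<Sum>k<n. w k * I k) \<le> (\<Sum>k<n + J. w k * I k)"
          using w_pos by (intro sum_mono2) (auto simp: I_def less_imp_le)
        also have "\<dots> = (\<Sum>k<J. w k)"
          by (rule sum.mono_neutral_cong_right) (auto simp: I_def)
        finally show ?thesis by (simp add: TJ_def T_sum_eq)
      qed
      have sN: "(\<Sum>k<n. w k * N j k) \<le> (2 * T + 1) / (\<eta> n)\<^sup>2" for j
      proof -
        have "(\<Sum>k<n. w k * N j k) \<le> (2 * R + 1) * inverse (\<eta> n)"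
          unfolding N_def using w_pos w_le \<eta>n R by (intro weighted_sum_near_diagonal) (auto intro: less_imp_le)
        also have "\<dots> = (2 * T + \<eta> n) / (\<eta> n)\<^sup>2" using \<eta>n by (simp add: R_def field_simps power2_eq_square)
        also have "\<dots> \<le> (2 * T + 1) / (\<eta> n)\<^sup>2" using \<eta>n by (intro divide_right_mono) auto
        finally show ?thesis .
      qed
      have "(\<Sum>j<n. \<Sum>k<n. w j * w k * cv j k) \<le> (\<Sum>j<n. \<Sum>k<n. w j * w k * (\<epsilon> + D * (I j + I k + N j k)))"
        using w_pos cv_le by (intro sum_mono mult_left_mono) (auto intro: less_imp_le)
      also have "\<dots> = (\<Sum>j<n. w j * (\<epsilon> * Tn + D * (I j * Tn + (\<Sum>k<n. w k * I k) + (\<Sum>k<n. w k * N j k))))"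
        unfolding Tn(2)[symmetric]
        by (simp add: sum_distrib_left sum.distrib algebra_simps)
      also have "\<dots> \<le> (\<Sum>j<n. w j * (\<epsilon> * Tn + D * (I j * Tn + TJ + (2 * T + 1) / (\<eta> n)\<^sup>2)))"
        using w_pos D sI sN by (intro sum_mono mult_left_mono add_left_mono add_mono) (auto intro: less_imp_le)
      also have "\<dots> = \<epsilon> * Tn * Tn + D * ((\<Sum>j<n. w j * I j) * Tn + TJ * Tn + (2 * T + 1) / (\<eta> n)\<^sup>2 * Tn)"
        unfolding Tn(2)[symmetric]
        by (simp add: sum_distrib_left sum_distrib_right sum.distrib algebra_simps add_divide_distrib sum_divide_distrib)
      also have "\<dots> \<le> \<epsilon> * Tn * Tn + D * (TJ * Tn + TJ * Tn + (2 * T + 1) / (\<eta> n)\<^sup>2 * Tn)"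
        using D sI Tn(1) by (intro add_left_mono mult_left_mono add_right_mono mult_right_mono) auto
      finally have "(\<Sum>j<n. \<Sum>k<n. w j * w k * cv j k) / Tn\<^sup>2 \<le>
          (\<epsilon> * Tn * Tn + D * (TJ * Tn + TJ * Tn + (2 * T + 1) / (\<eta> n)\<^sup>2 * Tn)) / Tn\<^sup>2"
        by (rule divide_right_mono) simp
      also have "\<dots> = \<epsilon> + D * (2 * TJ * (1 / Tn) + (2 * T + 1) * (1 / ((\<eta> n)\<^sup>2 * Tn)))"
        using Tn(1) \<eta>n by (simp add: field_simps power2_eq_square)
      finally show ?thesis by (simp add: Tn_def)
    qed
    have "(\<lambda>n. \<epsilon> + D * (2 * TJ * (1 / T_sum \<eta> n) + (2 * T + 1) * (1 / ((\<eta> n)\<^sup>2 * T_sum \<eta> n)))) \<longlonglongrightarrow>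
        \<epsilon> + D * (2 * TJ * 0 + (2 * T + 1) * 0)"
      by (intro tendsto_intros \<eta>_T_sq real_tendsto_divide_at_top[OF tendsto_const T_sum_at_top])
    then have "\<forall>\<^sub>F n in sequentially. \<epsilon> + D * (2 * TJ * (1 / T_sum \<eta> n) + (2 * T + 1) * (1 / ((\<eta> n)\<^sup>2 * T_sum \<eta> n))) < r"
      by (rule order_tendstoD(2)) (use r in \<open>simp add: \<epsilon>_def\<close>)
    then obtain m where m: "\<And>n. n \<ge> m \<Longrightarrow> \<epsilon> + D * (2 * TJ * (1 / T_sum \<eta> n) + (2 * T + 1) * (1 / ((\<eta> n)\<^sup>2 * T_sum \<eta> n))) < r"
      unfolding eventually_sequentially by blast
    show "\<exists>no. \<forall>n\<ge>no. norm ((\<integral>\<omega>. ((\<Sum>k<n. w k * (g (\<theta> k \<omega>) - integral\<^sup>L \<mu> g)) / T_sum \<eta> n)\<^sup>2 \<partial>M) - 0) < r"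
    proof (intro exI[of _ "Suc m"] allI impI)
      fix n assume n: "Suc m \<le> n"
      have "(\<integral>\<omega>. ((\<Sum>k<n. w k * G (\<theta> k \<omega>)) / T_sum \<eta> n)\<^sup>2 \<partial>M) < r"
        unfolding second using le_less_trans[OF bound m] n by simp
      moreover have "0 \<le> (\<integral>\<omega>. ((\<Sum>k<n. w k * G (\<theta> k \<omega>)) / T_sum \<eta> n)\<^sup>2 \<partial>M)"
        by (intro integral_nonneg_AE) auto
      ultimately show "norm ((\<integral>\<omega>. ((\<Sum>k<n. w k * (g (\<theta> k \<omega>) - integral\<^sup>L \<mu> g)) / T_sum \<eta> n)\<^sup>2 \<partial>M) - 0) < r"
        by (simp add: G_def)
    qed
  qed
qed

section \<open>From mean square to mean, and from bounded to unbounded functions\<close>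

lemma integral_abs_le_sqrt:
  fixes f :: "'a \<Rightarrow> real"
  assumes [measurable]: "f \<in> borel_measurable M" and f2: "integrable M (\<lambda>\<omega>. (f \<omega>)\<^sup>2)"
  shows "integrable M f" "(\<integral>\<omega>. \<bar>f \<omega>\<bar> \<partial>M) \<le> sqrt (\<integral>\<omega>. (f \<omega>)\<^sup>2 \<partial>M)"
proof -
  have "\<bar>f \<omega>\<bar> \<le> 1 + (f \<omega>)\<^sup>2" for \<omega>
    using sum_squares_bound[of 1 "\<bar>f \<omega>\<bar>"] by simp
  then show int: "integrable M f"
    using f2 by (intro Bochner_Integration.integrable_bound[of M "\<lambda>\<omega>. 1 + (f \<omega>)\<^sup>2" f]) (auto intro: order_trans[OF _ abs_ge_self])
  \<comment> \<open>Nonnegativity of the variance of \<open>\<bar>f\<bar>\<close> yields the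
    comparison of first and second moments.\<close>
  have "0 \<le> (\<integral>\<omega>. (\<bar>f \<omega>\<bar> - (\<integral>\<omega>. \<bar>f \<omega>\<bar> \<partial>M))\<^sup>2 \<partial>M)"
    by (intro integral_nonneg_AE) auto
  also have "\<dots> = (\<integral>\<omega>. (f \<omega>)\<^sup>2 \<partial>M) - (\<integral>\<omega>. \<bar>f \<omega>\<bar> \<partial>M)\<^sup>2"
    using int f2 by (subst variance_eq[of "\<lambda>\<omega>. \<bar>f \<omega>\<bar>"]) auto
  finally show "(\<integral>\<omega>. \<bar>f \<omega>\<bar> \<partial>M) \<le> sqrt (\<integral>\<omega>. (f \<omega>)\<^sup>2 \<partial>M)"
    by (simp add: real_le_rsqrt)
qed

lemma ergodic_bounded_L1:
  fixes g :: "real^'n \<Rightarrow> real"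
  assumes g: "continuous_on UNIV g" "\<And>x. \<bar>g x\<bar> \<le> c"
  shows "(\<lambda>n. \<integral>\<omega>. \<bar>(\<Sum>k<n. w k * g (\<theta> k \<omega>)) / T_sum \<eta> n - integral\<^sup>L \<mu> g\<bar> \<partial>M) \<longlonglongrightarrow> 0"
proof (rule Lim_null_comparison)
  have [measurable]: "g \<in> borel_measurable borel" by (rule borel_measurable_continuous_onI[OF g(1)])
  let ?A = "\<lambda>n \<omega>. (\<Sum>k<n. w k * (g (\<theta> k \<omega>) - integral\<^sup>L \<mu> g)) / T_sum \<eta> n"
  show "(\<lambda>n. sqrt (\<integral>\<omega>. (?A n \<omega>)\<^sup>2 \<partial>M)) \<longlonglongrightarrow> 0"
    using tendsto_real_sqrt[OF ergodic_bounded[OF g]] by simp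
  show "\<forall>\<^sub>F n in sequentially. norm (\<integral>\<omega>. \<bar>(\<Sum>k<n. w k * g (\<theta> k \<omega>)) / T_sum \<eta> n - integral\<^sup>L \<mu> g\<bar> \<partial>M)
      \<le> sqrt (\<integral>\<omega>. (?A n \<omega>)\<^sup>2 \<partial>M)"
    using eventually_gt_at_top[of 0]
  proof eventually_elim
    fix n :: nat assume n: "0 < n"
    have eq: "(\<Sum>k<n. w k * g (\<theta> k \<omega>)) / T_sum \<eta> n - integral\<^sup>L \<mu> g = ?A n \<omega>" for \<omega>
      using T_sum_pos[OF n]
      by (simp add: right_diff_distrib sum_subtractf sum_distrib_right[symmetric] T_sum_eq[symmetric] diff_divide_distrib)
    define c' where "c' = (\<Sum>k<n. w k * (c + \<bar>integral\<^sup>L \<mu> g\<bar>)) / T_sum \<eta> n"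
    have cb: "\<bar>?A n \<omega>\<bar> \<le> c'" for \<omega>
    proof -
      have "\<bar>\<Sum>k<n. w k * (g (\<theta> k \<omega>) - integral\<^sup>L \<mu> g)\<bar> \<le> (\<Sum>k<n. \<bar>w k * (g (\<theta> k \<omega>) - integral\<^sup>L \<mu> g)\<bar>)"
        by (rule sum_abs)
      also have "\<dots> \<le> (\<Sum>k<n. w k * (c + \<bar>integral\<^sup>L \<mu> g\<bar>))"
      proof (rule sum_mono)
        fix k
        have "\<bar>g (\<theta> k \<omega>) - integral\<^sup>L \<mu> g\<bar> \<le> c + \<bar>integral\<^sup>L \<mu> g\<bar>"
          using g(2)[of "\<theta> k \<omega>"] by linarith
        then show "\<bar>w k * (g (\<theta> k \<omega>) - integral\<^sup>L \<mu> g)\<bar> \<le> w k * (c + \<bar>integral\<^sup>L \<mu> g\<bar>)"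
          using w_pos[of k] by (simp add: abs_mult)
      qed
      finally show ?thesis using T_sum_pos[OF n] by (simp add: c'_def divide_right_mono)
    qed
    have "(?A n \<omega>)\<^sup>2 \<le> c'\<^sup>2" for \<omega>
      using power_mono[OF cb[of \<omega>] abs_ge_zero, of 2] by (simp only: power2_abs)
    then have "integrable M (\<lambda>\<omega>. (?A n \<omega>)\<^sup>2)"
      by (intro integrable_const_bound[of _ "c'\<^sup>2"]) auto
    then have "(\<integral>\<omega>. \<bar>?A n \<omega>\<bar> \<partial>M) \<le> sqrt (\<integral>\<omega>. (?A n \<omega>)\<^sup>2 \<partial>M)"
      by (intro integral_abs_le_sqrt(2)) auto
    moreover have "0 \<le> (\<integral>\<omega>. \<bar>?A n \<omega>\<bar> \<partial>M)" by (intro integral_nonneg_AE) auto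
    ultimately show "norm (\<integral>\<omega>. \<bar>(\<Sum>k<n. w k * g (\<theta> k \<omega>)) / T_sum \<eta> n - integral\<^sup>L \<mu> g\<bar> \<partial>M)
        \<le> sqrt (\<integral>\<omega>. (?A n \<omega>)\<^sup>2 \<partial>M)" unfolding eq by simp
  qed
qed

text \<open>Truncation at level \<open>m\<close>: uniform second moments along the chain bound the
  mean of the excess by \<open>C / m\<close>, whatever the index. Integrability under
  \<open>\<mu>\<close> also comes from the chain, whose averages of the truncated functions converge
  to their integrals under \<open>\<mu>\<close>.\<close>

lemma ergodic_L1:
  fixes f :: "real^'n \<Rightarrow> real"
  assumes f: "continuous_on UNIV f" "\<And>x. 0 \<le> f x"
    and f2: "\<And>k. integrable M (\<lambda>\<omega>. (f (\<theta> k \<omega>))\<^sup>2)" "\<And>k. (\<integral>\<omega>. (f (\<theta> k \<omega>))\<^sup>2 \<partial>M) \<le> C"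
  shows "integrable \<mu> f"
    and "(\<lambda>n. \<integral>\<omega>. \<bar>(\<Sum>k<n. w k * f (\<theta> k \<omega>)) / T_sum \<eta> n - integral\<^sup>L \<mu> f\<bar> \<partial>M) \<longlonglongrightarrow> 0"
proof -
  have [measurable]: "f \<in> borel_measurable borel" by (rule borel_measurable_continuous_onI[OF f(1)])
  define C1 where "C1 = sqrt C"
  have "0 \<le> (\<integral>\<omega>. (f (\<theta> 0 \<omega>))\<^sup>2 \<partial>M)" by (intro integral_nonneg_AE) auto
  then have C: "0 \<le> C" using f2(2)[of 0] by linarith
  have fi: "integrable M (\<lambda>\<omega>. f (\<theta> k \<omega>))" "(\<integral>\<omega>. f (\<theta> k \<omega>) \<partial>M) \<le> C1" for k
  proof -
    show "integrable M (\<lambda>\<omega>. f (\<theta> k \<omega>))"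
      by (rule integral_abs_le_sqrt(1)) (use f2(1) in auto)
    have "(\<integral>\<omega>. \<bar>f (\<theta> k \<omega>)\<bar> \<partial>M) \<le> sqrt (\<integral>\<omega>. (f (\<theta> k \<omega>))\<^sup>2 \<partial>M)"
      by (rule integral_abs_le_sqrt(2)) (use f2(1) in auto)
    also have "\<dots> \<le> C1" unfolding C1_def by (rule real_sqrt_le_mono[OF f2(2)])
    finally show "(\<integral>\<omega>. f (\<theta> k \<omega>) \<partial>M) \<le> C1" using f(2) by simp
  qed
  define fR where "fR m x = min (f x) (real m)" for m x
  have fRc: "continuous_on UNIV (fR m)" for m unfolding fR_def by (intro continuous_intros f)
  have fRb: "\<bar>fR m x\<bar> \<le> real m" "0 \<le> fR m x" "fR m x \<le> f x" for m x using f(2)[of x] by (auto simp: fR_def)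
  have [measurable]: "fR m \<in> borel_measurable borel" for m by (rule borel_measurable_continuous_onI[OF fRc])
  have fRi: "integrable \<mu> (fR m)" for m by (rule \<mu>.integrable_const_bound[of _ "real m"]) (auto simp: fRb(1))
  have fR\<theta>: "integrable M (\<lambda>\<omega>. fR m (\<theta> k \<omega>))" for m k by (rule integrable_const_bound[of _ "real m"]) (auto simp: fRb(1))
  define A where "A g n \<omega> = (\<Sum>k<n. w k * g (\<theta> k \<omega>)) / T_sum \<eta> n" for g :: "real^'n \<Rightarrow> real" and n \<omega>
  have A_int: "integrable M (A g n)" if "\<And>k. integrable M (\<lambda>\<omega>. g (\<theta> k \<omega>))" for g n
    unfolding A_def using that by (intro integrable_divide_zero Bochner_Integration.integrable_sum integrable_mult_right) auto
  have A_le: "(\<integral>\<omega>. A g n \<omega> \<partial>M) \<le> c" if "\<And>k. integrable M (\<lambda>\<omega>. g (\<theta> k \<omega>))" "\<And>k. (\<integral>\<omega>. g (\<theta> k \<omega>) \<partial>M) \<le> c" "0 < n" for g n c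
  proof -
    have "(\<integral>\<omega>. A g n \<omega> \<partial>M) = (\<Sum>k<n. w k * (\<integral>\<omega>. g (\<theta> k \<omega>) \<partial>M)) / T_sum \<eta> n"
      unfolding A_def using that(1) by simp
    also have "\<dots> \<le> (\<Sum>k<n. w k * c) / T_sum \<eta> n"
      using that(2) w_pos T_sum_nonneg by (intro divide_right_mono sum_mono mult_left_mono) (auto intro: less_imp_le)
    also have "\<dots> = c" using T_sum_pos[OF that(3)] by (simp add: sum_distrib_right[symmetric] T_sum_eq[symmetric])
    finally show ?thesis .
  qed
  have lim: "(\<lambda>n. \<integral>\<omega>. \<bar>A (fR m) n \<omega> - integral\<^sup>L \<mu> (fR m)\<bar> \<partial>M) \<longlonglongrightarrow> 0" for m
    unfolding A_def by (rule ergodic_bounded_L1[OF fRc fRb(1)])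
  \<comment> \<open>The averages have mean at most \<open>C1\<close> at every truncation level, and
    the bound passes to the limit.\<close>
  have fR_le: "integral\<^sup>L \<mu> (fR m) \<le> C1" for m
  proof (rule tendsto_lowerbound)
    show "(\<lambda>n. C1 + (\<integral>\<omega>. \<bar>A (fR m) n \<omega> - integral\<^sup>L \<mu> (fR m)\<bar> \<partial>M)) \<longlonglongrightarrow> C1"
      using tendsto_add[OF tendsto_const lim[of m], of C1] by simp
    show "\<forall>\<^sub>F n in sequentially. integral\<^sup>L \<mu> (fR m) \<le> C1 + (\<integral>\<omega>. \<bar>A (fR m) n \<omega> - integral\<^sup>L \<mu> (fR m)\<bar> \<partial>M)"
      using eventually_gt_at_top[of 0]
    proof eventually_elim
      fix n :: nat assume n: "0 < n"
      have Ai: "integrable M (A (fR m) n)" by (rule A_int) (rule fR\<theta>)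
      have "(\<integral>\<omega>. A (fR m) n \<omega> - integral\<^sup>L \<mu> (fR m) \<partial>M) = (\<integral>\<omega>. A (fR m) n \<omega> \<partial>M) - integral\<^sup>L \<mu> (fR m)"
        using Ai prob_space by simp
      moreover have "(\<integral>\<omega>. A (fR m) n \<omega> \<partial>M) \<le> C1"
      proof (rule A_le[OF fR\<theta> _ n])
        show "(\<integral>\<omega>. fR m (\<theta> k \<omega>) \<partial>M) \<le> C1" for k
          using fi[of k] fRb(3) by (intro order_trans[OF integral_mono[OF fR\<theta>] fi(2)]) auto
      qed
      moreover have "- (\<integral>\<omega>. A (fR m) n \<omega> - integral\<^sup>L \<mu> (fR m) \<partial>M) \<le> (\<integral>\<omega>. \<bar>A (fR m) n \<omega> - integral\<^sup>L \<mu> (fR m)\<bar> \<partial>M)"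
        using integral_abs_bound[of M "\<lambda>\<omega>. A (fR m) n \<omega> - integral\<^sup>L \<mu> (fR m)"] by linarith
      ultimately show "integral\<^sup>L \<mu> (fR m) \<le> C1 + (\<integral>\<omega>. \<bar>A (fR m) n \<omega> - integral\<^sup>L \<mu> (fR m)\<bar> \<partial>M)" by linarith
    qed
  qed simp
  have fRlim: "(\<lambda>m. fR m x) \<longlonglongrightarrow> f x" for x
  proof (rule tendsto_eventually)
    obtain m where "f x \<le> real m" using real_arch_simple by blast
    then show "\<forall>\<^sub>F m in sequentially. fR m x = f x"
      by (intro eventually_sequentiallyI[of m]) (simp add: fR_def min_def)
  qed
  show f\<mu>: "integrable \<mu> f"
  proof (rule integrableI_nonneg)
    \<comment> \<open>Fatou's lemma along the truncation levels carries the bound \<open>C1\<close>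
      over to \<open>f\<close>.\<close>
    have "(\<integral>\<^sup>+ x. ennreal (f x) \<partial>\<mu>) = (\<integral>\<^sup>+ x. liminf (\<lambda>m. ennreal (fR m x)) \<partial>\<mu>)"
    proof (rule nn_integral_cong)
      fix x
      have "(\<lambda>m. ennreal (fR m x)) \<longlonglongrightarrow> ennreal (f x)" by (rule tendsto_ennrealI[OF fRlim])
      then show "ennreal (f x) = liminf (\<lambda>m. ennreal (fR m x))"
        using lim_imp_Liminf[OF sequentially_bot] by metis
    qed
    also have "\<dots> \<le> liminf (\<lambda>m. (\<integral>\<^sup>+ x. ennreal (fR m x) \<partial>\<mu>))"
      by (rule nn_integral_liminf) measurable
    also have "\<dots> \<le> ennreal C1"
    proof (rule order_trans[OF Liminf_le_Limsup[OF sequentially_bot] Limsup_bounded])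
      have "(\<integral>\<^sup>+ x. ennreal (fR m x) \<partial>\<mu>) \<le> ennreal C1" for m
        using fRi[of m] fRb(2) fR_le by (subst nn_integral_eq_integral) (auto intro: ennreal_leI)
      then show "\<forall>\<^sub>F m in sequentially. (\<integral>\<^sup>+ x. ennreal (fR m x) \<partial>\<mu>) \<le> ennreal C1" by simp
    qed
    finally show "(\<integral>\<^sup>+ x. ennreal (f x) \<partial>\<mu>) < \<infinity>" by (rule le_less_trans) simp
  qed (use f(2) in auto)
  have \<mu>lim: "(\<lambda>m. integral\<^sup>L \<mu> (fR m)) \<longlonglongrightarrow> integral\<^sup>L \<mu> f"
    by (rule integral_dominated_convergence[where w = f]) (use f\<mu> fRlim fRb f(2) in auto)
  show "(\<lambda>n. \<integral>\<omega>. \<bar>(\<Sum>k<n. w k * f (\<theta> k \<omega>)) / T_sum \<eta> n - integral\<^sup>L \<mu> f\<bar> \<partial>M) \<longlonglongrightarrow> 0"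
    unfolding A_def[symmetric]
  proof (rule LIMSEQ_I)
    fix r :: real assume r: "0 < r"
    have "(\<lambda>m. C / real m + \<bar>integral\<^sup>L \<mu> (fR m) - integral\<^sup>L \<mu> f\<bar>) \<longlonglongrightarrow> 0 + \<bar>integral\<^sup>L \<mu> f - integral\<^sup>L \<mu> f\<bar>"
      by (intro tendsto_intros \<mu>lim lim_const_over_n)
    then have "\<forall>\<^sub>F m in sequentially. C / real m + \<bar>integral\<^sup>L \<mu> (fR m) - integral\<^sup>L \<mu> f\<bar> < r / 2"
      by (rule order_tendstoD(2)) (use r in simp)
    from eventually_conj[OF this eventually_gt_at_top[of 0]]
    obtain m where m: "C / real m + \<bar>integral\<^sup>L \<mu> (fR m) - integral\<^sup>L \<mu> f\<bar> < r / 2" "0 < m"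
      using eventually_happens'[OF sequentially_bot] by blast
    obtain n0 where n0: "\<And>n. n \<ge> n0 \<Longrightarrow> \<bar>\<integral>\<omega>. \<bar>A (fR m) n \<omega> - integral\<^sup>L \<mu> (fR m)\<bar> \<partial>M\<bar> < r / 2"
      using LIMSEQ_D[OF lim[of m], of "r / 2"] r by auto
    show "\<exists>no. \<forall>n\<ge>no. norm ((\<integral>\<omega>. \<bar>A f n \<omega> - integral\<^sup>L \<mu> f\<bar> \<partial>M) - 0) < r"
    proof (intro exI[of _ "Suc n0"] allI impI)
      fix n assume n: "Suc n0 \<le> n"
      define d where "d = (\<lambda>x. f x - fR m x)"
      \<comment> \<open>Above the level \<open>m\<close> the factor \<open>f x / m\<close> is at
        least 1, so the excess is at most the square divided by \<open>m\<close>; below it the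
        excess is 0.\<close>
      have d0: "0 \<le> d x" and d2: "d x \<le> (f x)\<^sup>2 / real m" for x
      proof -
        show "0 \<le> d x" using fRb(3)[of m x] by (simp add: d_def)
        show "d x \<le> (f x)\<^sup>2 / real m"
        proof (cases "f x \<le> real m")
          case True
          then show ?thesis by (simp add: d_def fR_def)
        next
          case False
          have "d x \<le> f x" using fRb(2)[of m x] by (simp add: d_def)
          also have "f x * real m \<le> f x * f x" using False f(2)[of x] by (intro mult_left_mono) auto
          then have "f x \<le> (f x)\<^sup>2 / real m" using m(2) by (simp add: le_divide_eq power2_eq_square)
          finally show ?thesis .
        qed
      qed
      have di: "integrable M (\<lambda>\<omega>. d (\<theta> k \<omega>))" for k unfolding d_def using fi(1)[of k] fR\<theta>[of m k] by auto
      have dC: "(\<integral>\<omega>. d (\<theta> k \<omega>) \<partial>M) \<le> C / real m" for k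
      proof -
        have "(\<integral>\<omega>. d (\<theta> k \<omega>) \<partial>M) \<le> (\<integral>\<omega>. (f (\<theta> k \<omega>))\<^sup>2 / real m \<partial>M)"
          using di f2(1)[of k] d2 by (intro integral_mono) auto
        also have "\<dots> \<le> C / real m" using f2(2)[of k] by (simp add: divide_right_mono)
        finally show ?thesis .
      qed
      have Ad0: "0 \<le> A d n \<omega>" for \<omega>
        unfolding A_def using d0 w_pos T_sum_nonneg
        by (intro divide_nonneg_nonneg sum_nonneg mult_nonneg_nonneg) (auto intro: less_imp_le)
      have Afd: "A f n \<omega> = A (fR m) n \<omega> + A d n \<omega>" for \<omega>
        by (simp add: A_def d_def right_diff_distrib sum_subtractf diff_divide_distrib)
      have Ai: "integrable M (A f n)" "integrable M (A (fR m) n)" "integrable M (A d n)"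
        by (rule A_int, rule fi(1) fR\<theta> di)+
      let ?q = "\<bar>integral\<^sup>L \<mu> (fR m) - integral\<^sup>L \<mu> f\<bar>"
      have "(\<integral>\<omega>. \<bar>A f n \<omega> - integral\<^sup>L \<mu> f\<bar> \<partial>M) \<le>
          (\<integral>\<omega>. \<bar>A (fR m) n \<omega> - integral\<^sup>L \<mu> (fR m)\<bar> + A d n \<omega> + ?q \<partial>M)"
      proof (rule integral_mono)
        show "\<bar>A f n \<omega> - integral\<^sup>L \<mu> f\<bar> \<le> \<bar>A (fR m) n \<omega> - integral\<^sup>L \<mu> (fR m)\<bar> + A d n \<omega> + ?q" for \<omega>
          using Ad0[of \<omega>] unfolding Afd by linarith
      qed (use Ai in auto)
      also have "\<dots> = (\<integral>\<omega>. \<bar>A (fR m) n \<omega> - integral\<^sup>L \<mu> (fR m)\<bar> \<partial>M) + (\<integral>\<omega>. A d n \<omega> \<partial>M) + ?q"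
        using Ai prob_space by simp
      also have "\<dots> < r / 2 + r / 2"
        using n0[of n] A_le[OF di dC, of n] n m by linarith
      finally have "(\<integral>\<omega>. \<bar>A f n \<omega> - integral\<^sup>L \<mu> f\<bar> \<partial>M) < r" by simp
      moreover have "0 \<le> (\<integral>\<omega>. \<bar>A f n \<omega> - integral\<^sup>L \<mu> f\<bar> \<partial>M)" by (intro integral_nonneg_AE) auto
      ultimately show "norm ((\<integral>\<omega>. \<bar>A f n \<omega> - integral\<^sup>L \<mu> f\<bar> \<partial>M) - 0) < r" by simp
    qed
  qed
qed

end


section \<open>Expansion by the Poisson equation\<close>

lemma norm_matrix_vector_mult_le:
  fixes A :: "real^'n^'m"
  shows "norm (A *v x) \<le> norm A * norm x"
proof -
  have "norm (A *v x) = L2_set (\<lambda>i. \<bar>A $ i \<bullet> x\<bar>) UNIV"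
    by (simp add: norm_vec_def matrix_vector_mul_component)
  also have "\<dots> \<le> L2_set (\<lambda>i. norm (A $ i) * norm x) UNIV"
    by (rule L2_set_mono) (auto simp: Cauchy_Schwarz_ineq2)
  also have "\<dots> = norm A * norm x"
    by (simp add: norm_vec_def[of A] L2_set_left_distrib)
  finally show ?thesis .
qed

lemma inner_matrix_vector_le:
  fixes A :: "real^'n^'n"
  shows "\<bar>x \<bullet> (A *v y)\<bar> \<le> norm A * (norm x * norm y)"
proof -
  have "\<bar>x \<bullet> (A *v y)\<bar> \<le> norm x * norm (A *v y)" by (rule Cauchy_Schwarz_ineq2)
  also have "\<dots> \<le> norm x * (norm A * norm y)"
    by (intro mult_left_mono norm_matrix_vector_mult_le) auto
  finally show ?thesis by (simp add: mult_ac)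
qed

text \<open>\<open>grad\<close> is a definite description, so a gradient has to be exhibited: a
  linear functional is the inner product with the vector of its values on the basis.\<close>

lemma has_derivative_grad:
  fixes f :: "real^'n \<Rightarrow> real"
  assumes "f differentiable (at x)"
  shows "(f has_derivative (\<lambda>y. y \<bullet> grad f x)) (at x)"
proof -
  obtain f' where f': "(f has_derivative f') (at x)"
    using assms by (auto simp: differentiable_def)
  define D where "D = (\<Sum>b\<in>Basis. f' b *\<^sub>R b)"
  have "f' y = y \<bullet> D" for y
  proof -
    have "f' y = f' (\<Sum>b\<in>Basis. (y \<bullet> b) *\<^sub>R b)" by (simp add: euclidean_representation)
    also have "\<dots> = (\<Sum>b\<in>Basis. (y \<bullet> b) * f' b)"
      using has_derivative_linear[OF f'] by (simp add: linear_sum linear_scale)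
    also have "\<dots> = y \<bullet> D" by (simp add: D_def inner_sum_right mult.commute)
    finally show ?thesis .
  qed
  then have "f' = (\<lambda>y. y \<bullet> D)" by auto
  then have "GDERIV f x :> D" using f' by (simp add: gderiv_def)
  then show ?thesis using grad_eqI by (metis gderiv_def)
qed

text \<open>One-dimensional Taylor formula along the segment from \<open>x\<close> to
  \<open>x + d\<close>; the Lagrange form puts the Hessian at an intermediate point, where its local
  Lipschitz bound can be used.\<close>

lemma C2_taylor:
  fixes f :: "real^'n \<Rightarrow> real"
  assumes "C2 f"
  shows "\<exists>t. 0 < t \<and> t < 1 \<and> f (x + d) = f x + d \<bullet> grad f x + d \<bullet> (hess f (x + t *\<^sub>R d) *v d) / 2"
proof -
  have f: "(f has_derivative (\<lambda>y. y \<bullet> grad f x)) (at x)" for x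
    using assms by (intro has_derivative_grad) (simp add: C2_def)
  have g: "(grad f has_derivative (\<lambda>y. hess f x *v y)) (at x)" for x
    using assms unfolding hess_def by (simp add: C2_def jacobian_works[symmetric])
  define u0 where "u0 t = f (x + t *\<^sub>R d)" for t
  define u1 where "u1 t = d \<bullet> grad f (x + t *\<^sub>R d)" for t
  define u2 where "u2 t = d \<bullet> (hess f (x + t *\<^sub>R d) *v d)" for t
  have line: "((\<lambda>t. x + t *\<^sub>R d) has_derivative (\<lambda>s. s *\<^sub>R d)) (at t)" for t
    by (auto intro!: derivative_eq_intros)
  have d0: "DERIV u0 t :> u1 t" for t
  proof -
    have "((\<lambda>t. f (x + t *\<^sub>R d)) has_derivative (\<lambda>s. (s *\<^sub>R d) \<bullet> grad f (x + t *\<^sub>R d))) (at t)"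
      by (rule has_derivative_compose[OF line f])
    then show ?thesis by (simp add: has_field_derivative_def u0_def u1_def mult.commute[of _ "d \<bullet> _"] cong: if_cong) (simp add: u0_def[abs_def] fun_eq_iff)
  qed
  have d1: "DERIV u1 t :> u2 t" for t
  proof -
    have "((\<lambda>t. grad f (x + t *\<^sub>R d)) has_derivative (\<lambda>s. hess f (x + t *\<^sub>R d) *v (s *\<^sub>R d))) (at t)"
      by (rule has_derivative_compose[OF line g])
    then have "((\<lambda>t. d \<bullet> grad f (x + t *\<^sub>R d)) has_derivative (\<lambda>s. d \<bullet> (hess f (x + t *\<^sub>R d) *v (s *\<^sub>R d)))) (at t)"
      by (rule has_derivative_inner_right)
    moreover have "(\<lambda>s. d \<bullet> (hess f (x + t *\<^sub>R d) *v (s *\<^sub>R d))) = (*) (u2 t)"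
      by (auto simp: u2_def linear_scale[OF matrix_vector_mul_linear] mult.commute)
    ultimately show ?thesis by (simp add: has_field_derivative_def u1_def[abs_def])
  qed
  define U where "U m = (if m = 0 then u0 else if m = 1 then u1 else u2)" for m :: nat
  have "\<exists>t. 0 < t \<and> t < 1 \<and> u0 1 = (\<Sum>m<2. U m 0 / fact m * 1 ^ m) + U 2 t / fact 2 * 1 ^ 2"
  proof (rule Maclaurin)
    show "\<forall>m t. m < 2 \<and> 0 \<le> t \<and> t \<le> 1 \<longrightarrow> DERIV (U m) t :> U (Suc m) t"
      using d0 d1 by (auto simp: U_def less_2_cases_iff)
  qed (auto simp: U_def)
  then show ?thesis
    by (auto simp: U_def u0_def u1_def u2_def numeral_2_eq_2)
qed

lemma hs_inner_expand: "hs_inner (\<sigma> ** transpose \<sigma>) A = (\<Sum>i\<in>UNIV. (transpose \<sigma> ** A ** \<sigma>) $ i $ i)"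
  for \<sigma> A :: "real^'n^'n"
proof -
  have "hs_inner (\<sigma> ** transpose \<sigma>) A = trace (\<sigma> ** (transpose \<sigma> ** A))"
    by (simp add: hs_inner_def matrix_transpose_mul matrix_mul_assoc)
  also have "\<dots> = trace (transpose \<sigma> ** A ** \<sigma>)" by (rule trace_mul_sym)
  finally show ?thesis by (simp add: trace_def)
qed

text \<open>Taking the mean keeps the diagonal of
  \<open>transpose \<sigma> ** A ** \<sigma>\<close>; when \<open>A\<close> is the Hessian this is
  twice the second-order part of the generator.\<close>

lemma integral_gauss_quadratic_form:
  fixes \<sigma> A :: "real^'n^'n"
  shows "integrable gauss (\<lambda>z. (\<sigma> *v z) \<bullet> (A *v (\<sigma> *v z)))"
    and "(\<integral>z. (\<sigma> *v z) \<bullet> (A *v (\<sigma> *v z)) \<partial>gauss) = hs_inner (\<sigma> ** transpose \<sigma>) A"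
proof -
  define C where "C = transpose \<sigma> ** A ** \<sigma>"
  have eq: "(\<sigma> *v z) \<bullet> (A *v (\<sigma> *v z)) = (\<Sum>i\<in>UNIV. \<Sum>j\<in>UNIV. C $ i $ j * (z $ i * z $ j))" for z
  proof -
    have "(\<sigma> *v z) \<bullet> (A *v (\<sigma> *v z)) = z \<bullet> (C *v z)"
      unfolding C_def
      by (metis dot_lmul_matrix inner_commute matrix_vector_mul_assoc transpose_matrix_vector)
    also have "\<dots> = (\<Sum>i\<in>UNIV. \<Sum>j\<in>UNIV. C $ i $ j * (z $ i * z $ j))"
      by (simp add: inner_vec_def matrix_vector_mult_def sum_distrib_left mult_ac)
    finally show ?thesis .
  qed
  show "integrable gauss (\<lambda>z. (\<sigma> *v z) \<bullet> (A *v (\<sigma> *v z)))"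
    unfolding eq by (intro Bochner_Integration.integrable_sum integrable_mult_right gauss_coord)
  have "(\<integral>z. (\<sigma> *v z) \<bullet> (A *v (\<sigma> *v z)) \<partial>gauss) = (\<Sum>i\<in>UNIV. \<Sum>j\<in>UNIV. C $ i $ j * (if i = j then 1 else 0))"
    unfolding eq by (simp add: gauss_coord)
  also have "\<dots> = hs_inner (\<sigma> ** transpose \<sigma>) A"
    unfolding hs_inner_expand C_def[symmetric] by (simp add: if_distrib cong: if_cong)
  finally show "(\<integral>z. (\<sigma> *v z) \<bullet> (A *v (\<sigma> *v z)) \<partial>gauss) = hs_inner (\<sigma> ** transpose \<sigma>) A" .
qed

lemma one_plus_power_le:
  fixes r :: real
  assumes "0 \<le> r" "1 \<le> k" "k \<le> m"
  shows "1 + r ^ k \<le> (1 + r) ^ m"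
proof -
  obtain q where q: "k = Suc q" using assms(2) by (cases k) auto
  have "1 + r ^ Suc q \<le> (1 + r) ^ Suc q"
  proof (induction q)
    case (Suc q)
    have "1 + r ^ Suc (Suc q) \<le> (1 + r) * (1 + r ^ Suc q)" using assms(1) by (simp add: algebra_simps)
    also have "\<dots> \<le> (1 + r) * (1 + r) ^ Suc q" using Suc assms(1) by (intro mult_left_mono) auto
    finally show ?case by simp
  qed simp
  also have "\<dots> \<le> (1 + r) ^ m" using assms q by (intro power_increasing) auto
  finally show ?thesis by (simp add: q)
qed

section \<open>Size of the terms in the expansion of one step\<close>

locale em_poisson = em_full b \<sigma> L K1 K2 W B X \<mu> M \<xi> \<eta> x0
  for b :: "real^'n \<Rightarrow> real^'n" and \<sigma> L K1 K2 and W :: "'w measure" and B X \<mu>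
    and M :: "'a measure" and \<xi> \<eta> x0 +
  fixes h \<phi> :: "real^'n \<Rightarrow> real"
  assumes h_cont: "continuous_on UNIV h"
    and poisson: "poisson_solution b \<sigma> \<mu> h \<phi>"
begin

definition S where "S = onorm ((*v) \<sigma>)"

lemma S: "0 \<le> S" "norm (\<sigma> *v z) \<le> S * norm z"
  by (auto simp: S_def onorm_\<sigma>_nonneg norm_\<sigma>_le)

lemma \<phi>_C2: "C2 \<phi>"
  using poisson by (simp add: poisson_solution_def)

lemma \<phi>_cont: "continuous_on UNIV \<phi>" "continuous_on UNIV (grad \<phi>)" "continuous_on UNIV (hess \<phi>)"
  using \<phi>_C2 by (auto simp: C2_def continuous_on_eq_continuous_at intro!: differentiable_imp_continuous_within)

lemma \<phi>_measurable [measurable]: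
  "\<phi> \<in> borel_measurable borel" "grad \<phi> \<in> borel_measurable borel" "hess \<phi> \<in> borel_measurable borel"
  "h \<in> borel_measurable borel"
  by (intro borel_measurable_continuous_onI \<phi>_cont h_cont)+

lemma measurable_hess_mult [measurable (raw)]:
  assumes [measurable]: "f \<in> borel_measurable N" "g \<in> borel_measurable N"
  shows "(\<lambda>x. hess \<phi> (f x) *v g x) \<in> borel_measurable N"
proof -
  have "continuous_on UNIV (\<lambda>p. hess \<phi> (fst p) *v snd p)"
    unfolding matrix_vector_mult_def
    by (intro continuous_on_vec_lambda continuous_on_sum continuous_on_mult continuous_on_component
        continuous_on_compose2[OF \<phi>_cont(3)] continuous_on_fst continuous_on_snd continuous_on_id) auto
  then have "(\<lambda>p. hess \<phi> (fst p) *v snd p) \<in> borel_measurable borel"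
    by (rule borel_measurable_continuous_onI)
  then have "(\<lambda>p. hess \<phi> (fst p) *v snd p) \<in> borel_measurable (borel \<Otimes>\<^sub>M borel)"
    by (simp add: borel_prod)
  from measurable_compose[OF measurable_Pair[OF assms] this] show ?thesis by simp
qed

text \<open>The known bounds in terms of powers of \<open>1 + norm x\<close>, which can be merged by
  raising exponents, and with the Lipschitz bound multiplied out so that it includes
  \<open>y = x\<close>.\<close>

lemma \<phi>_growth:
  "\<exists>C>0. \<forall>x. norm (grad \<phi> x) \<le> C * (1 + norm x) ^ 3 \<and>
    norm (hess \<phi> x) \<le> C * (1 + norm x) ^ 4 \<and> \<bar>\<phi> x\<bar> \<le> C * (1 + norm x) ^ 2 \<and>
    (\<forall>y. norm (y - x) \<le> 1 \<longrightarrow> norm (hess \<phi> y - hess \<phi> x) \<le> C * (1 + norm x) ^ 5 * norm (y - x))"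
proof -
  obtain C where C: "0 < C" "\<And>x. \<bar>\<phi> x\<bar> \<le> C * (1 + norm x ^ 2) \<and> norm (grad \<phi> x) \<le> C * (1 + norm x ^ 3) \<and>
      norm (hess \<phi> x) \<le> C * (1 + norm x ^ 4) \<and>
      (\<forall>y. 0 < norm (y - x) \<and> norm (y - x) \<le> 1 \<longrightarrow>
        norm (hess \<phi> x - hess \<phi> y) / norm (x - y) \<le> C * (1 + norm x ^ 5))"
    using poisson unfolding poisson_solution_def by blast
  have p: "C * (1 + norm x ^ k) \<le> C * (1 + norm x) ^ m" if "1 \<le> k" "k \<le> m" for x :: "real^'n" and k m
    using one_plus_power_le[of "norm x" k m] that C(1) by simp
  have "norm (hess \<phi> y - hess \<phi> x) \<le> C * (1 + norm x) ^ 5 * norm (y - x)" if "norm (y - x) \<le> 1" for x y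
  proof (cases "y = x")
    case False
    then have "norm (hess \<phi> x - hess \<phi> y) / norm (x - y) \<le> C * (1 + norm x ^ 5)" using C(2)[of x] that by auto
    then have "norm (hess \<phi> x - hess \<phi> y) / norm (x - y) \<le> C * (1 + norm x) ^ 5" using p[of 5 5 x] by linarith
    then show ?thesis using False by (simp add: divide_le_eq norm_minus_commute)
  qed simp
  then show ?thesis
    using C p by (intro exI[of _ C]) (auto intro!: order_trans[OF _ p])
qed

text \<open>The second-order noise term of the expansion minus its Gaussian mean, per unit of step
  size: a martingale difference along the chain.\<close>

definition Q :: "real^'n \<Rightarrow> real^'n \<Rightarrow> real" where
  "Q x z = ((\<sigma> *v z) \<bullet> (hess \<phi> x *v (\<sigma> *v z)) - hs_inner (\<sigma> ** transpose \<sigma>) (hess \<phi> x)) / 2"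

text \<open>Defined as what is left, so that the expansion of one step is an identity and only the
  size of this term has to be shown. By the Poisson equation the term with \<open>h\<close> stands
  for the drift and the mean second-order contribution.\<close>

definition Rem :: "real \<Rightarrow> real^'n \<Rightarrow> real^'n \<Rightarrow> real" where
  "Rem e x z = \<phi> (em_step e x z) - \<phi> x - sqrt e * ((transpose \<sigma> *v grad \<phi> x) \<bullet> z)
    - e * (h x - integral\<^sup>L \<mu> h) - e * Q x z"

lemma Q_mean: "(\<integral>z. Q x z \<partial>gauss) = 0"
  unfolding Q_def using integral_gauss_quadratic_form[of \<sigma> "hess \<phi> x"] by simp

lemma Q_measurable [measurable (raw)]:
  assumes [measurable]: "f \<in> borel_measurable N" "g \<in> borel_measurable N"
  shows "(\<lambda>w. Q (f w) (g w)) \<in> borel_measurable N"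
proof -
  \<comment> \<open>With the trace written as a Gaussian integral, its measurability in
    \<open>x\<close> is that of a parameter integral.\<close>
  have "Q x z = ((\<sigma> *v z) \<bullet> (hess \<phi> x *v (\<sigma> *v z)) - (\<integral>z. (\<sigma> *v z) \<bullet> (hess \<phi> x *v (\<sigma> *v z)) \<partial>gauss)) / 2" for x z
    by (simp add: Q_def integral_gauss_quadratic_form)
  then show ?thesis by (simp only:) measurable
qed

lemma Q_growth: "\<exists>C\<ge>0. \<forall>x z. \<bar>Q x z\<bar> \<le> C * (1 + norm x) ^ 4 * (1 + norm z) ^ 2"
proof -
  obtain C where C: "0 < C" "\<And>x. norm (hess \<phi> x) \<le> C * (1 + norm x) ^ 4" using \<phi>_growth by blast
  define \<kappa> where "\<kappa> = (\<integral>z. norm (z :: real^'n) ^ 2 \<partial>gauss)"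
  have \<kappa>: "0 \<le> \<kappa>" unfolding \<kappa>_def by (intro integral_nonneg_AE) auto
  have q: "\<bar>(\<sigma> *v z) \<bullet> (hess \<phi> x *v (\<sigma> *v z))\<bar> \<le> norm (hess \<phi> x) * S\<^sup>2 * norm z ^ 2" for x z
  proof -
    have "norm (\<sigma> *v z) * norm (\<sigma> *v z) \<le> (S * norm z) * (S * norm z)"
      using S by (intro mult_mono) auto
    then have "norm (hess \<phi> x) * (norm (\<sigma> *v z) * norm (\<sigma> *v z)) \<le> norm (hess \<phi> x) * ((S * norm z) * (S * norm z))"
      by (intro mult_left_mono) auto
    also have "\<dots> = norm (hess \<phi> x) * S\<^sup>2 * norm z ^ 2" by (simp add: power2_eq_square)
    finally show ?thesis
      by (rule order_trans[OF inner_matrix_vector_le])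
  qed
  have hs: "\<bar>hs_inner (\<sigma> ** transpose \<sigma>) (hess \<phi> x)\<bar> \<le> norm (hess \<phi> x) * S\<^sup>2 * \<kappa>" for x
  proof -
    have "\<bar>\<integral>z. (\<sigma> *v z) \<bullet> (hess \<phi> x *v (\<sigma> *v z)) \<partial>gauss\<bar> \<le> (\<integral>z. \<bar>(\<sigma> *v z) \<bullet> (hess \<phi> x *v (\<sigma> *v z))\<bar> \<partial>gauss)"
      by (rule integral_abs_bound)
    also have "\<dots> \<le> (\<integral>z. norm (hess \<phi> x) * S\<^sup>2 * norm (z :: real^'n) ^ 2 \<partial>gauss)"
      by (intro integral_mono q) (auto intro!: integrable_abs integral_gauss_quadratic_form)
    finally show ?thesis by (simp add: integral_gauss_quadratic_form \<kappa>_def)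
  qed
  have "\<bar>Q x z\<bar> \<le> C * S\<^sup>2 * (1 + \<kappa>) * (1 + norm x) ^ 4 * (1 + norm z) ^ 2" for x z
  proof -
    have "\<bar>Q x z\<bar> \<le> norm (hess \<phi> x) * S\<^sup>2 * norm z ^ 2 + norm (hess \<phi> x) * S\<^sup>2 * \<kappa>"
      unfolding Q_def using q[of z x] hs[of x] by (simp add: abs_le_iff)
    also have "\<dots> = norm (hess \<phi> x) * (S\<^sup>2 * (norm z ^ 2 + \<kappa>))" by (simp add: algebra_simps)
    also have "\<dots> \<le> (C * (1 + norm x) ^ 4) * (S\<^sup>2 * ((1 + \<kappa>) * (1 + norm z) ^ 2))"
    proof (intro mult_mono C)
      have "norm z ^ 2 \<le> (1 + norm z) ^ 2" by (intro power_mono) auto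
      moreover have "\<kappa> * 1 \<le> \<kappa> * (1 + norm z) ^ 2" using \<kappa> by (intro mult_left_mono) auto
      ultimately show "norm z ^ 2 + \<kappa> \<le> (1 + \<kappa>) * (1 + norm z) ^ 2"
        unfolding distrib_right mult_1_left mult_1_right by linarith
    qed (use \<kappa> C in auto)
    finally show ?thesis by (simp add: mult_ac)
  qed
  moreover have "0 \<le> C * S\<^sup>2 * (1 + \<kappa>)" using C \<kappa> by auto
  ultimately show ?thesis by blast
qed

text \<open>For short \<open>d\<close> the local Lipschitz bound of the Hessian supplies the third
  power. For \<open>norm d > 1\<close> no cancellation is required: each term is bounded by its
  growth, with powers of \<open>norm d\<close> at most 3.\<close>

lemma taylor_remainder:
  "\<exists>C\<ge>0. \<forall>x d. \<bar>\<phi> (x + d) - \<phi> x - d \<bullet> grad \<phi> x - d \<bullet> (hess \<phi> x *v d) / 2\<bar> \<le>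
    C * (1 + norm x) ^ 5 * norm d ^ 3"
proof -
  obtain C where C: "0 < C" "\<And>x. \<bar>\<phi> x\<bar> \<le> C * (1 + norm x) ^ 2" "\<And>x. norm (grad \<phi> x) \<le> C * (1 + norm x) ^ 3"
    "\<And>x. norm (hess \<phi> x) \<le> C * (1 + norm x) ^ 4"
    "\<And>x y. norm (y - x) \<le> 1 \<Longrightarrow> norm (hess \<phi> y - hess \<phi> x) \<le> C * (1 + norm x) ^ 5 * norm (y - x)"
    using \<phi>_growth by blast
  have "\<bar>\<phi> (x + d) - \<phi> x - d \<bullet> grad \<phi> x - d \<bullet> (hess \<phi> x *v d) / 2\<bar> \<le>
    7 * C * (1 + norm x) ^ 5 * norm d ^ 3" for x d
  proof (cases "norm d \<le> 1")
    case True
    obtain t where t: "0 < t" "t < 1"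
      and eq: "\<phi> (x + d) = \<phi> x + d \<bullet> grad \<phi> x + d \<bullet> (hess \<phi> (x + t *\<^sub>R d) *v d) / 2"
      using C2_taylor[OF \<phi>_C2, of x d] by blast
    have "\<phi> (x + d) - \<phi> x - d \<bullet> grad \<phi> x - d \<bullet> (hess \<phi> x *v d) / 2 =
        d \<bullet> ((hess \<phi> (x + t *\<^sub>R d) - hess \<phi> x) *v d) / 2"
      unfolding eq matrix_vector_mult_diff_rdistrib inner_diff_right by (simp add: diff_divide_distrib)
    then have "\<bar>\<phi> (x + d) - \<phi> x - d \<bullet> grad \<phi> x - d \<bullet> (hess \<phi> x *v d) / 2\<bar> \<le>
        norm (hess \<phi> (x + t *\<^sub>R d) - hess \<phi> x) * (norm d * norm d)"
      using inner_matrix_vector_le[of d "hess \<phi> (x + t *\<^sub>R d) - hess \<phi> x" d] by simp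
    also have "\<dots> \<le> (C * (1 + norm x) ^ 5 * norm d) * (norm d * norm d)"
    proof (rule mult_right_mono)
      have td: "t * norm d \<le> 1 * norm d" using t by (intro mult_right_mono) auto
      have "norm (hess \<phi> (x + t *\<^sub>R d) - hess \<phi> x) \<le> C * (1 + norm x) ^ 5 * norm (x + t *\<^sub>R d - x)"
        using t td True by (intro C) auto
      also have "\<dots> \<le> C * (1 + norm x) ^ 5 * norm d"
        using t td C(1) by (intro mult_left_mono) auto
      finally show "norm (hess \<phi> (x + t *\<^sub>R d) - hess \<phi> x) \<le> C * (1 + norm x) ^ 5 * norm d" .
    qed auto
    also have "\<dots> = C * (1 + norm x) ^ 5 * norm d ^ 3" by (simp add: power3_eq_cube)
    also have "\<dots> \<le> 7 * C * (1 + norm x) ^ 5 * norm d ^ 3"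
      using C(1) by (intro mult_right_mono) auto
    finally show ?thesis .
  next
    case False
    define P where "P = 1 + norm x"
    define r where "r = norm d"
    have P: "1 \<le> P" and r: "1 < r" using False by (auto simp: P_def r_def)
    have pw: "P ^ k * r ^ l \<le> P ^ 5 * r ^ 3" if "k \<le> 5" "l \<le> 3" for k l
      using P r that by (intro mult_mono power_increasing) auto
    have "1 + norm (x + d) \<le> P * (2 * r)"
    proof -
      have "1 + norm (x + d) \<le> P + r" using norm_triangle_ineq[of x d] by (simp add: P_def r_def)
      moreover have "P * 1 \<le> P * r" "1 * r \<le> P * r" using P r by (intro mult_mono; simp)+
      ultimately show ?thesis by simp
    qed
    then have "(1 + norm (x + d)) ^ 2 \<le> (P * (2 * r)) ^ 2" by (intro power_mono) auto
    also have "\<dots> = 4 * (P ^ 2 * r ^ 2)" by (simp add: power_mult_distrib)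
    also have "\<dots> \<le> 4 * (P ^ 5 * r ^ 3)" using pw[of 2 2] by simp
    finally have "C * (1 + norm (x + d)) ^ 2 \<le> C * (4 * (P ^ 5 * r ^ 3))" using C(1) by simp
    then have 1: "\<bar>\<phi> (x + d)\<bar> \<le> C * (4 * (P ^ 5 * r ^ 3))" using C(2)[of "x + d"] by linarith
    have "C * (P ^ 2 * r ^ 0) \<le> C * (P ^ 5 * r ^ 3)" using pw[of 2 0] C(1) by (intro mult_left_mono) auto
    then have 2: "\<bar>\<phi> x\<bar> \<le> C * (P ^ 5 * r ^ 3)" using C(2)[of x] by (simp add: P_def)
    have "\<bar>d \<bullet> grad \<phi> x\<bar> \<le> r * norm (grad \<phi> x)" unfolding r_def by (rule Cauchy_Schwarz_ineq2)
    also have "\<dots> \<le> r * (C * P ^ 3)" unfolding P_def using r C(3)[of x] by (intro mult_left_mono) auto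
    also have "\<dots> = C * (P ^ 3 * r ^ 1)" by simp
    also have "\<dots> \<le> C * (P ^ 5 * r ^ 3)" using pw[of 3 1] C(1) by (intro mult_left_mono) auto
    finally have 3: "\<bar>d \<bullet> grad \<phi> x\<bar> \<le> C * (P ^ 5 * r ^ 3)" .
    have "\<bar>d \<bullet> (hess \<phi> x *v d)\<bar> \<le> norm (hess \<phi> x) * (r * r)" unfolding r_def by (rule inner_matrix_vector_le)
    also have "\<dots> \<le> (C * P ^ 4) * (r * r)" unfolding P_def using C(4)[of x] r by (intro mult_right_mono) auto
    also have "\<dots> = C * (P ^ 4 * r ^ 2)" by (simp add: power2_eq_square)
    also have "\<dots> \<le> C * (P ^ 5 * r ^ 3)" using pw[of 4 2] C(1) by (intro mult_left_mono) auto
    finally have 4: "\<bar>d \<bullet> (hess \<phi> x *v d)\<bar> \<le> C * (P ^ 5 * r ^ 3)" .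
    \<comment> \<open>The four terms contribute 4, 1, 1 and one half, in total less than 7.\<close>
    have "\<bar>\<phi> (x + d) - \<phi> x - d \<bullet> grad \<phi> x - d \<bullet> (hess \<phi> x *v d) / 2\<bar> \<le> 7 * (C * (P ^ 5 * r ^ 3))"
      using 1 2 3 4 by linarith
    then show ?thesis by (simp add: P_def r_def mult.assoc)
  qed
  moreover have "0 \<le> 7 * C" using C by simp
  ultimately show ?thesis by blast
qed

text \<open>A step is \<open>u + v\<close> with drift \<open>u\<close> of order \<open>e\<close> and
  noise \<open>v\<close> of order \<open>sqrt e\<close>. What remains is the cubic Taylor error and
  the quadratic terms containing \<open>u\<close>, all at most of order \<open>e * sqrt e\<close>.
  The exponent 8 is 5 from the Taylor bound plus 3 from the cube of the step.\<close>

lemma Rem_growth: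
  "\<exists>C\<ge>0. \<forall>e x z. 0 < e \<longrightarrow> e \<le> 1 \<longrightarrow> \<bar>Rem e x z\<bar> \<le> C * (e * sqrt e) * (1 + norm x) ^ 8 * (1 + norm z) ^ 3"
proof -
  obtain C1 where C1: "0 \<le> C1" "\<And>x d. \<bar>\<phi> (x + d) - \<phi> x - d \<bullet> grad \<phi> x - d \<bullet> (hess \<phi> x *v d) / 2\<bar> \<le>
      C1 * (1 + norm x) ^ 5 * norm d ^ 3" using taylor_remainder by blast
  obtain C where C: "0 < C" "\<And>x. norm (hess \<phi> x) \<le> C * (1 + norm x) ^ 4" using \<phi>_growth by blast
  define D where "D = L + norm (b 0) + S"
  have D: "0 \<le> D" using L S(1) by (simp add: D_def)
  have "\<bar>Rem e x z\<bar> \<le> (C1 * D ^ 3 + 3 * C * D ^ 2) * (e * sqrt e) * (1 + norm x) ^ 8 * (1 + norm z) ^ 3"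
    if e: "0 < e" "e \<le> 1" for e x z
  proof -
    define P where "P = 1 + norm x"
    define Z where "Z = 1 + norm z"
    \<comment> \<open>Common scale of the step: \<open>norm u \<le> e * p\<close>,
      \<open>norm v \<le> sqrt e * p\<close>, and \<open>D\<close> is large enough that the sum is
      still at most \<open>sqrt e * p\<close>.\<close>
    define p where "p = D * P * Z"
    have PZ: "1 \<le> P" "1 \<le> Z" by (auto simp: P_def Z_def)
    have p0: "0 \<le> p" using PZ D by (auto simp: p_def)
    have se: "0 < sqrt e" "sqrt e \<le> 1" "e = sqrt e * sqrt e" "e \<le> sqrt e"
      using e by (auto intro!: real_le_rsqrt simp: power2_eq_square mult_le_one)
    define u where "u = e *\<^sub>R b x"
    define v where "v = sqrt e *\<^sub>R (\<sigma> *v z)"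
    define d where "d = u + v"
    have Bx: "norm (b x) \<le> (L + norm (b 0)) * P"
    proof -
      have "L * norm x + norm (b 0) \<le> L * P + norm (b 0) * P"
        using L PZ by (intro add_mono mult_left_mono) (auto simp: P_def mult_le_cancel_left1)
      then show ?thesis using norm_b_le[of x] by (simp add: ring_distribs)
    qed
    have LP: "(L + norm (b 0)) * P \<le> (L + norm (b 0)) * P * Z" "0 \<le> (L + norm (b 0)) * P * Z"
      using L PZ mult_left_mono[of 1 Z "(L + norm (b 0)) * P"]
      by (auto intro!: mult_nonneg_nonneg add_nonneg_nonneg)
    have SZ: "S * norm z \<le> S * P * Z"
    proof -
      have "S * norm z \<le> S * (P * Z)"
      proof (rule mult_left_mono[OF _ S(1)])
        have "1 * Z \<le> P * Z" using PZ by (intro mult_right_mono) auto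
        then show "norm z \<le> P * Z" by (simp add: Z_def)
      qed
      then show ?thesis by (simp add: mult.assoc)
    qed
    have SP0: "0 \<le> S * P * Z" using S(1) PZ by auto
    have p_split: "p = (L + norm (b 0)) * P * Z + S * P * Z" by (simp add: p_def D_def algebra_simps)
    have nu: "norm u \<le> e * ((L + norm (b 0)) * P * Z)" "norm u \<le> e * p"
    proof -
      show "norm u \<le> e * ((L + norm (b 0)) * P * Z)" unfolding u_def using e Bx LP by (simp add: mult_left_mono)
      also have "\<dots> \<le> e * p" using e SP0 by (intro mult_left_mono) (auto simp: p_split)
      finally show "norm u \<le> e * p" .
    qed
    have nv: "norm v \<le> sqrt e * (S * P * Z)" "norm v \<le> sqrt e * p"
    proof -
      have "norm (\<sigma> *v z) \<le> S * P * Z" using S(2)[of z] SZ by linarith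
      then show "norm v \<le> sqrt e * (S * P * Z)" unfolding v_def using e by simp
      also have "\<dots> \<le> sqrt e * p" using e LP by (intro mult_left_mono) (auto simp: p_split)
      finally show "norm v \<le> sqrt e * p" .
    qed
    have nd: "norm d \<le> sqrt e * p"
    proof -
      have "e * ((L + norm (b 0)) * P * Z) \<le> sqrt e * ((L + norm (b 0)) * P * Z)"
        using se LP by (intro mult_right_mono) auto
      then show ?thesis
        unfolding d_def using norm_triangle_ineq[of u v] nu(1) nv(1) by (simp add: p_split distrib_left)
    qed
    have step: "em_step e x z = x + d" by (simp add: em_step_def d_def u_def v_def add.assoc)
    \<comment> \<open>The Poisson equation enters here: the drift term and the mean of the
      second-order noise term combine to \<open>h x\<close> minus its mean.\<close>
    have gen: "h x - integral\<^sup>L \<mu> h = b x \<bullet> grad \<phi> x + 1 / 2 * hs_inner (\<sigma> ** transpose \<sigma>) (hess \<phi> x)"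
      using poisson unfolding poisson_solution_def generator_def by metis
    have tr: "(transpose \<sigma> *v grad \<phi> x) \<bullet> z = (\<sigma> *v z) \<bullet> grad \<phi> x"
      by (simp add: dot_lmul_matrix inner_commute[of _ "grad \<phi> x"])
    let ?H = "hess \<phi> x"
    have vv: "v \<bullet> (?H *v v) = e * ((\<sigma> *v z) \<bullet> (?H *v (\<sigma> *v z)))"
      using e by (simp add: v_def linear_scale[OF matrix_vector_mul_linear] mult.assoc[symmetric])
    have dg: "d \<bullet> grad \<phi> x = e * (b x \<bullet> grad \<phi> x) + sqrt e * ((\<sigma> *v z) \<bullet> grad \<phi> x)"
      by (simp add: d_def u_def v_def inner_add_left)
    have "Rem e x z = (\<phi> (x + d) - \<phi> x - d \<bullet> grad \<phi> x - d \<bullet> (?H *v d) / 2) +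
        (d \<bullet> (?H *v d) - v \<bullet> (?H *v v)) / 2"
      unfolding Rem_def step Q_def gen tr vv dg by (simp add: field_simps)
    \<comment> \<open>The part \<open>v \<bullet> (?H *v v)\<close> is already accounted for by
      \<open>Q\<close> and the generator; every remaining quadratic term contains
      \<open>u\<close>.\<close>
    also have "d \<bullet> (?H *v d) - v \<bullet> (?H *v v) = u \<bullet> (?H *v u) + u \<bullet> (?H *v v) + v \<bullet> (?H *v u)"
      by (simp add: d_def matrix_vector_right_distrib inner_add_left inner_add_right)
    finally have Rem_eq: "Rem e x z = (\<phi> (x + d) - \<phi> x - d \<bullet> grad \<phi> x - d \<bullet> (?H *v d) / 2) +
        (u \<bullet> (?H *v u) + u \<bullet> (?H *v v) + v \<bullet> (?H *v u)) / 2" .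
    have "\<bar>r + (s + t + q) / 2\<bar> \<le> \<bar>r\<bar> + (\<bar>s\<bar> + \<bar>t\<bar> + \<bar>q\<bar>)" for r s t q :: real
      using abs_triangle_ineq[of r "(s + t + q) / 2"] abs_triangle_ineq[of "s + t" q] abs_triangle_ineq[of s t]
        abs_ge_zero[of s] abs_ge_zero[of t] abs_ge_zero[of q]
      unfolding abs_divide abs_numeral by linarith
    then have "\<bar>Rem e x z\<bar> \<le> \<bar>\<phi> (x + d) - \<phi> x - d \<bullet> grad \<phi> x - d \<bullet> (?H *v d) / 2\<bar> +
        (\<bar>u \<bullet> (?H *v u)\<bar> + \<bar>u \<bullet> (?H *v v)\<bar> + \<bar>v \<bullet> (?H *v u)\<bar>)"
      unfolding Rem_eq .
    also have "\<dots> \<le> C1 * P ^ 5 * (e * sqrt e * p ^ 3) + (C * P ^ 4 * (e * sqrt e * p ^ 2) +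
        C * P ^ 4 * (e * sqrt e * p ^ 2) + C * P ^ 4 * (e * sqrt e * p ^ 2))"
    proof (intro add_mono)
      have "norm d ^ 3 \<le> (sqrt e * p) ^ 3" using nd by (intro power_mono) auto
      also have "\<dots> = e * sqrt e * p ^ 3" using se(3) by (simp add: power_mult_distrib power3_eq_cube)
      finally have "C1 * P ^ 5 * norm d ^ 3 \<le> C1 * P ^ 5 * (e * sqrt e * p ^ 3)"
        using C1(1) PZ by (intro mult_left_mono) auto
      then show "\<bar>\<phi> (x + d) - \<phi> x - d \<bullet> grad \<phi> x - d \<bullet> (?H *v d) / 2\<bar> \<le> C1 * P ^ 5 * (e * sqrt e * p ^ 3)"
        using C1(2)[of x d] by (simp add: P_def)
      have H: "\<bar>y \<bullet> (?H *v y')\<bar> \<le> C * P ^ 4 * (e * sqrt e * p ^ 2)"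
        if "norm y * norm y' \<le> e * sqrt e * p ^ 2" for y y'
      proof -
        have "\<bar>y \<bullet> (?H *v y')\<bar> \<le> norm ?H * (norm y * norm y')" by (rule inner_matrix_vector_le)
        also have "\<dots> \<le> C * P ^ 4 * (e * sqrt e * p ^ 2)"
          by (rule mult_mono[OF _ that]) (use C PZ in \<open>auto simp: P_def\<close>)
        finally show ?thesis .
      qed
      have uv: "norm u * norm v \<le> e * sqrt e * p ^ 2"
      proof -
        have "norm u * norm v \<le> (e * p) * (sqrt e * p)" using nu nv e p0 by (intro mult_mono) auto
        then show ?thesis by (simp add: power2_eq_square mult_ac)
      qed
      have uu: "norm u * norm u \<le> e * sqrt e * p ^ 2"
      proof -
        have "norm u * norm u \<le> (e * p) * (sqrt e * p)"
          using nu(2) mult_right_mono[OF se(4) p0] e p0 by (intro mult_mono) auto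
        then show ?thesis by (simp add: power2_eq_square mult_ac)
      qed
      show "\<bar>u \<bullet> (?H *v u)\<bar> \<le> C * P ^ 4 * (e * sqrt e * p ^ 2)" by (rule H[OF uu])
      show "\<bar>u \<bullet> (?H *v v)\<bar> \<le> C * P ^ 4 * (e * sqrt e * p ^ 2)" by (rule H[OF uv])
      show "\<bar>v \<bullet> (?H *v u)\<bar> \<le> C * P ^ 4 * (e * sqrt e * p ^ 2)" by (rule H) (use uv in \<open>simp add: mult.commute\<close>)
    qed
    also have "\<dots> = C1 * D ^ 3 * (e * sqrt e) * (P ^ 8 * Z ^ 3) + 3 * C * D ^ 2 * (e * sqrt e) * (P ^ 6 * Z ^ 2)"
    proof -
      have P: "P ^ 8 = P ^ 3 * P ^ 5" "P ^ 6 = P ^ 2 * P ^ 4" by (simp_all add: power_add[symmetric])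
      have "C1 * p5 * (E * (D3 * p3 * Z3)) + (C * p4 * (E * (D2 * p2 * Z2)) + C * p4 * (E * (D2 * p2 * Z2)) +
          C * p4 * (E * (D2 * p2 * Z2))) = C1 * D3 * E * (p3 * p5 * Z3) + 3 * C * D2 * E * (p2 * p4 * Z2)"
        for p2 p3 p4 p5 D2 D3 Z2 Z3 E :: real
        by (simp add: algebra_simps)
      then show ?thesis unfolding p_def power_mult_distrib P .
    qed
    also have "\<dots> \<le> C1 * D ^ 3 * (e * sqrt e) * (P ^ 8 * Z ^ 3) + 3 * C * D ^ 2 * (e * sqrt e) * (P ^ 8 * Z ^ 3)"
      using PZ C e D by (intro add_left_mono mult_left_mono mult_mono power_increasing) auto
    also have "\<dots> = (C1 * D ^ 3 + 3 * C * D ^ 2) * (e * sqrt e) * P ^ 8 * Z ^ 3" by (simp add: algebra_simps)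
    finally show ?thesis by (simp add: P_def Z_def)
  qed
  moreover have "0 \<le> C1 * D ^ 3 + 3 * C * D ^ 2" using C1 C D by auto
  ultimately show ?thesis by blast
qed

end


section \<open>Convergence of the characteristic functions\<close>

context em_full
begin

section \<open>Limits of weighted sums of step sizes\<close>

lemma w_step: "w k * \<eta> (Suc k) = 1"
  unfolding w_def by (rule left_inverse) (use \<eta>_pos[of "Suc k"] in linarith)

lemma w_sqrt_step: "w k * sqrt (\<eta> (Suc k)) = sqrt (w k)"
proof -
  have "sqrt (w k) = sqrt (w k) * sqrt (w k * \<eta> (Suc k))" by (simp add: w_step)
  also have "\<dots> = (sqrt (w k) * sqrt (w k)) * sqrt (\<eta> (Suc k))" by (simp only: real_sqrt_mult mult.assoc)
  also have "sqrt (w k) * sqrt (w k) = w k" using w_pos[of k] by simp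
  finally show ?thesis ..
qed

lemma sqrt_step: "\<eta> (Suc k) * sqrt (w k) = sqrt (\<eta> (Suc k))"
  unfolding w_sqrt_step[symmetric] using w_step[of k] by (simp add: mult.assoc[symmetric] mult.commute[of "\<eta> _"])

text \<open>Toeplitz argument: the total weight tends to infinity, so finitely many early terms are
  negligible, and the others are uniformly small.\<close>

lemma weighted_average_tendsto_0:
  assumes p: "\<And>k. 0 \<le> p k" "p \<longlonglongrightarrow> 0"
  shows "(\<lambda>n. (\<Sum>k<n. w k * p k) / T_sum \<eta> n) \<longlonglongrightarrow> 0"
proof (rule LIMSEQ_I)
  fix r :: real assume r: "0 < r"
  obtain m where m: "\<And>k. k \<ge> m \<Longrightarrow> p k < r / 2"
    using LIMSEQ_D[OF p(2), of "r / 2"] r p(1) by auto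
  define c where "c = (\<Sum>k<m. w k * p k)"
  have "(\<lambda>n. c / T_sum \<eta> n) \<longlonglongrightarrow> 0"
    by (rule real_tendsto_divide_at_top[OF tendsto_const T_sum_at_top])
  from LIMSEQ_D[OF this, of "r / 2"] r obtain m' where m': "\<And>n. n \<ge> m' \<Longrightarrow> \<bar>c / T_sum \<eta> n\<bar> < r / 2"
    by auto
  show "\<exists>no. \<forall>n\<ge>no. norm ((\<Sum>k<n. w k * p k) / T_sum \<eta> n - 0) < r"
  proof (intro exI[of _ "Suc (max m m')"] allI impI)
    fix n assume n: "Suc (max m m') \<le> n"
    have T: "0 < T_sum \<eta> n" using n by (intro T_sum_pos) auto
    have "(\<Sum>k<n. w k * p k) = c + (\<Sum>k\<in>{m..<n}. w k * p k)"
      unfolding c_def using n by (subst sum.union_disjoint[symmetric]) (auto intro!: sum.cong)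
    also have "(\<Sum>k\<in>{m..<n}. w k * p k) \<le> (\<Sum>k\<in>{m..<n}. w k * (r / 2))"
      using m w_pos by (intro sum_mono mult_left_mono) (auto intro: less_imp_le)
    also have "\<dots> \<le> (\<Sum>k<n. w k * (r / 2))"
      using w_pos r by (intro sum_mono2) (auto intro: less_imp_le)
    also have "\<dots> = T_sum \<eta> n * (r / 2)" by (simp add: T_sum_eq sum_distrib_right)
    finally have "(\<Sum>k<n. w k * p k) / T_sum \<eta> n \<le> c / T_sum \<eta> n + r / 2"
      using T by (simp add: field_simps)
    also have "\<dots> < r"
    proof -
      have "\<bar>c / T_sum \<eta> n\<bar> < r / 2" using n by (intro m') simp
      then show ?thesis by linarith
    qed
    finally have "(\<Sum>k<n. w k * p k) / T_sum \<eta> n < r" .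
    moreover have "0 \<le> (\<Sum>k<n. w k * p k) / T_sum \<eta> n"
      using T w_pos p(1) by (intro divide_nonneg_nonneg sum_nonneg mult_nonneg_nonneg) (auto intro: less_imp_le)
    ultimately show "norm ((\<Sum>k<n. w k * p k) / T_sum \<eta> n - 0) < r" by simp
  qed
qed

text \<open>The ratio is the weighted average of the step sizes, since
  \<open>w k * \<eta> (Suc k) = 1\<close>, and these tend to 0.\<close>

lemma count_over_T_sum: "(\<lambda>n. real n / T_sum \<eta> n) \<longlonglongrightarrow> 0"
proof -
  show ?thesis
    using weighted_average_tendsto_0[of "\<lambda>k. \<eta> (Suc k)", OF _ \<eta>_tendsto_0] by (simp add: w_step)
qed

text \<open>Cauchy--Schwarz for \<open>sqrt (\<eta> (Suc k)) = \<eta> (Suc k) * sqrt (w k)\<close>: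
  the square of the sum from \<open>m\<close> on is at most a tail of the summable squares times
  \<open>T_sum \<eta> n\<close>.\<close>

lemma sum_sqrt_step_over_sqrt_T_sum: "(\<lambda>n. (\<Sum>k<n. sqrt (\<eta> (Suc k))) / sqrt (T_sum \<eta> n)) \<longlonglongrightarrow> 0"
proof (rule LIMSEQ_I)
  fix r :: real assume r: "0 < r"
  from \<eta>_sq[unfolded summable_Cauchy, rule_format, of "(r / 2)\<^sup>2"] r
  obtain m where m: "\<And>k n. k \<ge> m \<Longrightarrow> norm (\<Sum>i\<in>{k..<n}. (\<eta> (Suc i))\<^sup>2) < (r / 2)\<^sup>2" by auto
  have "filterlim (\<lambda>n. sqrt (T_sum \<eta> n)) at_top sequentially"
    by (rule filterlim_compose[OF sqrt_at_top T_sum_at_top])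
  then have "(\<lambda>n. real m / sqrt (T_sum \<eta> n)) \<longlonglongrightarrow> 0"
    by (rule real_tendsto_divide_at_top[OF tendsto_const])
  from LIMSEQ_D[OF this, of "r / 2"] r obtain m' where m': "\<And>n. n \<ge> m' \<Longrightarrow> \<bar>real m / sqrt (T_sum \<eta> n)\<bar> < r / 2"
    by auto
  show "\<exists>no. \<forall>n\<ge>no. norm ((\<Sum>k<n. sqrt (\<eta> (Suc k))) / sqrt (T_sum \<eta> n) - 0) < r"
  proof (intro exI[of _ "Suc (max m m')"] allI impI)
    fix n assume n: "Suc (max m m') \<le> n"
    have T: "0 < T_sum \<eta> n" using n by (intro T_sum_pos) auto
    have "(\<Sum>k<n. sqrt (\<eta> (Suc k))) = (\<Sum>k<m. sqrt (\<eta> (Suc k))) + (\<Sum>k\<in>{m..<n}. sqrt (\<eta> (Suc k)))"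
      using n by (subst sum.union_disjoint[symmetric]) (auto intro!: sum.cong)
    also have "(\<Sum>k<m. sqrt (\<eta> (Suc k))) \<le> (\<Sum>k<m. 1)"
      using \<eta>_le_1 by (intro sum_mono) auto
    also have "(\<Sum>k\<in>{m..<n}. sqrt (\<eta> (Suc k))) \<le> sqrt ((r / 2)\<^sup>2 * T_sum \<eta> n)"
    proof (rule real_le_rsqrt)
      have "(\<Sum>k\<in>{m..<n}. sqrt (\<eta> (Suc k)))\<^sup>2 = (\<Sum>k\<in>{m..<n}. \<eta> (Suc k) * sqrt (w k))\<^sup>2"
        by (simp add: sqrt_step)
      also have "\<dots> \<le> (\<Sum>k\<in>{m..<n}. (\<eta> (Suc k))\<^sup>2) * (\<Sum>k\<in>{m..<n}. (sqrt (w k))\<^sup>2)"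
        by (rule Cauchy_Schwarz_ineq_sum)
      also have "\<dots> \<le> (r / 2)\<^sup>2 * T_sum \<eta> n"
      proof (rule mult_mono)
        show "(\<Sum>k\<in>{m..<n}. (\<eta> (Suc k))\<^sup>2) \<le> (r / 2)\<^sup>2" using m[of m n] by simp
        have "(\<Sum>k\<in>{m..<n}. (sqrt (w k))\<^sup>2) = (\<Sum>k\<in>{m..<n}. w k)" using w_pos by (simp add: less_imp_le)
        also have "\<dots> \<le> T_sum \<eta> n" unfolding T_sum_eq using w_pos by (intro sum_mono2) (auto intro: less_imp_le)
        finally show "(\<Sum>k\<in>{m..<n}. (sqrt (w k))\<^sup>2) \<le> T_sum \<eta> n" .
      qed (auto intro!: sum_nonneg)
      finally show "(\<Sum>k\<in>{m..<n}. sqrt (\<eta> (Suc k)))\<^sup>2 \<le> (r / 2)\<^sup>2 * T_sum \<eta> n" .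
    qed
    also have "\<dots> = r / 2 * sqrt (T_sum \<eta> n)" using r by (simp add: real_sqrt_mult)
    finally have "(\<Sum>k<n. sqrt (\<eta> (Suc k))) / sqrt (T_sum \<eta> n) \<le> real m / sqrt (T_sum \<eta> n) + r / 2"
      using T by (simp add: field_simps)
    also have "\<dots> < r"
    proof -
      have "\<bar>real m / sqrt (T_sum \<eta> n)\<bar> < r / 2" using n by (intro m') simp
      then show ?thesis by linarith
    qed
    finally have "(\<Sum>k<n. sqrt (\<eta> (Suc k))) / sqrt (T_sum \<eta> n) < r" .
    moreover have "0 \<le> (\<Sum>k<n. sqrt (\<eta> (Suc k))) / sqrt (T_sum \<eta> n)"
      using T by (intro divide_nonneg_nonneg sum_nonneg) auto
    ultimately show "norm ((\<Sum>k<n. sqrt (\<eta> (Suc k))) / sqrt (T_sum \<eta> n) - 0) < r" by simp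
  qed
qed

end

section \<open>Quadratic variation and error terms\<close>

context em_poisson
begin

text \<open>Conditional variance of the leading martingale increment per unit of weight; its
  integral under \<open>\<mu>\<close> is the variance of the limit.\<close>

definition f where "f x = (norm (transpose \<sigma> *v grad \<phi> x))\<^sup>2"

lemma f_cont: "continuous_on UNIV f"
  unfolding f_def
  by (intro continuous_intros continuous_on_compose2[OF _ \<phi>_cont(2)]
      linear_continuous_on matrix_vector_mul_bounded_linear) auto

lemma f_second_moment:
  "\<exists>C. \<forall>k. integrable M (\<lambda>\<omega>. (f (\<theta> k \<omega>))\<^sup>2) \<and> (\<integral>\<omega>. (f (\<theta> k \<omega>))\<^sup>2 \<partial>M) \<le> C"
proof -
  obtain C where C: "0 < C" "\<And>x. norm (grad \<phi> x) \<le> C * (1 + norm x) ^ 3" using \<phi>_growth by blast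
  \<comment> \<open>The square of \<open>f\<close> is a fourth power of the gradient, which grows
    like the third power of the position; hence the exponent 12.\<close>
  obtain D where D: "0 \<le> D" "\<And>k. integrable M (\<lambda>\<omega>. (1 + norm (\<theta> k \<omega>)) ^ 12)"
    "\<And>k. (\<integral>\<omega>. (1 + norm (\<theta> k \<omega>)) ^ 12 \<partial>M) \<le> D"
    using moments[of 12 0] by auto
  have [measurable]: "f \<in> borel_measurable borel" by (rule borel_measurable_continuous_onI[OF f_cont])
  define c where "c = (norm (transpose \<sigma>) * C) ^ 4"
  have c: "0 \<le> c" by (simp add: c_def)
  have bd: "(f x)\<^sup>2 \<le> c * (1 + norm x) ^ 12" for x
  proof -
    have "norm (transpose \<sigma> *v grad \<phi> x) \<le> norm (transpose \<sigma>) * (C * (1 + norm x) ^ 3)"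
      by (intro order_trans[OF norm_matrix_vector_mult_le] mult_left_mono C) auto
    then have "norm (transpose \<sigma> *v grad \<phi> x) ^ 4 \<le> (norm (transpose \<sigma>) * (C * (1 + norm x) ^ 3)) ^ 4"
      by (intro power_mono) auto
    also have "\<dots> = c * (1 + norm x) ^ 12" by (simp add: c_def power_mult_distrib power_mult[symmetric])
    finally show ?thesis by (simp add: f_def power_mult[symmetric])
  qed
  have int: "integrable M (\<lambda>\<omega>. (f (\<theta> k \<omega>))\<^sup>2)" for k
    by (rule Bochner_Integration.integrable_bound[OF integrable_mult_right[OF D(2)[of k], of c]])
      (use bd in \<open>auto intro: order_trans[OF _ abs_ge_self]\<close>)
  have "(\<integral>\<omega>. (f (\<theta> k \<omega>))\<^sup>2 \<partial>M) \<le> c * D" for k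
  proof -
    have "(\<integral>\<omega>. (f (\<theta> k \<omega>))\<^sup>2 \<partial>M) \<le> (\<integral>\<omega>. c * (1 + norm (\<theta> k \<omega>)) ^ 12 \<partial>M)"
      using int D(2) bd by (intro integral_mono) auto
    also have "\<dots> \<le> c * D" using D(3)[of k] c by (simp add: mult_left_mono)
    finally show ?thesis .
  qed
  then show ?thesis using int by blast
qed

lemma quadratic_variation:
  shows "integrable \<mu> f"
    and "(\<lambda>n. \<integral>\<omega>. \<bar>(\<Sum>k<n. w k * f (\<theta> k \<omega>)) / T_sum \<eta> n - integral\<^sup>L \<mu> f\<bar> \<partial>M) \<longlonglongrightarrow> 0"
proof -
  obtain C where "\<And>k. integrable M (\<lambda>\<omega>. (f (\<theta> k \<omega>))\<^sup>2)" "\<And>k. (\<integral>\<omega>. (f (\<theta> k \<omega>))\<^sup>2 \<partial>M) \<le> C"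
    using f_second_moment by blast
  moreover have "0 \<le> f x" for x by (simp add: f_def)
  ultimately show "integrable \<mu> f"
    "(\<lambda>n. \<integral>\<omega>. \<bar>(\<Sum>k<n. w k * f (\<theta> k \<omega>)) / T_sum \<eta> n - integral\<^sup>L \<mu> f\<bar> \<partial>M) \<longlonglongrightarrow> 0"
    by (blast intro: ergodic_L1[OF f_cont])+
qed

text \<open>Summation by parts moves the differences from \<open>\<phi>\<close> to the weights. The
  weights do not decrease, so the absolute values of their differences telescope, and the means of
  \<open>\<bar>\<phi> (\<theta> k \<omega>)\<bar>\<close> are uniformly bounded.\<close>

lemma boundary_terms:
  "\<exists>C\<ge>0. \<forall>n>0. integrable M (\<lambda>\<omega>. \<Sum>k<n. w k * (\<phi> (\<theta> (Suc k) \<omega>) - \<phi> (\<theta> k \<omega>))) \<and>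
    (\<integral>\<omega>. \<bar>\<Sum>k<n. w k * (\<phi> (\<theta> (Suc k) \<omega>) - \<phi> (\<theta> k \<omega>))\<bar> \<partial>M) \<le> C * (1 / \<eta> n)"
proof -
  obtain C where C: "0 < C" "\<And>x. \<bar>\<phi> x\<bar> \<le> C * (1 + norm x) ^ 2" using \<phi>_growth by blast
  obtain D where D: "0 \<le> D" "\<And>k. integrable M (\<lambda>\<omega>. (1 + norm (\<theta> k \<omega>)) ^ 2)"
    "\<And>k. (\<integral>\<omega>. (1 + norm (\<theta> k \<omega>)) ^ 2 \<partial>M) \<le> D"
    using moments[of 2 0] by auto
  have int: "integrable M (\<lambda>\<omega>. \<phi> (\<theta> k \<omega>))" for k
    by (rule Bochner_Integration.integrable_bound[OF integrable_mult_right[OF D(2)[of k], of C]])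
      (use C(2) in \<open>auto intro: order_trans[OF _ abs_ge_self] simp del: euler_maruyama.simps\<close>)
  have E: "(\<integral>\<omega>. \<bar>\<phi> (\<theta> k \<omega>)\<bar> \<partial>M) \<le> C * D" for k
  proof -
    have "(\<integral>\<omega>. \<bar>\<phi> (\<theta> k \<omega>)\<bar> \<partial>M) \<le> (\<integral>\<omega>. C * (1 + norm (\<theta> k \<omega>)) ^ 2 \<partial>M)"
      using int D(2) C(2) by (intro integral_mono) auto
    also have "\<dots> \<le> C * D" using D(3)[of k] C(1) by simp
    finally show ?thesis .
  qed
  define p where "p k \<omega> = \<phi> (\<theta> k \<omega>)" for k \<omega>
  have pint: "integrable M (p k)" for k unfolding p_def by (rule int)
  have wmono: "w k \<le> w (Suc k)" for k
    unfolding w_def using \<eta>_dec[of "Suc k"] by (intro le_imp_inverse_le) auto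
  have abel: "(\<Sum>k<Suc m. w k * (p (Suc k) \<omega> - p k \<omega>)) =
      w m * p (Suc m) \<omega> - (\<Sum>k<m. (w (Suc k) - w k) * p (Suc k) \<omega>) - w 0 * p 0 \<omega>" for m \<omega>
    by (induction m) (simp_all add: algebra_simps)
  have "integrable M (\<lambda>\<omega>. \<Sum>k<n. w k * (p (Suc k) \<omega> - p k \<omega>)) \<and>
    (\<integral>\<omega>. \<bar>\<Sum>k<n. w k * (p (Suc k) \<omega> - p k \<omega>)\<bar> \<partial>M) \<le> 2 * C * D * (1 / \<eta> n)" if n: "0 < n" for n
  proof
    show i: "integrable M (\<lambda>\<omega>. \<Sum>k<n. w k * (p (Suc k) \<omega> - p k \<omega>))" using pint by auto
    obtain m where m: "n = Suc m" using n by (cases n) auto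
    have "(\<integral>\<omega>. \<bar>\<Sum>k<n. w k * (p (Suc k) \<omega> - p k \<omega>)\<bar> \<partial>M) \<le>
        (\<integral>\<omega>. w m * \<bar>p (Suc m) \<omega>\<bar> + (\<Sum>k<m. (w (Suc k) - w k) * \<bar>p (Suc k) \<omega>\<bar>) + w 0 * \<bar>p 0 \<omega>\<bar> \<partial>M)"
    proof (rule integral_mono)
      fix \<omega>
      have 1: "\<bar>w k * p j \<omega>\<bar> = w k * \<bar>p j \<omega>\<bar>" for k j using w_pos[of k] by (simp add: abs_mult)
      have 2: "\<bar>\<Sum>k<m. (w (Suc k) - w k) * p (Suc k) \<omega>\<bar> \<le> (\<Sum>k<m. (w (Suc k) - w k) * \<bar>p (Suc k) \<omega>\<bar>)"
        using wmono by (intro order_trans[OF sum_abs] sum_mono) (auto simp: abs_mult)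
      show "\<bar>\<Sum>k<n. w k * (p (Suc k) \<omega> - p k \<omega>)\<bar> \<le>
          w m * \<bar>p (Suc m) \<omega>\<bar> + (\<Sum>k<m. (w (Suc k) - w k) * \<bar>p (Suc k) \<omega>\<bar>) + w 0 * \<bar>p 0 \<omega>\<bar>"
        unfolding m abel using 2 1[of m "Suc m"] 1[of 0 0] by linarith
    qed (use i pint in auto)
    also have "\<dots> = w m * (\<integral>\<omega>. \<bar>p (Suc m) \<omega>\<bar> \<partial>M) + (\<Sum>k<m. (w (Suc k) - w k) * (\<integral>\<omega>. \<bar>p (Suc k) \<omega>\<bar> \<partial>M)) +
        w 0 * (\<integral>\<omega>. \<bar>p 0 \<omega>\<bar> \<partial>M)"
      using pint by simp
    also have "\<dots> \<le> w m * (C * D) + (\<Sum>k<m. (w (Suc k) - w k) * (C * D)) + w 0 * (C * D)"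
      using E wmono w_pos unfolding p_def
      by (intro add_mono sum_mono mult_left_mono) (auto intro: less_imp_le simp del: euler_maruyama.simps)
    \<comment> \<open>The coefficients add up to \<open>2 * w m\<close>, and
      \<open>w m = 1 / \<eta> n\<close> because \<open>n = Suc m\<close>.\<close>
    also have "\<dots> = w m * (C * D) + (w m - w 0) * (C * D) + w 0 * (C * D)"
      by (simp add: sum_distrib_right[symmetric] sum_lessThan_telescope)
    also have "\<dots> = 2 * C * D * (1 / \<eta> n)" by (simp add: m w_def inverse_eq_divide algebra_simps)
    finally show "(\<integral>\<omega>. \<bar>\<Sum>k<n. w k * (p (Suc k) \<omega> - p k \<omega>)\<bar> \<partial>M) \<le> 2 * C * D * (1 / \<eta> n)" .
  qed
  then show ?thesis
    using C(1) D(1) unfolding p_def by (intro exI[of _ "2 * C * D"]) auto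
qed

text \<open>The weight \<open>w k\<close> cancels the factor \<open>\<eta> (Suc k)\<close> in front
  of \<open>Q\<close>, so the sum is unweighted; orthogonality makes its second moment of order
  \<open>n\<close>, negligible against \<open>T_sum \<eta> n\<close>.\<close>

lemma quadratic_noise_terms:
  "\<exists>C\<ge>0. \<forall>n. integrable M (\<lambda>\<omega>. \<Sum>k<n. Q (\<theta> k \<omega>) (\<xi> (Suc k) \<omega>)) \<and>
    (\<integral>\<omega>. \<bar>\<Sum>k<n. Q (\<theta> k \<omega>) (\<xi> (Suc k) \<omega>)\<bar> \<partial>M) \<le> sqrt (C * real n)"
proof -
  obtain C where C: "0 \<le> C" "\<And>x z. \<bar>Q x z\<bar> \<le> C * (1 + norm x) ^ 4 * (1 + norm z) ^ 2" using Q_growth by blast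
  obtain D where D: "0 \<le> D"
    "\<And>k. integrable M (\<lambda>\<omega>. (1 + norm (\<theta> k \<omega>)) ^ 8 * (1 + norm (\<xi> (Suc k) \<omega>)) ^ 4)"
    "\<And>k. (\<integral>\<omega>. (1 + norm (\<theta> k \<omega>)) ^ 8 * (1 + norm (\<xi> (Suc k) \<omega>)) ^ 4 \<partial>M) \<le> D"
    using moments[of 8 4] by blast
  have Q2: "(Q x z)\<^sup>2 \<le> C\<^sup>2 * ((1 + norm x) ^ 8 * (1 + norm z) ^ 4)" for x z
  proof -
    have "(Q x z)\<^sup>2 \<le> (C * (1 + norm x) ^ 4 * (1 + norm z) ^ 2)\<^sup>2"
      using power_mono[OF C(2)[of x z] abs_ge_zero, of 2] by (simp only: power2_abs)
    then show ?thesis by (simp add: power_mult_distrib power_mult[symmetric] mult.assoc)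
  qed
  have int: "integrable M (\<lambda>\<omega>. (Q (\<theta> k \<omega>) (\<xi> (Suc k) \<omega>))\<^sup>2)" for k
    by (rule Bochner_Integration.integrable_bound[OF integrable_mult_right[OF D(2)[of k], of "C\<^sup>2"]])
      (use Q2 in \<open>auto intro: order_trans[OF _ abs_ge_self]\<close>)
  have E: "(\<integral>\<omega>. (Q (\<theta> k \<omega>) (\<xi> (Suc k) \<omega>))\<^sup>2 \<partial>M) \<le> C\<^sup>2 * D" for k
  proof -
    have "(\<integral>\<omega>. (Q (\<theta> k \<omega>) (\<xi> (Suc k) \<omega>))\<^sup>2 \<partial>M) \<le>
        (\<integral>\<omega>. C\<^sup>2 * ((1 + norm (\<theta> k \<omega>)) ^ 8 * (1 + norm (\<xi> (Suc k) \<omega>)) ^ 4) \<partial>M)"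
      using int D(2) Q2 by (intro integral_mono integrable_mult_right) auto
    also have "\<dots> = C\<^sup>2 * (\<integral>\<omega>. (1 + norm (\<theta> k \<omega>)) ^ 8 * (1 + norm (\<xi> (Suc k) \<omega>)) ^ 4 \<partial>M)" by simp
    also have "\<dots> \<le> C\<^sup>2 * D" using D(3)[of k] by (intro mult_left_mono) auto
    finally show ?thesis .
  qed
  have sq: "integrable M (\<lambda>\<omega>. (\<Sum>k<n. Q (\<theta> k \<omega>) (\<xi> (Suc k) \<omega>))\<^sup>2) \<and>
      (\<integral>\<omega>. (\<Sum>k<n. Q (\<theta> k \<omega>) (\<xi> (Suc k) \<omega>))\<^sup>2 \<partial>M) = (\<Sum>k<n. (\<integral>\<omega>. (Q (\<theta> k \<omega>) (\<xi> (Suc k) \<omega>))\<^sup>2 \<partial>M))" for n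
    using martingale_difference_square[where Y = \<theta> and S = borel and f = "\<lambda>_ p. Q (fst p) (snd p)" and n = n]
      measurable_\<theta>_F[OF order_refl] Q_mean int by simp
  have "integrable M (\<lambda>\<omega>. \<Sum>k<n. Q (\<theta> k \<omega>) (\<xi> (Suc k) \<omega>)) \<and>
    (\<integral>\<omega>. \<bar>\<Sum>k<n. Q (\<theta> k \<omega>) (\<xi> (Suc k) \<omega>)\<bar> \<partial>M) \<le> sqrt (C\<^sup>2 * D * real n)" for n
  proof
    have m: "(\<lambda>\<omega>. \<Sum>k<n. Q (\<theta> k \<omega>) (\<xi> (Suc k) \<omega>)) \<in> borel_measurable M" by measurable
    show "integrable M (\<lambda>\<omega>. \<Sum>k<n. Q (\<theta> k \<omega>) (\<xi> (Suc k) \<omega>))"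
      by (rule integral_abs_le_sqrt(1)[OF m conjunct1[OF sq]])
    have "(\<integral>\<omega>. \<bar>\<Sum>k<n. Q (\<theta> k \<omega>) (\<xi> (Suc k) \<omega>)\<bar> \<partial>M) \<le> sqrt (\<Sum>k<n. (\<integral>\<omega>. (Q (\<theta> k \<omega>) (\<xi> (Suc k) \<omega>))\<^sup>2 \<partial>M))"
      using integral_abs_le_sqrt(2)[OF m conjunct1[OF sq]] sq[of n] by simp
    also have "\<dots> \<le> sqrt (\<Sum>k<n. C\<^sup>2 * D)" by (intro real_sqrt_le_mono sum_mono E)
    finally show "(\<integral>\<omega>. \<bar>\<Sum>k<n. Q (\<theta> k \<omega>) (\<xi> (Suc k) \<omega>)\<bar> \<partial>M) \<le> sqrt (C\<^sup>2 * D * real n)" by (simp add: mult.commute)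
  qed
  then show ?thesis using D(1) by (intro exI[of _ "C\<^sup>2 * D"]) auto
qed

text \<open>The weight turns the order \<open>\<eta> (Suc k) * sqrt (\<eta> (Suc k))\<close> of the
  remainder into \<open>sqrt (\<eta> (Suc k))\<close>; the terms are then added in absolute
  value.\<close>

lemma remainder_terms:
  "\<exists>C\<ge>0. \<forall>n. integrable M (\<lambda>\<omega>. \<Sum>k<n. w k * Rem (\<eta> (Suc k)) (\<theta> k \<omega>) (\<xi> (Suc k) \<omega>)) \<and>
    (\<integral>\<omega>. \<bar>\<Sum>k<n. w k * Rem (\<eta> (Suc k)) (\<theta> k \<omega>) (\<xi> (Suc k) \<omega>)\<bar> \<partial>M) \<le> C * (\<Sum>k<n. sqrt (\<eta> (Suc k)))"
proof -
  obtain C where C: "0 \<le> C" "\<And>e x z. 0 < e \<Longrightarrow> e \<le> 1 \<Longrightarrow>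
      \<bar>Rem e x z\<bar> \<le> C * (e * sqrt e) * (1 + norm x) ^ 8 * (1 + norm z) ^ 3" using Rem_growth by blast
  obtain D where D: "0 \<le> D"
    "\<And>k. integrable M (\<lambda>\<omega>. (1 + norm (\<theta> k \<omega>)) ^ 8 * (1 + norm (\<xi> (Suc k) \<omega>)) ^ 3)"
    "\<And>k. (\<integral>\<omega>. (1 + norm (\<theta> k \<omega>)) ^ 8 * (1 + norm (\<xi> (Suc k) \<omega>)) ^ 3 \<partial>M) \<le> D"
    using moments[of 8 3] by blast
  define R where "R k \<omega> = w k * Rem (\<eta> (Suc k)) (\<theta> k \<omega>) (\<xi> (Suc k) \<omega>)" for k \<omega>
  have [measurable]: "R k \<in> borel_measurable M" for k
    unfolding R_def Rem_def by (measurable; simp)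
  have Rb: "\<bar>R k \<omega>\<bar> \<le> C * sqrt (\<eta> (Suc k)) * ((1 + norm (\<theta> k \<omega>)) ^ 8 * (1 + norm (\<xi> (Suc k) \<omega>)) ^ 3)" for k \<omega>
  proof -
    have "\<bar>R k \<omega>\<bar> = w k * \<bar>Rem (\<eta> (Suc k)) (\<theta> k \<omega>) (\<xi> (Suc k) \<omega>)\<bar>"
      using w_pos[of k] by (simp add: R_def abs_mult)
    also have "\<dots> \<le> w k * (C * (\<eta> (Suc k) * sqrt (\<eta> (Suc k))) * (1 + norm (\<theta> k \<omega>)) ^ 8 * (1 + norm (\<xi> (Suc k) \<omega>)) ^ 3)"
      using w_pos[of k] \<eta>_le_1[of "Suc k"] by (intro mult_left_mono C) auto
    also have "\<dots> = (w k * \<eta> (Suc k)) * (C * sqrt (\<eta> (Suc k)) * ((1 + norm (\<theta> k \<omega>)) ^ 8 * (1 + norm (\<xi> (Suc k) \<omega>)) ^ 3))"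
      by (simp only: mult_ac)
    also have "w k * \<eta> (Suc k) = 1" by (rule w_step)
    finally show ?thesis by simp
  qed
  have int: "integrable M (R k)" for k
    by (rule Bochner_Integration.integrable_bound[OF integrable_mult_right[OF D(2)[of k], of "C * sqrt (\<eta> (Suc k))"]])
      (use Rb[of k] in \<open>auto intro: order_trans[OF _ abs_ge_self]\<close>)
  have E: "(\<integral>\<omega>. \<bar>R k \<omega>\<bar> \<partial>M) \<le> C * D * sqrt (\<eta> (Suc k))" for k
  proof -
    have "(\<integral>\<omega>. \<bar>R k \<omega>\<bar> \<partial>M) \<le>
        (\<integral>\<omega>. C * sqrt (\<eta> (Suc k)) * ((1 + norm (\<theta> k \<omega>)) ^ 8 * (1 + norm (\<xi> (Suc k) \<omega>)) ^ 3) \<partial>M)"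
      using int D(2) Rb by (intro integral_mono integrable_mult_right integrable_abs) auto
    also have "\<dots> = C * sqrt (\<eta> (Suc k)) * (\<integral>\<omega>. (1 + norm (\<theta> k \<omega>)) ^ 8 * (1 + norm (\<xi> (Suc k) \<omega>)) ^ 3 \<partial>M)" by simp
    also have "\<dots> \<le> C * sqrt (\<eta> (Suc k)) * D" using D(3)[of k] C(1) by (intro mult_left_mono) auto
    finally show ?thesis by (simp add: mult_ac)
  qed
  have "(\<integral>\<omega>. \<bar>\<Sum>k<n. R k \<omega>\<bar> \<partial>M) \<le> C * D * (\<Sum>k<n. sqrt (\<eta> (Suc k)))" for n
  proof -
    have "(\<integral>\<omega>. \<bar>\<Sum>k<n. R k \<omega>\<bar> \<partial>M) \<le> (\<integral>\<omega>. (\<Sum>k<n. \<bar>R k \<omega>\<bar>) \<partial>M)"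
      using int by (intro integral_mono sum_abs) auto
    also have "\<dots> = (\<Sum>k<n. (\<integral>\<omega>. \<bar>R k \<omega>\<bar> \<partial>M))" using int by simp
    also have "\<dots> \<le> (\<Sum>k<n. C * D * sqrt (\<eta> (Suc k)))" by (intro sum_mono E)
    finally show ?thesis by (simp add: sum_distrib_left)
  qed
  then show ?thesis
    using C(1) D(1) int unfolding R_def by (intro exI[of _ "C * D"]) auto
qed

text \<open>The minus sign comes from solving the expansion for \<open>h\<close>. The normalisation
  depends on \<open>n\<close>, so this is a triangular array, to which the bound on characteristic
  functions is applied row by row.\<close>

definition a :: "nat \<Rightarrow> nat \<Rightarrow> 'a \<Rightarrow> real^'n" where
  "a n k \<omega> = (- sqrt (w k / T_sum \<eta> n)) *\<^sub>R (transpose \<sigma> *v grad \<phi> (\<theta> k \<omega>))"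

definition Z :: "nat \<Rightarrow> 'a \<Rightarrow> real" where
  "Z n \<omega> = (\<Sum>k<n. h (\<theta> k \<omega>) - integral\<^sup>L \<mu> h) / sqrt (T_sum \<eta> n)"

definition N :: "nat \<Rightarrow> 'a \<Rightarrow> real" where
  "N n \<omega> = (\<Sum>k<n. a n k \<omega> \<bullet> \<xi> (Suc k) \<omega>)"

section \<open>Martingale approximation and passage to the limit\<close>

lemma measurable_Z_N [measurable]: "Z n \<in> borel_measurable M" "N n \<in> borel_measurable M"
  unfolding Z_def N_def a_def by measurable

text \<open>The definition of \<open>Rem\<close>, multiplied by \<open>w k\<close> and solved for
  \<open>h\<close> by means of \<open>w k * \<eta> (Suc k) = 1\<close>.\<close>

lemma Z_decomposition:
  "Z n \<omega> - N n \<omega> = ((\<Sum>k<n. w k * (\<phi> (\<theta> (Suc k) \<omega>) - \<phi> (\<theta> k \<omega>))) -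
      (\<Sum>k<n. Q (\<theta> k \<omega>) (\<xi> (Suc k) \<omega>)) -
      (\<Sum>k<n. w k * Rem (\<eta> (Suc k)) (\<theta> k \<omega>) (\<xi> (Suc k) \<omega>))) / sqrt (T_sum \<eta> n)"
proof -
  have "h (\<theta> k \<omega>) - integral\<^sup>L \<mu> h = w k * (\<phi> (\<theta> (Suc k) \<omega>) - \<phi> (\<theta> k \<omega>))
      - sqrt (w k) * ((transpose \<sigma> *v grad \<phi> (\<theta> k \<omega>)) \<bullet> \<xi> (Suc k) \<omega>) - Q (\<theta> k \<omega>) (\<xi> (Suc k) \<omega>)
      - w k * Rem (\<eta> (Suc k)) (\<theta> k \<omega>) (\<xi> (Suc k) \<omega>)" for k
  proof -
    define e where "e = \<eta> (Suc k)"
    have e: "0 < e" by (simp add: e_def)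
    have w1: "w k * e = 1" "w k * sqrt e = sqrt (w k)"
      unfolding e_def by (rule w_step w_sqrt_step)+
    have "\<phi> (\<theta> (Suc k) \<omega>) - \<phi> (\<theta> k \<omega>) = sqrt e * ((transpose \<sigma> *v grad \<phi> (\<theta> k \<omega>)) \<bullet> \<xi> (Suc k) \<omega>)
        + e * (h (\<theta> k \<omega>) - integral\<^sup>L \<mu> h) + e * Q (\<theta> k \<omega>) (\<xi> (Suc k) \<omega>) + Rem e (\<theta> k \<omega>) (\<xi> (Suc k) \<omega>)"
      unfolding Rem_def \<theta>_Suc e_def by simp
    then have "w k * (\<phi> (\<theta> (Suc k) \<omega>) - \<phi> (\<theta> k \<omega>)) =
        (w k * sqrt e) * ((transpose \<sigma> *v grad \<phi> (\<theta> k \<omega>)) \<bullet> \<xi> (Suc k) \<omega>)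
        + (w k * e) * (h (\<theta> k \<omega>) - integral\<^sup>L \<mu> h) + (w k * e) * Q (\<theta> k \<omega>) (\<xi> (Suc k) \<omega>)
        + w k * Rem e (\<theta> k \<omega>) (\<xi> (Suc k) \<omega>)"
      by (simp only: distrib_left mult.assoc)
    then show ?thesis unfolding w1 unfolding e_def by simp
  qed
  moreover have "N n \<omega> = (\<Sum>k<n. - sqrt (w k) * ((transpose \<sigma> *v grad \<phi> (\<theta> k \<omega>)) \<bullet> \<xi> (Suc k) \<omega>)) / sqrt (T_sum \<eta> n)"
    by (simp add: N_def a_def real_sqrt_divide sum_divide_distrib)
  ultimately show ?thesis
    unfolding Z_def by (simp only: diff_divide_distrib[symmetric] sum_subtractf[symmetric]) (simp add: algebra_simps)
qed

lemma Z_minus_N: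
  shows Z_minus_N_integrable: "0 < n \<Longrightarrow> integrable M (\<lambda>\<omega>. Z n \<omega> - N n \<omega>)"
    and Z_minus_N_tendsto_0: "(\<lambda>n. \<integral>\<omega>. \<bar>Z n \<omega> - N n \<omega>\<bar> \<partial>M) \<longlonglongrightarrow> 0"
proof -
  define A where "A n \<omega> = (\<Sum>k<n. w k * (\<phi> (\<theta> (Suc k) \<omega>) - \<phi> (\<theta> k \<omega>)))" for n \<omega>
  define B where "B n \<omega> = (\<Sum>k<n. Q (\<theta> k \<omega>) (\<xi> (Suc k) \<omega>))" for n \<omega>
  define R where "R n \<omega> = (\<Sum>k<n. w k * Rem (\<eta> (Suc k)) (\<theta> k \<omega>) (\<xi> (Suc k) \<omega>))" for n \<omega>
  have eq: "Z n \<omega> - N n \<omega> = (A n \<omega> - B n \<omega> - R n \<omega>) / sqrt (T_sum \<eta> n)" for n \<omega>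
    unfolding A_def B_def R_def by (rule Z_decomposition)
  obtain C1 where C1: "0 \<le> C1" "\<And>n. 0 < n \<Longrightarrow> integrable M (A n)" "\<And>n. 0 < n \<Longrightarrow> (\<integral>\<omega>. \<bar>A n \<omega>\<bar> \<partial>M) \<le> C1 * (1 / \<eta> n)"
    using boundary_terms unfolding A_def by blast
  obtain C2 where C2: "0 \<le> C2" "\<And>n. integrable M (B n)" "\<And>n. (\<integral>\<omega>. \<bar>B n \<omega>\<bar> \<partial>M) \<le> sqrt (C2 * real n)"
    using quadratic_noise_terms unfolding B_def by blast
  obtain C3 where C3: "0 \<le> C3" "\<And>n. integrable M (R n)" "\<And>n. (\<integral>\<omega>. \<bar>R n \<omega>\<bar> \<partial>M) \<le> C3 * (\<Sum>k<n. sqrt (\<eta> (Suc k)))"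
    using remainder_terms unfolding R_def by blast
  show int: "integrable M (\<lambda>\<omega>. Z n \<omega> - N n \<omega>)" if "0 < n" for n
    unfolding eq using C1(2)[OF that] C2(2) C3(2) by auto
  \<comment> \<open>One summand each for the boundary terms, the quadratic noise and the remainders;
    each tends to 0 by one of the step-size limits.\<close>
  let ?u = "\<lambda>n. C1 * (1 / (\<eta> n * sqrt (T_sum \<eta> n))) + sqrt C2 * sqrt (real n / T_sum \<eta> n) +
      C3 * ((\<Sum>k<n. sqrt (\<eta> (Suc k))) / sqrt (T_sum \<eta> n))"
  show "(\<lambda>n. \<integral>\<omega>. \<bar>Z n \<omega> - N n \<omega>\<bar> \<partial>M) \<longlonglongrightarrow> 0"
  proof (rule Lim_null_comparison)
    have "?u \<longlonglongrightarrow> C1 * 0 + sqrt C2 * sqrt 0 + C3 * 0"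
      by (intro tendsto_intros \<eta>_T tendsto_real_sqrt count_over_T_sum sum_sqrt_step_over_sqrt_T_sum)
    then show "?u \<longlonglongrightarrow> 0" by simp
    show "\<forall>\<^sub>F n in sequentially. norm (\<integral>\<omega>. \<bar>Z n \<omega> - N n \<omega>\<bar> \<partial>M) \<le> ?u n"
      using eventually_gt_at_top[of 0]
    proof eventually_elim
      fix n :: nat assume n: "0 < n"
      define s where "s = sqrt (T_sum \<eta> n)"
      have s: "0 < s" using T_sum_pos[OF n] by (simp add: s_def)
      have "(\<integral>\<omega>. \<bar>Z n \<omega> - N n \<omega>\<bar> \<partial>M) \<le> (\<integral>\<omega>. (\<bar>A n \<omega>\<bar> + \<bar>B n \<omega>\<bar> + \<bar>R n \<omega>\<bar>) / s \<partial>M)"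
      proof (rule integral_mono)
        fix \<omega>
        have "\<bar>A n \<omega> - B n \<omega> - R n \<omega>\<bar> \<le> \<bar>A n \<omega>\<bar> + \<bar>B n \<omega>\<bar> + \<bar>R n \<omega>\<bar>" by linarith
        then show "\<bar>Z n \<omega> - N n \<omega>\<bar> \<le> (\<bar>A n \<omega>\<bar> + \<bar>B n \<omega>\<bar> + \<bar>R n \<omega>\<bar>) / s"
          unfolding eq s_def[symmetric] using s by (simp add: divide_right_mono)
      qed (use int[OF n] C1(2)[OF n] C2(2)[of n] C3(2)[of n] in auto)
      also have "\<dots> = ((\<integral>\<omega>. \<bar>A n \<omega>\<bar> \<partial>M) + (\<integral>\<omega>. \<bar>B n \<omega>\<bar> \<partial>M) + (\<integral>\<omega>. \<bar>R n \<omega>\<bar> \<partial>M)) / s"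
        using C1(2)[OF n] C2(2)[of n] C3(2)[of n] by simp
      also have "\<dots> \<le> (C1 * (1 / \<eta> n) + sqrt (C2 * real n) + C3 * (\<Sum>k<n. sqrt (\<eta> (Suc k)))) / s"
        using s by (intro divide_right_mono add_mono C1(3)[OF n] C2(3) C3(3)) auto
      also have "\<dots> = ?u n"
        unfolding s_def by (simp add: add_divide_distrib real_sqrt_mult real_sqrt_divide)
      finally show "norm (\<integral>\<omega>. \<bar>Z n \<omega> - N n \<omega>\<bar> \<partial>M) \<le> ?u n" by (simp add: integral_nonneg_AE)
    qed
  qed
qed

text \<open>The error splits into the mean distance between \<open>Z n\<close> and the martingale,
  through the Lipschitz bound of \<open>iexp\<close>, and the distance of the martingale from the
  Gaussian, through the mean deviation of its quadratic variation.\<close>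

lemma char_Z_tendsto:
  "(\<lambda>n. \<integral>\<omega>. iexp (s * Z n \<omega>) \<partial>M) \<longlonglongrightarrow> exp (- s\<^sup>2 * integral\<^sup>L \<mu> f / 2)"
proof (rule LIM_zero_cancel, rule Lim_null_comparison)
  define v where "v = integral\<^sup>L \<mu> f"
  have v: "0 \<le> v" unfolding v_def by (intro integral_nonneg_AE) (auto simp: f_def)
  define c where "c = 2 + s\<^sup>2 / 2 * exp (s\<^sup>2 * (v + 1) / 2) * (1 + v)"
  define V where "V n = (\<integral>\<omega>. \<bar>(\<Sum>k<n. w k * f (\<theta> k \<omega>)) / T_sum \<eta> n - v\<bar> \<partial>M)" for n
  have "(\<lambda>n. \<bar>s\<bar> * (\<integral>\<omega>. \<bar>Z n \<omega> - N n \<omega>\<bar> \<partial>M) + c * V n) \<longlonglongrightarrow> \<bar>s\<bar> * 0 + c * 0"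
    unfolding V_def v_def by (intro tendsto_intros Z_minus_N_tendsto_0 quadratic_variation)
  then show "(\<lambda>n. \<bar>s\<bar> * (\<integral>\<omega>. \<bar>Z n \<omega> - N n \<omega>\<bar> \<partial>M) + c * V n) \<longlonglongrightarrow> 0" by simp
  have [measurable]: "f \<in> borel_measurable borel" by (rule borel_measurable_continuous_onI[OF f_cont])
  show "\<forall>\<^sub>F n in sequentially. norm ((\<integral>\<omega>. iexp (s * Z n \<omega>) \<partial>M) - exp (- s\<^sup>2 * integral\<^sup>L \<mu> f / 2)) \<le>
      \<bar>s\<bar> * (\<integral>\<omega>. \<bar>Z n \<omega> - N n \<omega>\<bar> \<partial>M) + c * V n"
    using eventually_gt_at_top[of 0]
  proof eventually_elim
    fix n :: nat assume n: "0 < n"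
    have T: "0 < T_sum \<eta> n" by (rule T_sum_pos[OF n])
    have aF: "a n k \<in> borel_measurable (F k)" for k
    proof -
      note [measurable] = measurable_\<theta>_F[OF order_refl, of k]
      show ?thesis unfolding a_def by measurable
    qed
    \<comment> \<open>The quadratic variation of row \<open>n\<close> is exactly the weighted
      average of \<open>f\<close> along the chain.\<close>
    have sq: "(\<Sum>k<n. (norm (a n k \<omega>))\<^sup>2) = (\<Sum>k<n. w k * f (\<theta> k \<omega>)) / T_sum \<eta> n" for \<omega>
      using T w_pos unfolding a_def f_def
      by (simp add: power_mult_distrib sum_divide_distrib less_imp_le)
    have fi: "integrable M (\<lambda>\<omega>. f (\<theta> k \<omega>))" for k
    proof (rule integral_abs_le_sqrt(1))
      show "integrable M (\<lambda>\<omega>. (f (\<theta> k \<omega>))\<^sup>2)" using f_second_moment by blast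
    qed measurable
    have "integrable M (\<lambda>\<omega>. \<Sum>k<n. (norm (a n k \<omega>))\<^sup>2)"
      unfolding sq using fi by auto
    from martingale_char_bound[OF aF v this, of s]
    have 1: "cmod ((\<integral>\<omega>. iexp (s * N n \<omega>) \<partial>M) - exp (- s\<^sup>2 * v / 2)) \<le> c * V n"
      unfolding sq by (simp only: N_def c_def V_def)
    have eq: "(\<integral>\<omega>. iexp (s * Z n \<omega>) \<partial>M) - (\<integral>\<omega>. iexp (s * N n \<omega>) \<partial>M) = (\<integral>\<omega>. iexp (s * Z n \<omega>) - iexp (s * N n \<omega>) \<partial>M)"
      by (intro Bochner_Integration.integral_diff[symmetric] integrable_const_bound[of _ 1]) auto
    have "cmod ((\<integral>\<omega>. iexp (s * Z n \<omega>) \<partial>M) - (\<integral>\<omega>. iexp (s * N n \<omega>) \<partial>M)) \<le> (\<integral>\<omega>. cmod (iexp (s * Z n \<omega>) - iexp (s * N n \<omega>)) \<partial>M)"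
      unfolding eq by (rule integral_norm_bound)
    also have "\<dots> \<le> (\<integral>\<omega>. \<bar>s\<bar> * \<bar>Z n \<omega> - N n \<omega>\<bar> \<partial>M)"
    proof (rule integral_mono)
      fix \<omega>
      have "iexp (s * Z n \<omega>) - iexp (s * N n \<omega>) = iexp (s * N n \<omega>) * (iexp (s * (Z n \<omega> - N n \<omega>)) - 1)"
        by (simp add: right_diff_distrib exp_add[symmetric])
      then have "cmod (iexp (s * Z n \<omega>) - iexp (s * N n \<omega>)) = cmod (iexp (s * (Z n \<omega> - N n \<omega>)) - 1)"
        by (simp only: norm_mult norm_exp_i_times mult_1_left)
      also have "\<dots> \<le> \<bar>s * (Z n \<omega> - N n \<omega>)\<bar>"
        using iexp_approx1[of "s * (Z n \<omega> - N n \<omega>)" 0] by simp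
      finally show "cmod (iexp (s * Z n \<omega>) - iexp (s * N n \<omega>)) \<le> \<bar>s\<bar> * \<bar>Z n \<omega> - N n \<omega>\<bar>" by (simp only: abs_mult)
      have "cmod (iexp (s * Z n \<omega>) - iexp (s * N n \<omega>)) \<le> 2" for \<omega>
        using norm_triangle_ineq4[of "iexp (s * Z n \<omega>)" "iexp (s * N n \<omega>)"] by simp
      then show "integrable M (\<lambda>\<omega>. cmod (iexp (s * Z n \<omega>) - iexp (s * N n \<omega>)))"
        by (intro integrable_const_bound[of _ 2] AE_I2) (simp, measurable)
      show "integrable M (\<lambda>\<omega>. \<bar>s\<bar> * \<bar>Z n \<omega> - N n \<omega>\<bar>)" using Z_minus_N_integrable[OF n] by auto
    qed
    also have "\<dots> = \<bar>s\<bar> * (\<integral>\<omega>. \<bar>Z n \<omega> - N n \<omega>\<bar> \<partial>M)" by simp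
    finally have 2: "cmod ((\<integral>\<omega>. iexp (s * Z n \<omega>) \<partial>M) - (\<integral>\<omega>. iexp (s * N n \<omega>) \<partial>M)) \<le> \<bar>s\<bar> * (\<integral>\<omega>. \<bar>Z n \<omega> - N n \<omega>\<bar> \<partial>M)" .
    show "norm ((\<integral>\<omega>. iexp (s * Z n \<omega>) \<partial>M) - exp (- s\<^sup>2 * integral\<^sup>L \<mu> f / 2)) \<le>
        \<bar>s\<bar> * (\<integral>\<omega>. \<bar>Z n \<omega> - N n \<omega>\<bar> \<partial>M) + c * V n"
      using norm_triangle_mono[OF 2 1] by (simp add: v_def)
  qed
qed

lemma weak_convergence:
  "weak_conv_m
    (\<lambda>n. distr M borel (\<lambda>\<omega>. real n / sqrt (T_sum \<eta> n) *
       (integral\<^sup>L (empirical_measure (\<lambda>k. \<theta> k \<omega>) n) h - integral\<^sup>L \<mu> h)))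
    (centred_normal (integral\<^sup>L \<mu> f))"
proof -
  \<comment> \<open>For \<open>n = 0\<close> both sides are 0 by the conventions on
    division.\<close>
  have Z: "real n / sqrt (T_sum \<eta> n) * (integral\<^sup>L (empirical_measure (\<lambda>k. \<theta> k \<omega>) n) h - integral\<^sup>L \<mu> h) = Z n \<omega>" for n \<omega>
    by (cases "n = 0")
      (simp_all add: integral_empirical_measure Z_def sum_subtractf right_diff_distrib diff_divide_distrib)
  have v: "0 \<le> integral\<^sup>L \<mu> f" by (intro integral_nonneg_AE) (auto simp: f_def)
  interpret std: prob_space std_normal_distribution by (rule prob_space_normal_density) simp
  show ?thesis
    unfolding Z
  proof (rule levy_continuity)
    show "real_distribution (distr M borel (Z n))" for n
      by (rule real_distribution.intro) (auto intro!: prob_space_distr simp: real_distribution_axioms_def)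
    show "real_distribution (centred_normal (integral\<^sup>L \<mu> f))"
      unfolding centred_normal_def
      by (rule real_distribution.intro) (auto intro!: std.prob_space_distr simp: real_distribution_axioms_def)
    fix s
    have "char (centred_normal (integral\<^sup>L \<mu> f)) s = char std_normal_distribution (s * sqrt (integral\<^sup>L \<mu> f))"
      unfolding char_def centred_normal_def by (subst integral_distr) (auto simp: mult.assoc)
    also have "\<dots> = exp (- s\<^sup>2 * integral\<^sup>L \<mu> f / 2)"
      using v by (simp add: char_std_normal_distribution power_mult_distrib)
    finally have "char (centred_normal (integral\<^sup>L \<mu> f)) s = exp (- s\<^sup>2 * integral\<^sup>L \<mu> f / 2)" .
    moreover have "char (distr M borel (Z n)) s = (\<integral>\<omega>. iexp (s * Z n \<omega>) \<partial>M)" for n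
      unfolding char_def by (subst integral_distr) auto
    ultimately show "(\<lambda>n. char (distr M borel (Z n)) s) \<longlonglongrightarrow> char (centred_normal (integral\<^sup>L \<mu> f)) s"
      using char_Z_tendsto[of s] by simp
  qed
qed

end

section \<open>From the step-size assumptions to the theorem\<close>

lemma square_summable_of_powr:
  fixes \<eta> :: "nat \<Rightarrow> real"
  assumes "\<And>k. 1 \<le> k \<Longrightarrow> 0 < \<eta> k \<and> \<eta> k < 1" "0 < \<epsilon>" "summable (\<lambda>k. \<eta> (Suc k) powr (2 - \<epsilon>))"
  shows "summable (\<lambda>k. (\<eta> (Suc k))\<^sup>2)"
proof (rule summable_comparison_test'[OF assms(3)])
  fix k :: nat
  have \<eta>: "0 < \<eta> (Suc k)" "\<eta> (Suc k) < 1" using assms(1)[of "Suc k"] by auto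
  have "(\<eta> (Suc k))\<^sup>2 = \<eta> (Suc k) powr 2" using \<eta> by (simp add: powr_numeral)
  also have "\<dots> \<le> \<eta> (Suc k) powr (2 - \<epsilon>)" using \<eta> assms(2) by (intro powr_mono') auto
  finally show "norm ((\<eta> (Suc k))\<^sup>2) \<le> \<eta> (Suc k) powr (2 - \<epsilon>)" by simp
qed

text \<open>The numerator \<open>Ln n\<close> is eventually at least 1, so the given null sequence
  dominates.\<close>

lemma step_T_sum_tendsto_0:
  fixes \<eta> Ln :: "nat \<Rightarrow> real"
  assumes \<eta>: "\<And>k. 1 \<le> k \<Longrightarrow> 0 < \<eta> k" and Ln: "filterlim Ln at_top sequentially"
    and lim: "(\<lambda>n. Ln n / (\<eta> n * sqrt (T_sum \<eta> n))) \<longlonglongrightarrow> 0"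
  shows "(\<lambda>n. 1 / (\<eta> n * sqrt (T_sum \<eta> n))) \<longlonglongrightarrow> 0"
proof (rule Lim_null_comparison[OF _ lim])
  have "\<forall>\<^sub>F n in sequentially. 1 \<le> Ln n" using Ln by (simp add: filterlim_at_top)
  then show "\<forall>\<^sub>F n in sequentially. norm (1 / (\<eta> n * sqrt (T_sum \<eta> n))) \<le> Ln n / (\<eta> n * sqrt (T_sum \<eta> n))"
    using eventually_gt_at_top[of 0]
  proof eventually_elim
    case (elim n)
    have "0 \<le> T_sum \<eta> n"
      unfolding T_sum_def using \<eta> by (intro sum_nonneg) (auto intro: less_imp_le)
    then have "0 \<le> \<eta> n * sqrt (T_sum \<eta> n)" using \<eta>[of n] elim by (auto intro!: mult_nonneg_nonneg)
    then show ?case using elim by (simp add: divide_right_mono)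
  qed
qed

theorem theorem2p5:
  fixes b :: "real^'n \<Rightarrow> real^'n"
    and \<sigma> :: "real^'n^'n"
    and h \<phi> :: "real^'n \<Rightarrow> real"
    and W :: "'w measure"
    and B :: "real \<Rightarrow> 'w \<Rightarrow> real^'n"
    and X :: "real^'n \<Rightarrow> real \<Rightarrow> 'w \<Rightarrow> real^'n"
    and \<mu> :: "(real^'n) measure"
  assumes "coeff_assumption b \<sigma>"
    and "\<exists>L. L-lipschitz_on UNIV h"
    and "standard_brownian_motion W B"
    and "\<And>x. strong_solution W B b \<sigma> x (X x)"
    and "invariant_probability_measure W X \<mu>"
    and "poisson_solution b \<sigma> \<mu> h \<phi>"
  shows "\<exists>\<eta>'>0. \<forall>\<eta> :: nat \<Rightarrow> real.
    (\<forall>k\<ge>1. 0 < \<eta> k \<and> \<eta> k < 1) \<and> step0_assumption \<eta> \<and> step1_assumption \<eta> \<and> \<eta> 1 \<le> \<eta>' \<longrightarrow>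
    (\<forall>(x :: real^'n) (M :: 'a measure) \<xi>. iid_standard_normal M \<xi> \<longrightarrow>
      weak_conv_m
        (\<lambda>n. distr M borel (\<lambda>\<omega>. real n / sqrt (T_sum \<eta> n) *
           (integral\<^sup>L (empirical_measure (\<lambda>k. euler_maruyama b \<sigma> \<eta> \<xi> x k \<omega>) n) h
            - integral\<^sup>L \<mu> h)))
        (centred_normal (\<integral>y. (norm (transpose \<sigma> *v grad \<phi> y))\<^sup>2 \<partial>\<mu>)))"
proof -
  obtain L K1 K2 where "0 < L" "\<And>x y. norm (b x - b y) \<le> L * norm (x - y)" "0 < K1" "0 \<le> K2"
    "\<And>x y. (b x - b y) \<bullet> (x - y) \<le> - K1 * (norm (x - y))\<^sup>2 + K2" "invertible \<sigma>"
    using assms(1) unfolding coeff_assumption_def by blast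
  then interpret em_kernel b \<sigma> L K1 K2 by unfold_locales
  have sde: "em_sde b \<sigma> L K1 K2 W B X \<mu>"
    using assms(3-5) by (intro em_sde.intro em_kernel_axioms em_sde_axioms.intro) auto
  have h: "continuous_on UNIV h"
    using assms(2) by (auto intro: lipschitz_on_continuous_on)
  show ?thesis
  \<comment> \<open>The threshold is the one up to which the drift estimates hold; monotonicity
    carries \<open>\<eta> 1 \<le> e0\<close> over to all steps.\<close>
  proof (intro exI[of _ e0] conjI allI impI e0(1))
    fix \<eta> :: "nat \<Rightarrow> real" and x :: "real^'n" and M :: "'a measure" and \<xi> :: "nat \<Rightarrow> 'a \<Rightarrow> real^'n"
    assume *: "(\<forall>k\<ge>1. 0 < \<eta> k \<and> \<eta> k < 1) \<and> step0_assumption \<eta> \<and> step1_assumption \<eta> \<and> \<eta> 1 \<le> e0"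
      and iid: "iid_standard_normal M \<xi>"
    then have pos: "\<And>k. 1 \<le> k \<Longrightarrow> 0 < \<eta> k \<and> \<eta> k < 1" and dec: "\<And>k. 1 \<le> k \<Longrightarrow> \<eta> (Suc k) \<le> \<eta> k"
      by (auto simp: step0_assumption_def)
    have le: "\<eta> k \<le> e0" if "1 \<le> k" for k
      using that
    proof (induction k rule: dec_induct)
      case (step n)
      then show ?case using dec[of n] by simp
    qed (use * in simp)
    obtain \<epsilon> Ln where "0 < \<epsilon>" "summable (\<lambda>k. \<eta> (Suc k) powr (2 - \<epsilon>))" "filterlim Ln at_top sequentially"
      "(\<lambda>n. Ln n / (\<eta> n * sqrt (T_sum \<eta> n))) \<longlonglongrightarrow> 0"
      using * unfolding step1_assumption_def by blast
    then have sq: "summable (\<lambda>k. (\<eta> (Suc k))\<^sup>2)" and T: "(\<lambda>n. 1 / (\<eta> n * sqrt (T_sum \<eta> n))) \<longlonglongrightarrow> 0"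
      using pos square_summable_of_powr step_T_sum_tendsto_0 by blast+
    have noise: "iid_noise M \<xi>"
      using iid by (intro iid_noise.intro iid_noise_axioms.intro) (auto simp: iid_standard_normal_def)
    have chain: "em_chain b \<sigma> L K1 K2 M \<xi> \<eta>"
      using pos by (intro em_chain.intro em_kernel_axioms noise em_chain_axioms.intro) auto
    have "em_full b \<sigma> L K1 K2 W B X \<mu> M \<xi> \<eta>"
      using dec le sq T by (intro em_full.intro sde chain em_full_axioms.intro) auto
    then interpret em_poisson b \<sigma> L K1 K2 W B X \<mu> M \<xi> \<eta> x h \<phi>
      using h assms(6) by (intro em_poisson.intro em_poisson_axioms.intro) auto
    show "weak_conv_m
        (\<lambda>n. distr M borel (\<lambda>\<omega>. real n / sqrt (T_sum \<eta> n) *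
           (integral\<^sup>L (empirical_measure (\<lambda>k. euler_maruyama b \<sigma> \<eta> \<xi> x k \<omega>) n) h
            - integral\<^sup>L \<mu> h)))
        (centred_normal (\<integral>y. (norm (transpose \<sigma> *v grad \<phi> y))\<^sup>2 \<partial>\<mu>))"
      using weak_convergence unfolding f_def .
  qed
qed

end
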